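(* Let $n\ge1$. Suppose that $V:\mathbb{R}^n\to\mathbb{R}$ is continuous and that $-\Delta+V$ has a negative eigenvalue with a positive eigenfunction which decays exponentially fast. Let $\phi,\psi\ge0$ be continuous functions of compact support on $\mathbb{R}^n$ and suppose that $\psi$ is not identically zero. If $(u,u_t)\in C([0,T);H^1(\mathbb{R}^n)\times L^2(\mathbb{R}^n))$ satisfies $$\partial_t^2u-\Delta u+V(x)u=A|u|^p,\qquad u(x,0)=\phi(x),\quad \partial_tu(x,0)=\psi(x)$$ for some $A>0$ and $p>1$, then $\|u(\cdot,t)\|_{L^q(\mathbb{R}^n)}$ blows up in finite time for each $1\le q\le\infty$.
   Context: The hypothesis on $-\Delta+V$ means: there are $\lambda>0$ and a function $\chi>0$ on $\mathbb{R}^n$ with $(-\Delta+V)\chi=-\lambda\chi$ and $\chi(x)\le C_0e^{-c|x|}$ for some constants $C_0,c>0$. The equation for $u$ is understood in the sense of distributions; $u(\cdot,t)$ has compact support for each $t$ (finite speed of propagation, the data being of compact support). "Blows up in finite time" means that the norm becomes infinite at some finite time: there is a finite $T_*$ (depending on $n,V,A,p,\phi,\psi$) such that, for $T>T_*$, there is no function $u$ with $(u,u_t)\in C([0,T);H^1(\mathbb{R}^n)\times L^2(\mathbb{R}^n))$ and with $u(\cdot,t)$ of compact support for each $t\in[0,T)$ that satisfies $\partial_t^2u-\Delta u+V(x)u=A|u|^p$ on $\mathbb{R}^n\times(0,T)$, $u(x,0)=\phi(x)$, $\partial_tu(x,0)=\psi(x)$, and for which $\|u(\cdot,t)\|_{L^q(\mathbb{R}^n)}$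 is finite for every $t\in[0,T)$. *)

theory Defs
  imports "HOL-Analysis.Analysis" "HOL-Probability.Essential_Supremum"
begin

text \<open>Elements of Lebesgue and Sobolev spaces are represented by Borel functions. Norms, weak
  derivatives, compact support and initial values are insensitive to changes on null sets, and a
  continuous curve in \<open>L\<^sup>2\<close> has a jointly Borel version, so nothing is lost by this.\<close>

section \<open>Test functions and distributions\<close>

definition dir_deriv :: "'a::euclidean_space \<Rightarrow> ('a \<Rightarrow> real) \<Rightarrow> 'a \<Rightarrow> real" where
  "dir_deriv b f x = frechet_derivative f (at x) b"

definition laplacian :: "('a::euclidean_space \<Rightarrow> real) \<Rightarrow> 'a \<Rightarrow> real" where
  "laplacian f x = (\<Sum>b\<in>Basis. dir_deriv b (dir_deriv b f) x)"

fun Ck :: "nat \<Rightarrow> ('a::euclidean_space \<Rightarrow> real) \<Rightarrow> bool" where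
  "Ck 0 f \<longleftrightarrow> continuous_on UNIV f"
| "Ck (Suc k) f \<longleftrightarrow> f differentiable_on UNIV \<and> (\<forall>b\<in>Basis. Ck k (dir_deriv b f))"

definition test_function :: "'a::euclidean_space set \<Rightarrow> ('a \<Rightarrow> real) \<Rightarrow> bool" where
  "test_function \<Omega> \<eta> \<longleftrightarrow>
     (\<forall>k. Ck k \<eta>) \<and> compact (closure {x. \<eta> x \<noteq> 0}) \<and> closure {x. \<eta> x \<noteq> 0} \<subseteq> \<Omega>"

definition locally_integrable :: "'a::euclidean_space set \<Rightarrow> ('a \<Rightarrow> real) \<Rightarrow> bool" where
  "locally_integrable \<Omega> f \<longleftrightarrow> (\<forall>K. compact K \<and> K \<subseteq> \<Omega> \<longrightarrow> set_integrable lborel K f)"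

text \<open>The derivative of \<open>f\<close> in direction \<open>b\<close>, in the sense of distributions on the open set \<open>\<Omega>\<close>,
  is the locally integrable function \<open>g\<close>. The test functions are defined on the whole space and
  vanish outside \<open>\<Omega>\<close>.\<close>

definition weak_deriv ::
    "'a::euclidean_space set \<Rightarrow> 'a \<Rightarrow> ('a \<Rightarrow> real) \<Rightarrow> ('a \<Rightarrow> real) \<Rightarrow> bool" where
  "weak_deriv \<Omega> b f g \<longleftrightarrow> locally_integrable \<Omega> f \<and> locally_integrable \<Omega> g \<and>
     (\<forall>\<eta>. test_function \<Omega> \<eta> \<longrightarrow>
        (LINT x|lborel. f x * dir_deriv b \<eta> x) = - (LINT x|lborel. g x * \<eta> x))"

section \<open>Function spaces\<close>

definition Lp_norm :: "ennreal \<Rightarrow> ('a::euclidean_space \<Rightarrow> real) \<Rightarrow> ennreal" where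
  "Lp_norm q f =
     (if q = \<infinity> then esssup lborel (\<lambda>x. ennreal \<bar>f x\<bar>)
      else let I = (\<integral>\<^sup>+x. ennreal (\<bar>f x\<bar> powr enn2real q) \<partial>lborel)
           in if I = \<infinity> then \<infinity> else ennreal (enn2real I powr (1 / enn2real q)))"

definition in_L2 :: "('a::euclidean_space \<Rightarrow> real) \<Rightarrow> bool" where
  "in_L2 f \<longleftrightarrow> f \<in> borel_measurable lborel \<and> Lp_norm 2 f < \<infinity>"

definition L2_norm :: "('a::euclidean_space \<Rightarrow> real) \<Rightarrow> real" where
  "L2_norm f = enn2real (Lp_norm 2 f)"

definition in_H1 :: "('a::euclidean_space \<Rightarrow> real) \<Rightarrow> bool" where
  "in_H1 f \<longleftrightarrow> in_L2 f \<and> (\<forall>b\<in>Basis. \<exists>g. in_L2 g \<and> weak_deriv UNIV b f g)"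

text \<open>Weak derivatives are unique up to null sets, so the norm does not depend on the choice made
  here.\<close>

definition weak_partial :: "'a::euclidean_space \<Rightarrow> ('a \<Rightarrow> real) \<Rightarrow> 'a \<Rightarrow> real" where
  "weak_partial b f = (SOME g. in_L2 g \<and> weak_deriv UNIV b f g)"

definition H1_norm :: "('a::euclidean_space \<Rightarrow> real) \<Rightarrow> real" where
  "H1_norm f = sqrt ((L2_norm f)\<^sup>2 + (\<Sum>b\<in>Basis. (L2_norm (weak_partial b f))\<^sup>2))"

text \<open>\<open>u \<in> C([0,T); X)\<close>, for a space \<open>X\<close> of functions given by a membership predicate and a norm.\<close>

definition continuous_curve ::
    "(('a \<Rightarrow> real) \<Rightarrow> bool) \<Rightarrow> (('a \<Rightarrow> real) \<Rightarrow> real) \<Rightarrow> real \<Rightarrow> (real \<Rightarrow> 'a \<Rightarrow> real) \<Rightarrow> bool" where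
  "continuous_curve inX normX T u \<longleftrightarrow> (\<forall>t\<in>{0..<T}. inX (u t)) \<and>
     (\<forall>s\<in>{0..<T}. ((\<lambda>t. normX (\<lambda>x. u t x - u s x)) \<longlongrightarrow> 0) (at s within {0..<T}))"

definition compactly_supported :: "('a::euclidean_space \<Rightarrow> real) \<Rightarrow> bool" where
  "compactly_supported f \<longleftrightarrow> (\<exists>K. compact K \<and> (AE x in lborel. x \<notin> K \<longrightarrow> f x = 0))"

section \<open>Eigenfunctions of the Schroedinger operator\<close>

text \<open>\<open>(-\<Delta> + V) w = \<mu> w\<close> in the sense of distributions, since \<open>V\<close> is merely continuous and \<open>w\<close>
  need not be twice continuously differentiable.\<close>

definition schroedinger_eigen_eq ::
    "('a::euclidean_space \<Rightarrow> real) \<Rightarrow> real \<Rightarrow> ('a \<Rightarrow> real) \<Rightarrow> bool" where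
  "schroedinger_eigen_eq V \<mu> w \<longleftrightarrow> locally_integrable UNIV w \<and>
     (\<forall>\<eta>. test_function UNIV \<eta> \<longrightarrow>
        (LINT x|lborel. w x * (- laplacian \<eta> x + V x * \<eta> x)) = \<mu> * (LINT x|lborel. w x * \<eta> x))"

definition exponentially_decaying :: "('a::euclidean_space \<Rightarrow> real) \<Rightarrow> bool" where
  "exponentially_decaying w \<longleftrightarrow> (\<exists>C\<^sub>0>0. \<exists>c>0. \<forall>x. w x \<le> C\<^sub>0 * exp (- c * norm x))"

definition has_positive_bound_state :: "('a::euclidean_space \<Rightarrow> real) \<Rightarrow> bool" where
  "has_positive_bound_state V \<longleftrightarrow>
     (\<exists>lam>0. \<exists>w. (\<forall>x. w x > 0) \<and> exponentially_decaying w \<and> schroedinger_eigen_eq V (- lam) w)"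

section \<open>The nonlinear wave equation\<close>

definition space_time :: "real \<Rightarrow> ('a::euclidean_space \<times> real) set" where
  "space_time T = UNIV \<times> {0<..<T}"

definition wave_op ::
    "('a::euclidean_space \<Rightarrow> real) \<Rightarrow> ('a \<times> real \<Rightarrow> real) \<Rightarrow> 'a \<times> real \<Rightarrow> real" where
  "wave_op V \<eta> z = dir_deriv (0, 1) (dir_deriv (0, 1) \<eta>) z
     - (\<Sum>b\<in>Basis. dir_deriv (b, 0) (dir_deriv (b, 0) \<eta>) z) + V (fst z) * \<eta> z"

text \<open>\<open>\<partial>\<^sub>t\<^sup>2 u - \<Delta> u + V u = A \<bar>u\<bar>\<^sup>p\<close> in the sense of distributions on \<open>\<real>\<^sup>n \<times> (0,T)\<close>; for this \<open>u\<close> and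
  \<open>\<bar>u\<bar>\<^sup>p\<close> have to be distributions, i.e. locally integrable. The operator is its own transpose.\<close>

definition wave_eq ::
    "('a::euclidean_space \<Rightarrow> real) \<Rightarrow> real \<Rightarrow> real \<Rightarrow> real \<Rightarrow> (real \<Rightarrow> 'a \<Rightarrow> real) \<Rightarrow> bool" where
  "wave_eq V A p T u \<longleftrightarrow>
     locally_integrable (space_time T) (\<lambda>(x, t). u t x) \<and>
     locally_integrable (space_time T) (\<lambda>(x, t). \<bar>u t x\<bar> powr p) \<and>
     (\<forall>\<eta>. test_function (space_time T) \<eta> \<longrightarrow>
        (LINT (x, t)|lborel. u t x * wave_op V \<eta> (x, t))
          = (LINT (x, t)|lborel. A * \<bar>u t x\<bar> powr p * \<eta> (x, t)))"

text \<open>\<open>(u, u\<^sub>t) \<in> C([0,T); H\<^sup>1 \<times> L\<^sup>2)\<close> solves the Cauchy problem with data \<open>(\<phi>, \<psi>)\<close>; \<open>v\<close> is \<open>u\<^sub>t\<close>.\<close>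

definition cauchy_solution ::
    "('a::euclidean_space \<Rightarrow> real) \<Rightarrow> real \<Rightarrow> real \<Rightarrow> ('a \<Rightarrow> real) \<Rightarrow> ('a \<Rightarrow> real) \<Rightarrow>
     real \<Rightarrow> (real \<Rightarrow> 'a \<Rightarrow> real) \<Rightarrow> bool" where
  "cauchy_solution V A p \<phi> \<psi> T u \<longleftrightarrow> (\<exists>v.
     continuous_curve in_H1 H1_norm T u \<and>
     continuous_curve in_L2 L2_norm T v \<and>
     weak_deriv (space_time T) (0, 1) (\<lambda>(x, t). u t x) (\<lambda>(x, t). v t x) \<and>
     wave_eq V A p T u \<and>
     (AE x in lborel. u 0 x = \<phi> x) \<and> (AE x in lborel. v 0 x = \<psi> x))"

end

theory Submission
  imports Defs
begin

text \<open>Let \<open>w > 0\<close> be the bound state, \<open>(-\<Delta> + V) w = -\<lambda> w\<close>. If the equation could be paired with \<open>w\<close>,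
the moment \<open>F(t) = \<integral> u(x,t) w(x) dx\<close> would satisfy
\<open>F'' = \<lambda> F + A \<integral> \<bar>u\<bar>\<^sup>p w \<ge> \<lambda> F + B \<bar>F\<bar>\<^sup>p\<close> by Jensen's inequality, because \<open>w\<close> is integrable. Since
\<open>F(0) = \<integral> \<phi> w \<ge> 0\<close> and \<open>F'(0) = \<integral> \<psi> w > 0\<close>, this forces \<open>F\<close> to become infinite before a time that
depends on \<open>F'(0)\<close>, \<open>B\<close> and \<open>p\<close> alone.

The function \<open>w\<close> is no test function: it has no compact support, and it solves its equation only in
the sense of distributions. It is replaced by \<open>\<theta> = \<zeta>(x/R) (w * j)\<close> with a cutoff \<open>\<zeta>\<close> and a mollifier
\<open>j\<close>. Two errors arise in \<open>(-\<Delta> + V + \<lambda>) \<theta>\<close>. One comes from \<open>V\<close> not commuting with the mollification;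
it is small since \<open>V\<close> is uniformly continuous on the support of the cutoff. The other contains the
derivatives of the cutoff, which are of order \<open>1/R\<close>; after an integration by parts
(\<open>laplacian_by_parts\<close>) the derivative of \<open>w * j\<close> falls on the solution, which lies in \<open>H\<^sup>1\<close>. Hence
\<open>(-\<Delta> + V + \<lambda>) \<theta>\<close> is arbitrarily small as a functional on \<open>H\<^sup>1\<close>, whereas \<open>\<theta>\<close> stays below a fixed multiple
of \<open>exp(-c\<bar>x\<bar>)\<close> and \<open>\<integral> \<psi> \<theta>\<close> stays above a fixed \<open>b > 0\<close>. This is \<open>bound_state_approximation\<close>, the
heart of the proof.

For a solution on \<open>[0,T)\<close> and \<open>T\<^sub>* < T\<close> the functional is then at most a small number \<open>\<kappa>\<close> along
the whole curve \<open>u(t)\<close>, \<open>0 \<le> t \<le> T\<^sub>*\<close>, so that the moment of \<open>\<theta>\<close> satisfies, weakly in time,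
\<open>F'' \<ge> \<lambda> F + B max(0,F)\<^sup>p - \<kappa>\<close> (\<open>moment_weak_inequality\<close>). Here \<open>B\<close> and \<open>b\<close> do not depend on the solution,
although \<open>\<theta>\<close> does. Mollifying in time turns weak inequalities into integrated ones (\<open>weak_increment\<close>),
and \<open>perturbed_blowup\<close> bounds \<open>T\<^sub>*\<close> as soon as \<open>\<kappa> T\<^sub>* \<le> b/2\<close>.\<close>

section \<open>Calculus of continuously differentiable functions\<close>

abbreviation smooth :: "('a::euclidean_space \<Rightarrow> real) \<Rightarrow> bool" where
  "smooth f \<equiv> \<forall>k. Ck k f"

lemma dir_deriv_eqI:
  assumes "(f has_derivative f') (at x)" shows "dir_deriv b f x = f' b"
  using frechet_derivative_at[OF assms] by (simp add: dir_deriv_def)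

lemma Ck_differentiable:
  assumes "Ck (Suc k) f" shows "(f has_derivative (\<lambda>h. dir_deriv h f x)) (at x)"
proof -
  from assms have "f differentiable (at x)" by (auto simp: differentiable_on_def)
  then show ?thesis unfolding dir_deriv_def frechet_derivative_works by simp
qed

text \<open>The classes \<open>Ck\<close> only speak of derivatives along basis vectors; all other directional derivatives
are reduced to these.\<close>

lemma dir_deriv_expand:
  fixes f :: "'a::euclidean_space \<Rightarrow> real"
  assumes "f differentiable (at x)"
  shows "dir_deriv h f x = (\<Sum>b\<in>Basis. (h \<bullet> b) * dir_deriv b f x)"
proof -
  have l: "linear (frechet_derivative f (at x))"
    using assms by (rule linear_frechet_derivative)
  have "frechet_derivative f (at x) h = frechet_derivative f (at x) (\<Sum>b\<in>Basis. (h \<bullet> b) *\<^sub>R b)"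
    by (simp add: euclidean_representation)
  also have "\<dots> = (\<Sum>b\<in>Basis. (h \<bullet> b) *\<^sub>R frechet_derivative f (at x) b)"
    using l by (simp add: linear_sum linear_scale)
  finally show ?thesis by (simp add: dir_deriv_def)
qed

lemma Ck_continuous: "Ck k f \<Longrightarrow> continuous_on UNIV f"
  by (cases k) (auto intro: differentiable_imp_continuous_on)

lemma Ck_Suc_D: "Ck (Suc k) f \<Longrightarrow> Ck k f"
proof (induction k arbitrary: f)
  case 0
  then show ?case using Ck_continuous Ck.simps(1) by blast
next
  case (Suc k)
  then show ?case by (metis Ck.simps(2))
qed

text \<open>Taking partial derivatives never leads out of the class \<open>P\<close>, so all iterated derivatives exist and
are continuous. This coinductive principle proves smoothness for families such as \<open>flat\<close> and \<open>mollify\<close>,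
whose derivatives are again members of the family.\<close>

lemma smoothI:
  assumes "\<And>f. P f \<Longrightarrow> f differentiable_on UNIV"
    and "\<And>f b. P f \<Longrightarrow> b \<in> Basis \<Longrightarrow> P (dir_deriv b f)"
    and "P f"
  shows "smooth f"
proof
  fix k show "Ck k f" using assms(3)
  proof (induction k arbitrary: f)
    case 0
    then show ?case using assms(1) by (auto intro: differentiable_imp_continuous_on)
  next
    case (Suc k)
    then show ?case using assms(1,2) by auto
  qed
qed

lemma smooth_dir_deriv: "smooth f \<Longrightarrow> b \<in> Basis \<Longrightarrow> smooth (dir_deriv b f)"
  by (metis Ck.simps(2))

lemma smooth_has_derivative:
  "smooth f \<Longrightarrow> (f has_derivative (\<lambda>h. dir_deriv h f x)) (at x)"
  by (metis Ck_differentiable)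

lemma smooth_continuous: "smooth f \<Longrightarrow> continuous_on UNIV f"
  by (metis Ck_continuous)

lemma dir_deriv_add:
  assumes "f differentiable_on UNIV" "g differentiable_on UNIV"
  shows "dir_deriv b (\<lambda>x. f x + g x) = (\<lambda>x. dir_deriv b f x + dir_deriv b g x)"
proof
  fix x
  have "(f has_derivative frechet_derivative f (at x)) (at x)"
    "(g has_derivative frechet_derivative g (at x)) (at x)"
    using assms by (auto simp: differentiable_on_def frechet_derivative_works)
  from dir_deriv_eqI[OF has_derivative_add[OF this]]
  show "dir_deriv b (\<lambda>x. f x + g x) x = dir_deriv b f x + dir_deriv b g x"
    by (simp add: dir_deriv_def)
qed

lemma dir_deriv_mult:
  assumes "f differentiable_on UNIV" "g differentiable_on UNIV"
  shows "dir_deriv b (\<lambda>x. f x * g x) = (\<lambda>x. f x * dir_deriv b g x + dir_deriv b f x * g x)"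
proof
  fix x
  have "(f has_derivative frechet_derivative f (at x)) (at x)"
    "(g has_derivative frechet_derivative g (at x)) (at x)"
    using assms by (auto simp: differentiable_on_def frechet_derivative_works)
  from dir_deriv_eqI[OF has_derivative_mult[OF this]]
  show "dir_deriv b (\<lambda>x. f x * g x) x = f x * dir_deriv b g x + dir_deriv b f x * g x"
    by (simp add: dir_deriv_def)
qed

lemma dir_deriv_const: "dir_deriv b (\<lambda>x. c) = (\<lambda>x. 0)"
  using dir_deriv_eqI[OF has_derivative_const] by blast

lemma Ck_const: "Ck k (\<lambda>x. c)"
  by (induction k arbitrary: c) (auto simp: dir_deriv_const)

lemma Ck_add: "Ck k f \<Longrightarrow> Ck k g \<Longrightarrow> Ck k (\<lambda>x. f x + g x)"
  by (induction k arbitrary: f g)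
     (auto intro!: continuous_intros differentiable_on_add simp: dir_deriv_add)

lemma Ck_mult: "Ck k f \<Longrightarrow> Ck k g \<Longrightarrow> Ck k (\<lambda>x. f x * g x)"
proof (induction k arbitrary: f g)
  case 0
  then show ?case by (auto intro!: continuous_intros)
next
  case (Suc k)
  have fg: "Ck k f" "Ck k g" using Suc.prems Ck_Suc_D by blast+
  show ?case
    using Suc fg by (auto intro!: differentiable_on_mult Ck_add simp: dir_deriv_mult)
qed

lemma Ck_sum: "(\<And>i. i \<in> I \<Longrightarrow> Ck k (f i)) \<Longrightarrow> Ck k (\<lambda>x. \<Sum>i\<in>I. f i x)"
  by (induction I rule: infinite_finite_induct) (auto intro!: Ck_const Ck_add)

lemma Ck_prod: "(\<And>i. i \<in> I \<Longrightarrow> Ck k (f i)) \<Longrightarrow> Ck k (\<lambda>x. \<Prod>i\<in>I. f i x)"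
  by (induction I rule: infinite_finite_induct) (auto intro!: Ck_const Ck_mult)

lemma dir_deriv_affine:
  fixes f :: "'b::euclidean_space \<Rightarrow> real" and L :: "'a::euclidean_space \<Rightarrow> 'b"
  assumes f: "f differentiable_on UNIV" and L: "linear L"
  shows "dir_deriv b (\<lambda>x. f (L x + a)) = (\<lambda>x. dir_deriv (L b) f (L x + a))"
proof
  fix x
  have d: "((\<lambda>x. L x + a) has_derivative L) (at x)"
    by (rule derivative_eq_intros refl linear_imp_has_derivative L | simp)+
  have "(f has_derivative frechet_derivative f (at (L x + a))) (at (L x + a))"
    using f by (auto simp: differentiable_on_def frechet_derivative_works)
  from has_derivative_compose[OF d this]
  show "dir_deriv b (\<lambda>x. f (L x + a)) x = dir_deriv (L b) f (L x + a)"
    by (subst dir_deriv_eqI) (auto simp: dir_deriv_def)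
qed

text \<open>The derivative of \<open>f \<circ> L\<close> along a basis vector is a linear combination of partial derivatives
of \<open>f\<close>, to which the induction hypothesis applies.\<close>

lemma Ck_affine:
  fixes f :: "'b::euclidean_space \<Rightarrow> real" and L :: "'a::euclidean_space \<Rightarrow> 'b"
  assumes "Ck k f" and L: "linear L"
  shows "Ck k (\<lambda>x. f (L x + a))"
  using assms(1)
proof (induction k arbitrary: f)
  case 0
  have "continuous_on UNIV (\<lambda>x. L x + a)"
    using L by (intro continuous_intros linear_continuous_on) (simp add: linear_conv_bounded_linear)
  with 0 show ?case by (auto intro: continuous_on_compose2[of UNIV f])
next
  case (Suc k)
  have f: "f differentiable_on UNIV" using Suc.prems by simp
  have *: "dir_deriv b (\<lambda>x. f (L x + a)) = (\<lambda>x. \<Sum>c\<in>Basis. (L b \<bullet> c) * dir_deriv c f (L x + a))" for b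
    using f unfolding dir_deriv_affine[OF f L]
    by (subst dir_deriv_expand) (auto simp: differentiable_on_def)
  have "(\<lambda>x. f (L x + a)) differentiable_on UNIV"
    unfolding differentiable_on_def
  proof (intro ballI, simp)
    fix x
    have d: "(\<lambda>x. L x + a) differentiable (at x)"
      using L by (simp add: linear_imp_differentiable)
    have "f differentiable (at (L x + a))" using f by (auto simp: differentiable_on_def)
    from differentiable_compose[OF this d] show "(\<lambda>x. f (L x + a)) differentiable at x" by simp
  qed
  moreover have "Ck k (\<lambda>x. (L b \<bullet> c) * dir_deriv c f (L x + a))" if "c \<in> Basis" for b c
    using Suc that by (intro Ck_mult Ck_const) auto
  ultimately show ?case by (auto simp: * intro!: Ck_sum)
qed

lemma laplacian_mult:
  assumes "smooth f" "smooth g"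
  shows "laplacian (\<lambda>x. f x * g x) x =
     f x * laplacian g x + 2 * (\<Sum>b\<in>Basis. dir_deriv b f x * dir_deriv b g x) + laplacian f x * g x"
proof -
  have d: "f differentiable_on UNIV" "g differentiable_on UNIV"
    "\<And>b. b \<in> Basis \<Longrightarrow> dir_deriv b f differentiable_on UNIV"
    "\<And>b. b \<in> Basis \<Longrightarrow> dir_deriv b g differentiable_on UNIV"
    using assms by (metis Ck.simps(2))+
  have "dir_deriv b (dir_deriv b (\<lambda>x. f x * g x)) x =
     f x * dir_deriv b (dir_deriv b g) x + 2 * (dir_deriv b f x * dir_deriv b g x)
      + dir_deriv b (dir_deriv b f) x * g x" if "b \<in> Basis" for b
    using d that by (simp add: dir_deriv_mult dir_deriv_add differentiable_on_mult)
  then show ?thesis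
    by (simp add: laplacian_def sum.distrib sum_distrib_left sum_distrib_right)
qed

lemma smooth_affine:
  "smooth f \<Longrightarrow> linear L \<Longrightarrow> smooth (\<lambda>x. f (L x + a))"
  by (simp add: Ck_affine)

lemma smooth_differentiable: "smooth f \<Longrightarrow> f differentiable_on UNIV"
  by (metis Ck.simps(2))

lemma dir_deriv_cmult:
  assumes "f differentiable_on UNIV"
  shows "dir_deriv b (\<lambda>x. a * f x) = (\<lambda>x. a * dir_deriv b f x)"
  using assms by (subst dir_deriv_mult) (auto simp: dir_deriv_const)

lemma dir_deriv_scale:
  fixes f :: "'a::euclidean_space \<Rightarrow> real"
  assumes f: "f differentiable_on UNIV"
  shows "dir_deriv b (\<lambda>x. f (s *\<^sub>R x)) = (\<lambda>x. s * dir_deriv b f (s *\<^sub>R x))"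
proof -
  have "dir_deriv (s *\<^sub>R b) f x = s * dir_deriv b f x" for x
    using f linear_scale[OF linear_frechet_derivative, of f "at x" s b]
    by (auto simp: dir_deriv_def differentiable_on_def)
  then show ?thesis
    using dir_deriv_affine[OF f linear_scaleR, of b s 0] by simp
qed

section \<open>Test functions\<close>

lemma test_function_mono: "test_function \<Omega> \<eta> \<Longrightarrow> \<Omega> \<subseteq> \<Omega>' \<Longrightarrow> test_function \<Omega>' \<eta>"
  by (auto simp: test_function_def)

lemma test_functionI:
  assumes "smooth \<eta>" "compact K" "K \<subseteq> \<Omega>" "\<And>x. \<eta> x \<noteq> 0 \<Longrightarrow> x \<in> K"
  shows "test_function \<Omega> \<eta>"
proof -
  have "closure {x. \<eta> x \<noteq> 0} \<subseteq> K"
    using assms(2,4) by (intro closure_minimal) (auto intro: compact_imp_closed)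
  moreover from this have "compact (closure {x. \<eta> x \<noteq> 0})"
    using compact_Int_closed[OF assms(2) closed_closure, of "{x. \<eta> x \<noteq> 0}"]
    by (simp add: inf.absorb2)
  ultimately show ?thesis
    using assms(1,3) unfolding test_function_def by blast
qed

lemma test_function_support:
  assumes "test_function \<Omega> \<eta>"
  obtains K where "compact K" "K \<subseteq> \<Omega>" "\<And>x. x \<notin> K \<Longrightarrow> \<eta> x = 0"
proof
  show "compact (closure {x. \<eta> x \<noteq> 0})" "closure {x. \<eta> x \<noteq> 0} \<subseteq> \<Omega>"
    using assms by (simp_all add: test_function_def)
  show "\<eta> x = 0" if "x \<notin> closure {x. \<eta> x \<noteq> 0}" for x
    using that closure_subset[of "{x. \<eta> x \<noteq> 0}"] by auto
qed

lemma test_function_smooth: "test_function \<Omega> \<eta> \<Longrightarrow> smooth \<eta>"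
  by (simp add: test_function_def)

text \<open>Differentiation does not enlarge supports, so derivatives of test functions are test functions.\<close>

lemma dir_deriv_zero_outside:
  assumes "closed K" "\<And>x. x \<notin> K \<Longrightarrow> f x = 0" "x \<notin> K"
  shows "dir_deriv b f x = 0"
proof -
  have "(f has_derivative (\<lambda>h. 0)) (at x)"
    by (rule has_derivative_transform_within_open[of "\<lambda>_. 0" _ _ UNIV "- K"]) (use assms in auto)
  then show ?thesis by (simp add: dir_deriv_eqI)
qed

lemma test_function_dir_deriv:
  assumes "test_function \<Omega> \<eta>" "b \<in> Basis"
  shows "test_function \<Omega> (dir_deriv b \<eta>)"
proof -
  obtain K where K: "compact K" "K \<subseteq> \<Omega>" "\<And>x. x \<notin> K \<Longrightarrow> \<eta> x = 0"
    using test_function_support[OF assms(1)] by blast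
  show ?thesis
    by (rule test_functionI[OF smooth_dir_deriv K(1,2)])
       (use assms K dir_deriv_zero_outside[of K \<eta>] in \<open>auto simp: test_function_smooth compact_imp_closed\<close>)
qed

lemma test_function_mult:
  assumes "smooth f" "test_function \<Omega> g"
  shows "test_function \<Omega> (\<lambda>x. f x * g x)"
proof -
  obtain K where K: "compact K" "K \<subseteq> \<Omega>" "\<And>x. x \<notin> K \<Longrightarrow> g x = 0"
    using test_function_support[OF assms(2)] by blast
  show ?thesis
    by (rule test_functionI[OF _ K(1,2)])
       (use assms K in \<open>auto simp: test_function_smooth Ck_mult\<close>)
qed

text \<open>Space-time test functions with separated variables: paired with them, the wave equation becomes a
statement about the moments of the solution as functions of time.\<close>

abbreviation tensor :: "('a \<Rightarrow> real) \<Rightarrow> (real \<Rightarrow> real) \<Rightarrow> 'a \<times> real \<Rightarrow> real" where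
  "tensor f r \<equiv> (\<lambda>z. f (fst z) * r (snd z))"

lemma Ck_fst:
  fixes f :: "'a::euclidean_space \<Rightarrow> real"
  shows "Ck k f \<Longrightarrow> Ck k (\<lambda>z :: 'a \<times> 'b::euclidean_space. f (fst z))"
  using Ck_affine[OF _ linear_fst, of k f 0] by simp

lemma Ck_snd:
  fixes f :: "'b::euclidean_space \<Rightarrow> real"
  shows "Ck k f \<Longrightarrow> Ck k (\<lambda>z :: 'a::euclidean_space \<times> 'b. f (snd z))"
  using Ck_affine[OF _ linear_snd, of k f 0] by simp

lemma smooth_tensor: "smooth f \<Longrightarrow> smooth r \<Longrightarrow> smooth (tensor f r)"
  by (simp add: Ck_mult Ck_fst Ck_snd)

lemma dir_deriv_tensor:
  fixes f :: "'a::euclidean_space \<Rightarrow> real"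
  assumes "smooth f" "smooth r"
  shows "dir_deriv (b, 0) (tensor f r) = tensor (dir_deriv b f) r"
    and "dir_deriv (0, 1) (tensor f r) = tensor f (dir_deriv 1 r)"
proof -
  have f: "f differentiable_on UNIV" and r: "r differentiable_on UNIV"
    using assms smooth_differentiable by auto
  have d: "(\<lambda>z. f (fst z)) differentiable_on (UNIV::('a\<times>real) set)"
    "(\<lambda>z. r (snd z)) differentiable_on (UNIV::('a\<times>real) set)"
    using assms by (simp_all add: smooth_differentiable Ck_fst Ck_snd)
  have 1: "dir_deriv c (\<lambda>z. f (fst z)) = (\<lambda>z. dir_deriv (fst c) f (fst z))" for c :: "'a \<times> real"
    using dir_deriv_affine[OF f linear_fst, of c 0] by simp
  have 2: "dir_deriv c (\<lambda>z. r (snd z)) = (\<lambda>z. dir_deriv (snd c) r (snd z))" for c :: "'a \<times> real"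
    using dir_deriv_affine[OF r linear_snd, of c 0] by simp
  have z: "dir_deriv 0 f x = 0" "dir_deriv 0 r t = 0" for x t
    using linear_0[OF linear_frechet_derivative] f r by (auto simp: dir_deriv_def differentiable_on_def)
  show "dir_deriv (b, 0) (tensor f r) = tensor (dir_deriv b f) r"
    "dir_deriv (0, 1) (tensor f r) = tensor f (dir_deriv 1 r)"
    by (simp_all add: dir_deriv_mult[OF d] 1 2 z)
qed

lemma wave_op_tensor:
  fixes f :: "'a::euclidean_space \<Rightarrow> real"
  assumes "smooth f" "smooth r"
  shows "wave_op V (tensor f r) (x, t) =
     f x * dir_deriv 1 (dir_deriv 1 r) t + (- laplacian f x + V x * f x) * r t"
proof -
  have "dir_deriv (0, 1) (dir_deriv (0, 1) (tensor f r)) = tensor f (dir_deriv 1 (dir_deriv 1 r))"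
    using assms smooth_dir_deriv[of r 1] by (simp add: dir_deriv_tensor)
  moreover have "dir_deriv (b, 0) (dir_deriv (b, 0) (tensor f r)) = tensor (dir_deriv b (dir_deriv b f)) r"
    if "b \<in> Basis" for b
    using assms smooth_dir_deriv[of f b] that by (simp add: dir_deriv_tensor)
  ultimately show ?thesis
    by (simp add: wave_op_def laplacian_def sum_distrib_left sum_distrib_right algebra_simps)
qed

lemma test_function_tensor:
  assumes "test_function UNIV f" "test_function {0<..<T} r"
  shows "test_function (space_time T) (tensor f r)"
proof -
  obtain K where K: "compact K" "\<And>x. x \<notin> K \<Longrightarrow> f x = 0"
    using test_function_support[OF assms(1)] by metis
  obtain J where J: "compact J" "J \<subseteq> {0<..<T}" "\<And>x. x \<notin> J \<Longrightarrow> r x = 0"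
    using test_function_support[OF assms(2)] by metis
  have "smooth (tensor f r)" using assms by (intro smooth_tensor) (auto simp: test_function_smooth)
  then show ?thesis
  proof (rule test_functionI)
    show "compact (K \<times> J)" "K \<times> J \<subseteq> space_time T"
      using K J by (auto simp: space_time_def intro!: compact_Times)
    show "z \<in> K \<times> J" if "tensor f r z \<noteq> 0" for z
      using that K(2)[of "fst z"] J(3)[of "snd z"] by (auto simp: mem_Times_iff)
  qed
qed

section \<open>Bump functions\<close>

text \<open>The function which is \<open>exp(-1/x)\<close> for \<open>x > 0\<close> and zero otherwise is \<open>flat 1\<close>. The polynomial factor
in \<open>1/x\<close> makes the family closed under differentiation.\<close>

definition flat :: "real poly \<Rightarrow> real \<Rightarrow> real" where
  "flat P x = (if x > 0 then poly P (1 / x) * exp (- (1 / x)) else 0)"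

lemma poly_over_exp_tendsto: "((\<lambda>x::real. poly P x / exp x) \<longlongrightarrow> 0) at_top"
proof -
  have "((\<lambda>x::real. \<Sum>i\<le>degree P. coeff P i * (x ^ i / exp x)) \<longlongrightarrow> (\<Sum>i\<le>degree P. coeff P i * 0)) at_top"
    by (intro tendsto_sum tendsto_mult tendsto_const tendsto_power_div_exp_0)
  then show ?thesis by (simp add: poly_altdef sum_divide_distrib)
qed

text \<open>For \<open>x > 0\<close> this is the product rule; the factor \<open>1/x\<^sup>2\<close> of both terms is the polynomial
\<open>[:0, 0, 1:]\<close> in \<open>1/x\<close>. At \<open>0\<close> the exponential decay in \<open>1/x\<close> beats every polynomial in \<open>1/x\<close>.\<close>

lemma flat_derivative:
  "(flat P has_real_derivative flat ([:0, 0, 1:] * (P - pderiv P)) x) (at x)"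
proof -
  consider "x > 0" | "x < 0" | "x = 0" by linarith
  then show ?thesis
  proof cases
    case 1
    have i: "((\<lambda>x. 1 / x) has_real_derivative - (1 / x\<^sup>2)) (at x)"
      using 1 by (auto intro!: derivative_eq_intros simp: power2_eq_square)
    have "((\<lambda>x. poly P (1 / x) * exp (- (1 / x))) has_real_derivative
        poly (pderiv P) (1 / x) * - (1 / x\<^sup>2) * exp (- (1 / x)) +
        exp (- (1 / x)) * - (- (1 / x\<^sup>2)) * poly P (1 / x)) (at x)"
      by (intro DERIV_mult DERIV_chain2[OF poly_DERIV i] DERIV_chain2[OF DERIV_exp DERIV_minus[OF i]])
    also have "poly (pderiv P) (1 / x) * - (1 / x\<^sup>2) * exp (- (1 / x)) +
        exp (- (1 / x)) * - (- (1 / x\<^sup>2)) * poly P (1 / x) = flat ([:0, 0, 1:] * (P - pderiv P)) x"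
      using 1 by (simp add: flat_def power2_eq_square algebra_simps)
    finally have "((\<lambda>x. poly P (1 / x) * exp (- (1 / x))) has_real_derivative
        flat ([:0, 0, 1:] * (P - pderiv P)) x) (at x)" .
    then show ?thesis
      by (rule has_field_derivative_transform_within_open[of _ _ _ "{0<..}"])
         (use 1 in \<open>auto simp: flat_def\<close>)
  next
    case 2
    have "((\<lambda>x. 0) has_real_derivative flat ([:0, 0, 1:] * (P - pderiv P)) x) (at x)"
      using 2 by (auto simp: flat_def)
    then show ?thesis
      by (rule has_field_derivative_transform_within_open[of _ _ _ "{..<0}"])
         (use 2 in \<open>auto simp: flat_def\<close>)
  next
    case 3
    have "((\<lambda>h. flat P h / h) \<longlongrightarrow> 0) (at 0)"
    proof (rule filterlim_split_at)
      show "((\<lambda>h. flat P h / h) \<longlongrightarrow> 0) (at_left 0)"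
        by (rule tendsto_eventually) (auto simp: eventually_at_filter flat_def)
      have "((\<lambda>h. poly (pCons 0 P) (inverse h) / exp (inverse h)) \<longlongrightarrow> 0) (at_right (0::real))"
        by (rule filterlim_compose[OF poly_over_exp_tendsto filterlim_inverse_at_top_right])
      then show "((\<lambda>h. flat P h / h) \<longlongrightarrow> 0) (at_right 0)"
        by (rule tendsto_cong[THEN iffD1, rotated])
           (auto simp: eventually_at_filter flat_def field_simps exp_minus)
    qed
    then show ?thesis using 3 by (simp add: DERIV_def flat_def)
  qed
qed

lemma smooth_flat: "smooth (flat P)"
proof (rule smoothI[where P = "\<lambda>f. \<exists>P. f = flat P"])
  have d: "(flat P has_derivative (*) (flat ([:0, 0, 1:] * (P - pderiv P)) x)) (at x)" for P x
    using flat_derivative by (simp add: has_field_derivative_def)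
  fix f assume "\<exists>P. f = flat P"
  then obtain P where f: "f = flat P" by blast
  show "f differentiable_on UNIV"
    using d unfolding f differentiable_on_def differentiable_def by blast
  fix b :: real assume "b \<in> Basis"
  then have "dir_deriv b f = flat ([:0, 0, 1:] * (P - pderiv P))"
    using dir_deriv_eqI[OF d] unfolding f by (auto simp del: mult_pCons_left)
  then show "\<exists>P. dir_deriv b f = flat P" by blast
qed blast

text \<open>A product of one-dimensional bumps in the coordinates is supported in a cube. Dilating by the
dimension moves the cube into the unit ball, as some coordinate of \<open>x\<close> has absolute value at least \<open>\<bar>x\<bar>/n\<close>.\<close>

lemma smooth_bump_exists:
  obtains \<beta> :: "'a::euclidean_space \<Rightarrow> real"
  where "smooth \<beta>" "\<And>x. \<beta> x \<ge> 0" "\<beta> 0 > 0" "\<And>x. norm x > 1 \<Longrightarrow> \<beta> x = 0"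
proof -
  define h where "h = (\<lambda>s. flat 1 (s + 1) * flat 1 (- s + 1))"
  have h: "smooth h" "\<And>s. h s \<ge> 0" "h 0 > 0" "\<And>s. \<bar>s\<bar> \<ge> 1 \<Longrightarrow> h s = 0"
    using smooth_affine[OF smooth_flat linear_ident, of 1 1]
      smooth_affine[OF smooth_flat linear_uminus, of 1 1]
    by (auto simp: h_def flat_def Ck_mult)
  define \<beta> where "\<beta> = (\<lambda>x::'a. \<Prod>b\<in>Basis. h ((real DIM('a) *\<^sub>R x) \<bullet> b))"
  have "linear (\<lambda>x. (real DIM('a) *\<^sub>R x) \<bullet> b)" for b :: 'a
    by (auto intro!: linearI simp: inner_add_left algebra_simps)
  from smooth_affine[OF h(1) this, of _ 0]
  have "Ck k (\<lambda>x. h ((real DIM('a) *\<^sub>R x) \<bullet> b))" for k and b :: 'a by (simp del: inner_scaleR_left)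
  then have "smooth \<beta>" unfolding \<beta>_def by (intro allI Ck_prod)
  moreover have "\<beta> x \<ge> 0" for x unfolding \<beta>_def using h by (intro prod_nonneg) auto
  moreover have "\<beta> 0 > 0" unfolding \<beta>_def using h by (intro prod_pos) auto
  moreover have "\<beta> x = 0" if x: "norm x > 1" for x
  proof -
    have "\<exists>b\<in>Basis. \<bar>x \<bullet> b\<bar> \<ge> 1 / real DIM('a)"
    proof (rule ccontr)
      assume "\<not> ?thesis"
      then have "(\<Sum>b\<in>Basis. \<bar>x \<bullet> b\<bar>) \<le> (\<Sum>b\<in>(Basis::'a set). 1 / real DIM('a))"
        by (intro sum_mono) force
      also have "\<dots> = 1" by simp
      finally show False using norm_le_l1[of x] x by simp
    qed
    then obtain b where b: "b \<in> Basis" "\<bar>x \<bullet> b\<bar> \<ge> 1 / real DIM('a)" by blast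
    then have "\<bar>(real DIM('a) *\<^sub>R x) \<bullet> b\<bar> \<ge> 1" by (simp add: abs_mult field_simps)
    with h(4) b(1) show ?thesis unfolding \<beta>_def by (auto intro!: prod_zero)
  qed
  ultimately show ?thesis using that by blast
qed

section \<open>Local integrability\<close>

lemma locally_integrable_mult:
  assumes w: "locally_integrable \<Omega> w" and K: "compact K" "K \<subseteq> \<Omega>"
    and g: "g \<in> borel_measurable borel" "\<And>x. x \<in> K \<Longrightarrow> \<bar>g x\<bar> \<le> C" "\<And>x. x \<notin> K \<Longrightarrow> g x = 0"
  shows "integrable lborel (\<lambda>x. w x * g x)"
proof -
  have i: "integrable lborel (\<lambda>x. indicator K x * w x)"
    using w K unfolding locally_integrable_def set_integrable_def by simp
  have e: "(\<lambda>x. w x * g x) = (\<lambda>x. (indicator K x * w x) * g x)"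
    using g(3) by (force simp: indicator_def)
  show ?thesis unfolding e
  proof (rule Bochner_Integration.integrable_bound)
    show "integrable lborel (\<lambda>x. C * (indicator K x * w x))" using i by simp
    show "(\<lambda>x. indicator K x * w x * g x) \<in> borel_measurable lborel"
      using borel_measurable_integrable[OF i] g(1) by simp
    have "norm (indicator K x * w x * g x) \<le> norm (C * (indicator K x * w x))" for x
      using g(2)[of x] mult_left_mono[of "\<bar>g x\<bar>" "\<bar>C\<bar>" "\<bar>w x\<bar>"] by (auto simp: indicator_def abs_mult mult.commute)
    then show "AE x in lborel. norm (indicator K x * w x * g x) \<le> norm (C * (indicator K x * w x))"
      by simp
  qed
qed

lemma continuous_support_bounded:
  fixes g :: "'a::euclidean_space \<Rightarrow> real"
  assumes "continuous_on UNIV g" "compact K" "\<And>x. x \<notin> K \<Longrightarrow> g x = 0"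
  obtains C where "C > 0" "\<And>x. \<bar>g x\<bar> \<le> C"
proof -
  have "bounded (g ` K)"
    using assms by (intro compact_imp_bounded compact_continuous_image) (auto intro: continuous_on_subset)
  then obtain C where C: "C > 0" "\<And>x. x \<in> K \<Longrightarrow> \<bar>g x\<bar> \<le> C" by (auto simp: bounded_pos)
  then have "\<bar>g x\<bar> \<le> C" for x using assms(3)[of x] by (cases "x \<in> K") auto
  with C(1) show ?thesis using that by blast
qed

lemma integrable_mult_continuous:
  assumes "locally_integrable \<Omega> w" and "compact K" "K \<subseteq> \<Omega>"
    and "continuous_on UNIV g" "\<And>x. x \<notin> K \<Longrightarrow> g x = 0"
  shows "integrable lborel (\<lambda>x. w x * g x)"
proof -
  obtain C where "\<And>x. \<bar>g x\<bar> \<le> C" using continuous_support_bounded[of g K] assms by metis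
  then show ?thesis
    using assms by (intro locally_integrable_mult[of \<Omega> w K g C]) (auto intro: borel_measurable_continuous_onI)
qed

lemma integrable_mult_test_function:
  assumes "locally_integrable \<Omega> w" "test_function \<Omega> \<eta>"
  shows "integrable lborel (\<lambda>x. w x * \<eta> x)"
proof -
  obtain K where "compact K" "K \<subseteq> \<Omega>" "\<And>x. x \<notin> K \<Longrightarrow> \<eta> x = 0"
    using test_function_support[OF assms(2)] by metis
  then show ?thesis
    using assms by (intro integrable_mult_continuous[of \<Omega> w K])
      (auto simp: test_function_smooth smooth_continuous)
qed

lemma test_function_ball_support:
  fixes \<eta> :: "'a::euclidean_space \<Rightarrow> real"
  assumes "test_function \<Omega> \<eta>"
  obtains R where "R > 0" "\<And>x. norm x > R \<Longrightarrow> \<eta> x = 0"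
proof -
  obtain K where K: "compact K" "\<And>x. x \<notin> K \<Longrightarrow> \<eta> x = 0"
    using test_function_support[OF assms] by metis
  obtain R where "R > 0" "\<And>x. x \<in> K \<Longrightarrow> norm x \<le> R"
    using compact_imp_bounded[OF K(1)] by (auto simp: bounded_pos)
  with K show ?thesis using that[of R] by force
qed

text \<open>Only \<open>x\<close> is restricted to the ball of radius \<open>R\<close>, hence continuity is required on a larger one.\<close>

lemma uniformly_continuous_on_neighborhood:
  fixes g :: "'a::euclidean_space \<Rightarrow> real"
  assumes "continuous_on (cball 0 (R + 1)) g" "e > 0"
  obtains d where "0 < d" "d \<le> 1" "\<And>x y. norm x \<le> R \<Longrightarrow> norm (y - x) < d \<Longrightarrow> \<bar>g y - g x\<bar> < e"
proof -
  have "uniformly_continuous_on (cball 0 (R + 1)) g"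
    using assms by (intro compact_uniformly_continuous) auto
  then obtain d where d: "d > 0" "\<And>x y. x \<in> cball 0 (R+1) \<Longrightarrow> y \<in> cball 0 (R+1) \<Longrightarrow> dist y x < d \<Longrightarrow> dist (g y) (g x) < e"
    using assms(2) unfolding uniformly_continuous_on_def by metis
  have "\<bar>g y - g x\<bar> < e" if "norm x \<le> R" "norm (y - x) < min d 1" for x y
  proof -
    have "norm y \<le> R + 1" using that norm_triangle_ineq2[of y x] by auto
    with that d(2)[of x y] show ?thesis by (auto simp: dist_norm)
  qed
  with d(1) show ?thesis using that[of "min d 1"] by auto
qed

lemma uniformly_continuous_test_function:
  fixes g :: "'a::euclidean_space \<Rightarrow> real"
  assumes "test_function \<Omega> g" "e > 0"
  obtains d where "0 < d" "\<And>x y. norm (y - x) < d \<Longrightarrow> \<bar>g y - g x\<bar> < e"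
proof -
  obtain R where R: "R > 0" "\<And>x. norm x > R \<Longrightarrow> g x = 0"
    using test_function_ball_support[OF assms(1)] by metis
  have "continuous_on (cball 0 (R + 1)) g"
    using smooth_continuous[OF test_function_smooth[OF assms(1)]] by (rule continuous_on_subset) simp
  then obtain d where d: "0 < d" "\<And>x y. norm x \<le> R \<Longrightarrow> norm (y - x) < d \<Longrightarrow> \<bar>g y - g x\<bar> < e"
    using uniformly_continuous_on_neighborhood[OF _ assms(2)] by metis
  have "\<bar>g y - g x\<bar> < e" if "norm (y - x) < d" for x y
    using d(2)[of x y] d(2)[of y x] R(2)[of x] R(2)[of y] that assms(2)
    by (cases "norm x \<le> R"; cases "norm y \<le> R") (auto simp: norm_minus_commute abs_minus_commute)
  with d(1) that show ?thesis by blast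
qed

text \<open>By the mean value theorem the remainder of first order is controlled by the oscillation of the
partial derivatives, which are uniformly continuous. Uniformity in the base point is what allows
differentiation under an integral against a function that is merely locally integrable.\<close>

lemma test_function_uniformly_differentiable:
  fixes g :: "'a::euclidean_space \<Rightarrow> real"
  assumes g: "test_function \<Omega> g" and "e > 0"
  obtains d where "0 < d" "\<And>h x. norm h < d \<Longrightarrow> \<bar>g (x + h) - g x - dir_deriv h g x\<bar> \<le> e * norm h"
proof -
  define e' where "e' = e / DIM('a)"
  have e': "e' > 0" using assms by (simp add: e'_def)
  have "\<exists>d>0. \<forall>x y. norm (y - x) < d \<longrightarrow> \<bar>dir_deriv b g y - dir_deriv b g x\<bar> < e'" if "b \<in> Basis" for b
    using uniformly_continuous_test_function[OF test_function_dir_deriv[OF g that] e'] by metis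
  then obtain d where d: "\<And>b. b \<in> Basis \<Longrightarrow> d b > 0"
    "\<And>b x y. b \<in> Basis \<Longrightarrow> norm (y - x) < d b \<Longrightarrow> \<bar>dir_deriv b g y - dir_deriv b g x\<bar> < e'"
    by metis
  define D where "D = Min (d ` Basis)"
  have D: "D > 0" "\<And>b. b \<in> Basis \<Longrightarrow> D \<le> d b" using d(1) by (auto simp: D_def)
  have sm: "smooth g" using g by (rule test_function_smooth)
  then have df: "g differentiable (at x)" for x
    using smooth_differentiable by (auto simp: differentiable_on_def)
  have "\<bar>g (x + h) - g x - dir_deriv h g x\<bar> \<le> e * norm h" if h: "norm h < D" for h x
  proof -
    have "((\<lambda>s. g (x + s *\<^sub>R h)) has_real_derivative dir_deriv h g (x + s *\<^sub>R h)) (at s)" for s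
    proof -
      have "((\<lambda>s. x + s *\<^sub>R h) has_derivative (\<lambda>s. s *\<^sub>R h)) (at s)"
        by (auto intro!: derivative_eq_intros)
      from has_derivative_compose[OF this smooth_has_derivative[OF sm]]
      have "((\<lambda>s. g (x + s *\<^sub>R h)) has_derivative (\<lambda>u. dir_deriv (u *\<^sub>R h) g (x + s *\<^sub>R h))) (at s)" .
      moreover have "(\<lambda>u. dir_deriv (u *\<^sub>R h) g (x + s *\<^sub>R h)) = (*) (dir_deriv h g (x + s *\<^sub>R h))"
        using linear_scale[OF linear_frechet_derivative[OF df]] by (auto simp: dir_deriv_def)
      ultimately show ?thesis by (simp add: has_field_derivative_def)
    qed
    from MVT2[of 0 1, OF _ this] obtain s where s: "0 < s" "s < 1"
      "g (x + h) - g x = dir_deriv h g (x + s *\<^sub>R h)" by auto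
    have "norm (s *\<^sub>R h) \<le> norm h" using s by (simp add: mult_left_le_one_le)
    then have n: "norm (s *\<^sub>R h) < D" using h by linarith
    have "g (x + h) - g x - dir_deriv h g x =
        (\<Sum>b\<in>Basis. (h \<bullet> b) * (dir_deriv b g (x + s *\<^sub>R h) - dir_deriv b g x))"
      unfolding s(3) dir_deriv_expand[OF df, of h]
      by (simp add: sum_subtractf right_diff_distrib)
    also have "\<bar>\<dots>\<bar> \<le> (\<Sum>b\<in>(Basis::'a set). norm h * e')"
    proof (rule order_trans[OF sum_abs], rule sum_mono)
      fix b :: 'a assume b: "b \<in> Basis"
      have "\<bar>dir_deriv b g (x + s *\<^sub>R h) - dir_deriv b g x\<bar> \<le> e'"
        using d(2)[OF b, of "x + s *\<^sub>R h" x] D(2)[OF b] n by auto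
      with Basis_le_norm[OF b, of h]
      show "\<bar>(h \<bullet> b) * (dir_deriv b g (x + s *\<^sub>R h) - dir_deriv b g x)\<bar> \<le> norm h * e'"
        unfolding abs_mult by (intro mult_mono) auto
    qed
    also have "\<dots> = e * norm h" by (simp add: e'_def)
    finally show ?thesis .
  qed
  with D(1) show ?thesis using that by blast
qed

lemma locally_integrable_continuous:
  assumes "continuous_on UNIV f" shows "locally_integrable \<Omega> f"
  unfolding locally_integrable_def set_integrable_def
  using assms borel_integrable_compact[of _ f] by (auto intro: continuous_on_subset)

lemma locally_integrable_measurable:
  fixes w :: "'a::euclidean_space \<Rightarrow> real"
  assumes "locally_integrable UNIV w" shows "w \<in> borel_measurable borel"
proof (rule borel_measurable_LIMSEQ_real)
  fix n :: nat
  have "integrable lborel (\<lambda>x. indicator (cball 0 (real n)) x *\<^sub>R w x)"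
    using assms unfolding locally_integrable_def set_integrable_def by auto
  then show "(\<lambda>x. indicator (cball 0 (real n)) x *\<^sub>R w x) \<in> borel_measurable borel"
    using borel_measurable_integrable by fastforce
next
  fix x :: 'a
  have "\<forall>\<^sub>F n in sequentially. norm x \<le> real n"
    by (meson eventually_sequentiallyI le_nat_iff nat_ceiling_le_eq)
  then have "\<forall>\<^sub>F n in sequentially. indicator (cball 0 (real n)) x *\<^sub>R w x = w x"
    by eventually_elim simp
  then show "(\<lambda>n. indicator (cball 0 (real n)) x *\<^sub>R w x) \<longlonglongrightarrow> w x" by (rule tendsto_eventually)
qed

lemma integrable_mult_laplacian:
  assumes "locally_integrable UNIV w" "test_function UNIV \<eta>"
  shows "integrable lborel (\<lambda>y. w y * laplacian \<eta> y)"
  unfolding laplacian_def sum_distrib_left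
  by (intro Bochner_Integration.integrable_sum integrable_mult_test_function[OF assms(1)] test_function_dir_deriv assms(2))

lemma integrable_mult_potential:
  assumes "locally_integrable UNIV w" "test_function UNIV \<eta>" "continuous_on UNIV V"
  shows "integrable lborel (\<lambda>y. w y * (V y * \<eta> y))"
proof -
  obtain K where "compact K" "\<And>x. x \<notin> K \<Longrightarrow> \<eta> x = 0"
    using test_function_support[OF assms(2)] by metis
  then show ?thesis
    using assms by (intro integrable_mult_continuous[of UNIV w K])
      (auto simp: test_function_smooth smooth_continuous intro!: continuous_intros)
qed

lemma integrable_schroedinger:
  assumes f: "locally_integrable UNIV f" and V: "continuous_on UNIV V" and th: "test_function UNIV \<theta>"
  shows "integrable lborel (\<lambda>x. f x * (- laplacian \<theta> x + V x * \<theta> x))"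
    and "integrable lborel (\<lambda>x. f x * (- laplacian \<theta> x + V x * \<theta> x + lam * \<theta> x))"
    and "(LINT x|lborel. f x * (- laplacian \<theta> x + V x * \<theta> x + lam * \<theta> x))
      = (LINT x|lborel. f x * (- laplacian \<theta> x + V x * \<theta> x)) + lam * (LINT x|lborel. f x * \<theta> x)"
proof -
  note i = integrable_mult_laplacian[OF f th] integrable_mult_potential[OF f th V] integrable_mult_test_function[OF f th]
  have e: "f x * (- laplacian \<theta> x + V x * \<theta> x) = f x * (V x * \<theta> x) - f x * laplacian \<theta> x"
    "f x * (- laplacian \<theta> x + V x * \<theta> x + lam * \<theta> x) = f x * (- laplacian \<theta> x + V x * \<theta> x) + lam * (f x * \<theta> x)" for x
    by (simp_all add: algebra_simps)
  show 1: "integrable lborel (\<lambda>x. f x * (- laplacian \<theta> x + V x * \<theta> x))" unfolding e(1) using i by simp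
  show "integrable lborel (\<lambda>x. f x * (- laplacian \<theta> x + V x * \<theta> x + lam * \<theta> x))" unfolding e(2) using 1 i by simp
  show "(LINT x|lborel. f x * (- laplacian \<theta> x + V x * \<theta> x + lam * \<theta> x))
      = (LINT x|lborel. f x * (- laplacian \<theta> x + V x * \<theta> x)) + lam * (LINT x|lborel. f x * \<theta> x)"
    unfolding e(2) using 1 i by simp
qed

section \<open>Mollification\<close>

definition mollify :: "('a::euclidean_space \<Rightarrow> real) \<Rightarrow> ('a \<Rightarrow> real) \<Rightarrow> 'a \<Rightarrow> real" where
  "mollify j w x = (LINT y|lborel. w y * j (x - y))"

lemma smooth_reflect:
  fixes j :: "'a::euclidean_space \<Rightarrow> real"
  assumes "smooth j" shows "smooth (\<lambda>y. j (x - y))"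
  using smooth_affine[OF assms, of uminus x] by (simp add: linear_uminus)

lemma dir_deriv_reflect:
  fixes j :: "'a::euclidean_space \<Rightarrow> real"
  assumes "smooth j"
  shows "dir_deriv b (\<lambda>y. j (x - y)) = (\<lambda>y. - dir_deriv b j (x - y))"
proof -
  have j: "j differentiable_on UNIV" using assms by (rule smooth_differentiable)
  have "dir_deriv b (\<lambda>y. j (- y + x)) = (\<lambda>y. dir_deriv (- b) j (- y + x))"
    using dir_deriv_affine[OF j, of uminus b x] by (simp add: linear_uminus)
  moreover have "dir_deriv (- b) j y = - dir_deriv b j y" for y
    using j linear_neg[OF linear_frechet_derivative, of j "at y"]
    by (auto simp: differentiable_on_def dir_deriv_def)
  ultimately show ?thesis by simp
qed

lemma laplacian_reflect:
  fixes j :: "'a::euclidean_space \<Rightarrow> real"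
  assumes "smooth j"
  shows "laplacian (\<lambda>y. j (x - y)) y = laplacian j (x - y)"
proof -
  have "dir_deriv b (\<lambda>y. - dir_deriv b j (x - y)) z = dir_deriv b (dir_deriv b j) (x - z)"
    if b: "b \<in> Basis" for b z
  proof -
    have s: "smooth (dir_deriv b j)" using assms b by (rule smooth_dir_deriv)
    have "dir_deriv b (\<lambda>y. (-1) * dir_deriv b j (x - y)) z =
      (-1) * dir_deriv b (\<lambda>y. dir_deriv b j (x - y)) z"
      using smooth_differentiable[OF smooth_reflect[OF s]]
      by (subst dir_deriv_mult) (auto simp: dir_deriv_const)
    then show ?thesis by (simp add: dir_deriv_reflect[OF s])
  qed
  then show ?thesis by (simp add: laplacian_def dir_deriv_reflect[OF assms])
qed

lemma test_function_reflect:
  fixes j :: "'a::euclidean_space \<Rightarrow> real"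
  assumes "test_function UNIV j" shows "test_function UNIV (\<lambda>y. j (x - y))"
proof -
  obtain R where R: "R > 0" "\<And>x. norm x > R \<Longrightarrow> j x = 0"
    using test_function_ball_support[OF assms] by metis
  show ?thesis
  proof (rule test_functionI)
    show "smooth (\<lambda>y. j (x - y))" using assms by (intro smooth_reflect test_function_smooth)
    show "compact (cball x R)" "cball x R \<subseteq> UNIV" by auto
    show "y \<in> cball x R" if "j (x - y) \<noteq> 0" for y
      using R(2)[of "x - y"] that by (force simp: dist_norm)
  qed
qed

text \<open>Both \<open>j (z - y)\<close> and \<open>j (x - y)\<close> vanish when \<open>y\<close> is outside a fixed ball \<open>B\<close> about \<open>x\<close> and \<open>z\<close> is near \<open>x\<close>.
On \<open>B\<close> the remainder of \<open>j\<close> is uniformly small, so the remainder of the integral is bounded by a small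
multiple of \<open>\<integral>\<^sub>B \<bar>w\<bar>\<close>.\<close>

lemma mollify_has_derivative:
  fixes j w :: "'a::euclidean_space \<Rightarrow> real"
  assumes w: "locally_integrable UNIV w" and j: "test_function UNIV j"
  shows "(mollify j w has_derivative (\<lambda>h. \<Sum>b\<in>Basis. (h \<bullet> b) * mollify (dir_deriv b j) w x)) (at x)"
  unfolding has_derivative_at_alt
proof (intro conjI allI impI)
  show "bounded_linear (\<lambda>h. \<Sum>b\<in>Basis. (h \<bullet> b) * mollify (dir_deriv b j) w x)"
    by (intro bounded_linear_sum bounded_linear_mult_const bounded_linear_inner_left)
  fix e :: real assume e: "e > 0"
  obtain R where R: "R > 0" "\<And>x. norm x > R \<Longrightarrow> j x = 0"
    using test_function_ball_support[OF j] by metis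
  define B where "B = cball x (R + 1)"
  have iB: "integrable lborel (\<lambda>y. indicator B y * \<bar>w y\<bar>)"
    using w integrable_abs[of lborel "\<lambda>y. indicator B y *\<^sub>R w y"]
    unfolding locally_integrable_def set_integrable_def B_def by (simp add: abs_mult)
  define C where "C = (LINT y|lborel. indicator B y * \<bar>w y\<bar>)"
  have C: "C \<ge> 0" unfolding C_def by (intro integral_nonneg_AE) auto
  \<comment> \<open>The summand \<open>1\<close> guards against a vanishing mass \<open>C\<close>.\<close>
  define e' where "e' = e / (C + 1)"
  have e': "e' > 0" using e C by (simp add: e'_def)
  obtain d where d: "0 < d" "\<And>h x. norm h < d \<Longrightarrow> \<bar>j (x + h) - j x - dir_deriv h j x\<bar> \<le> e' * norm h"
    using test_function_uniformly_differentiable[OF j e'] by metis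
  have df: "j differentiable (at x)" for x
    using smooth_differentiable[OF test_function_smooth[OF j]] by (auto simp: differentiable_on_def)
  have "norm (mollify j w z - mollify j w x - (\<Sum>b\<in>Basis. ((z - x) \<bullet> b) * mollify (dir_deriv b j) w x))
      \<le> e * norm (z - x)" if z: "norm (z - x) < min d 1" for z
  proof -
    define h where "h = z - x"
    have i0: "integrable lborel (\<lambda>y. w y * j (z - y))" for z
      by (rule integrable_mult_test_function[OF w test_function_reflect[OF j]])
    have ib: "integrable lborel (\<lambda>y. w y * dir_deriv b j (x - y))" if "b \<in> Basis" for b
      by (rule integrable_mult_test_function[OF w test_function_reflect[OF test_function_dir_deriv[OF j that]]])
    have "mollify j w z - mollify j w x - (\<Sum>b\<in>Basis. (h \<bullet> b) * mollify (dir_deriv b j) w x)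
       = (LINT y|lborel. w y * j (z - y) - w y * j (x - y) - (\<Sum>b\<in>Basis. (h \<bullet> b) * (w y * dir_deriv b j (x - y))))"
      using i0 ib unfolding mollify_def by (simp add: Bochner_Integration.integral_sum)
    also have "\<dots> = (LINT y|lborel. w y * (j ((x - y) + h) - j (x - y) - dir_deriv h j (x - y)))"
      unfolding dir_deriv_expand[OF df, of h]
      by (intro Bochner_Integration.integral_cong refl)
         (simp add: h_def algebra_simps sum_distrib_left)
    also have "\<bar>\<dots>\<bar> \<le> (LINT y|lborel. (e' * norm h) * (indicator B y * \<bar>w y\<bar>))"
    proof (rule integral_abs_bound_integral)
      show "integrable lborel (\<lambda>y. (e' * norm h) * (indicator B y * \<bar>w y\<bar>))" using iB by simp
      have "(\<lambda>y. w y * (j ((x - y) + h) - j (x - y) - dir_deriv h j (x - y))) =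
         (\<lambda>y. w y * j (z - y) - w y * j (x - y) - (\<Sum>b\<in>Basis. (h \<bullet> b) * (w y * dir_deriv b j (x - y))))"
        unfolding dir_deriv_expand[OF df, of h]
        by (auto simp add: h_def algebra_simps sum_distrib_left)
      then show "integrable lborel (\<lambda>y. w y * (j ((x - y) + h) - j (x - y) - dir_deriv h j (x - y)))"
        using i0 ib by simp
      fix y
      show "\<bar>w y * (j ((x - y) + h) - j (x - y) - dir_deriv h j (x - y))\<bar>
         \<le> (e' * norm h) * (indicator B y * \<bar>w y\<bar>)"
      proof (cases "y \<in> B")
        case True
        have "\<bar>j ((x - y) + h) - j (x - y) - dir_deriv h j (x - y)\<bar> \<le> e' * norm h"
          using d(2)[of h "x - y"] z by (simp add: h_def)
        from mult_left_mono[OF this, of "\<bar>w y\<bar>"] show ?thesis using True by (simp add: abs_mult mult_ac)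
      next
        case False
        then have n: "norm (x - y) > R + 1" by (auto simp: B_def dist_norm)
        have "norm (x - y) \<le> norm ((x - y) + h) + norm h"
          using norm_triangle_ineq4[of "(x - y) + h" h] by simp
        then have n2: "norm ((x - y) + h) > R" using n z by (simp add: h_def)
        have "dir_deriv h j (x - y) = 0"
          by (rule dir_deriv_zero_outside[of "cball 0 R"]) (use R n in auto)
        then show ?thesis using R(2)[OF n2] R(2)[of "x - y"] n False by simp
      qed
    qed
    also have "\<dots> = e' * norm h * C" using iB by (simp add: C_def)
    also have "\<dots> \<le> e * norm h"
    proof -
      have "e' * C \<le> e" using C e by (simp add: e'_def field_simps)
      from mult_right_mono[OF this, of "norm h"] show ?thesis by (simp add: mult_ac)
    qed
    finally show ?thesis by (simp add: h_def)
  qed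
  then show "\<exists>d>0. \<forall>z. norm (z - x) < d \<longrightarrow>
     norm (mollify j w z - mollify j w x - (\<Sum>b\<in>Basis. ((z - x) \<bullet> b) * mollify (dir_deriv b j) w x))
      \<le> e * norm (z - x)"
    using d(1) by (intro exI[of _ "min d 1"]) auto
qed

lemma dir_deriv_mollify:
  assumes "locally_integrable UNIV w" "test_function UNIV j" "b \<in> Basis"
  shows "dir_deriv b (mollify j w) = mollify (dir_deriv b j) w"
proof
  fix x
  have "(\<Sum>c\<in>Basis. (b \<bullet> c) * mollify (dir_deriv c j) w x) = mollify (dir_deriv b j) w x"
    using assms(3) by (subst sum.remove[OF _ assms(3)]) (auto simp: inner_Basis intro!: sum.neutral split: if_splits)
  then show "dir_deriv b (mollify j w) x = mollify (dir_deriv b j) w x"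
    using dir_deriv_eqI[OF mollify_has_derivative[OF assms(1,2)]] by simp
qed

lemma smooth_mollify:
  assumes "locally_integrable UNIV w" "test_function UNIV j"
  shows "smooth (mollify j w)"
proof (rule smoothI[where P = "\<lambda>f. \<exists>j. test_function UNIV j \<and> f = mollify j w"])
  show "f differentiable_on UNIV" if "\<exists>j. test_function UNIV j \<and> f = mollify j w" for f
    using that mollify_has_derivative[OF assms(1)] unfolding differentiable_on_def differentiable_def
    by blast
  show "\<exists>j. test_function UNIV j \<and> dir_deriv b f = mollify j w"
    if "\<exists>j. test_function UNIV j \<and> f = mollify j w" "b \<in> Basis" for f b
    using that dir_deriv_mollify[OF assms(1)] test_function_dir_deriv by metis
qed (use assms(2) in blast)

text \<open>The right-hand side is the pairing of \<open>w\<close> with the Laplacian of a test function. In this way an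
equation for \<open>w\<close> in the sense of distributions becomes an equation at the point \<open>x\<close>.\<close>

lemma laplacian_mollify:
  assumes "locally_integrable UNIV w" "test_function UNIV j"
  shows "laplacian (mollify j w) x = (LINT y|lborel. w y * laplacian (\<lambda>y. j (x - y)) y)"
proof -
  have sm: "smooth j" using assms(2) by (rule test_function_smooth)
  have t: "test_function UNIV (dir_deriv b (dir_deriv b j))" if "b \<in> Basis" for b
    using assms(2) that by (intro test_function_dir_deriv)
  have "laplacian (mollify j w) x = (\<Sum>b\<in>Basis. mollify (dir_deriv b (dir_deriv b j)) w x)"
    using assms by (simp add: laplacian_def dir_deriv_mollify test_function_dir_deriv)
  also have "\<dots> = (LINT y|lborel. w y * laplacian j (x - y))"
    unfolding mollify_def laplacian_def sum_distrib_left
    by (rule Bochner_Integration.integral_sum[symmetric])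
       (intro integrable_mult_test_function[OF assms(1)] test_function_reflect t)
  finally show ?thesis using laplacian_reflect[OF sm] by simp
qed

definition mollifier :: "real \<Rightarrow> ('a::euclidean_space \<Rightarrow> real) \<Rightarrow> bool" where
  "mollifier e j \<longleftrightarrow> smooth j \<and> (\<forall>x. 0 \<le> j x) \<and> (\<forall>x. norm x > e \<longrightarrow> j x = 0) \<and>
     integral\<^sup>L lborel j = 1"

lemma mollifier_test_function:
  assumes "mollifier e j" shows "test_function UNIV j"
  by (rule test_functionI[of _ "cball 0 e"]) (use assms in \<open>auto simp: mollifier_def not_less[symmetric]\<close>)

lemma mollifier_exists:
  assumes "e > 0" obtains j :: "'a::euclidean_space \<Rightarrow> real" where "mollifier e j"
proof -
  obtain \<beta> :: "'a \<Rightarrow> real" where b: "smooth \<beta>" "\<And>x. \<beta> x \<ge> 0" "\<beta> 0 > 0" "\<And>x. norm x > 1 \<Longrightarrow> \<beta> x = 0"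
    using smooth_bump_exists by metis
  define g where "g = (\<lambda>x. \<beta> ((1 / e) *\<^sub>R x))"
  have "linear ((*\<^sub>R) (1 / e) :: 'a \<Rightarrow> 'a)" by (rule linear_scaleR)
  from smooth_affine[OF b(1) this, of 0] have sg: "smooth g" by (simp add: g_def)
  have g0: "g x = 0" if "norm x > e" for x
    unfolding g_def by (rule b(4)) (use assms that in \<open>simp add: field_simps\<close>)
  have gn: "g x \<ge> 0" for x using b by (simp add: g_def)
  have tg: "test_function UNIV g"
    by (rule test_functionI[of _ "cball 0 e"]) (use sg g0 in \<open>auto simp: not_less[symmetric]\<close>)
  have "integrable lborel (\<lambda>x. 1 * g x)"
    by (rule integrable_mult_test_function[OF locally_integrable_continuous tg]) simp
  then have ig: "integrable lborel g" by simp
  have "isCont g 0" using smooth_continuous[OF sg] by (simp add: continuous_on_eq_continuous_at)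
  moreover have "\<beta> 0 / 2 > 0" using b by simp
  ultimately obtain d where d: "d > 0" "\<And>x. dist x 0 < d \<Longrightarrow> dist (g x) (g 0) < \<beta> 0 / 2"
    unfolding continuous_at_eps_delta by metis
  have "0 < \<beta> 0 / 2 * measure lborel (ball (0::'a) d)"
    using d b(3) content_ball_pos[of d "0::'a"] by simp
  also have "\<dots> = (LINT x|lborel. \<beta> 0 / 2 * indicator (ball (0::'a) d) x)"
    by simp
  also have "\<dots> \<le> integral\<^sup>L lborel g"
  proof (rule integral_mono)
    show "integrable lborel (\<lambda>x. \<beta> 0 / 2 * indicator (ball (0::'a) d) x)"
      using emeasure_lborel_ball_finite[of "0::'a" d] by (intro integrable_mult_right integrable_real_indicator) auto
    show "\<beta> 0 / 2 * indicator (ball 0 d) x \<le> g x" for x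
    proof (cases "norm x < d")
      case True
      then have "\<bar>g x - \<beta> 0\<bar> < \<beta> 0 / 2" using d(2)[of x] by (simp add: dist_norm g_def)
      then have "\<beta> 0 / 2 \<le> g x" by linarith
      with True show ?thesis by simp
    qed (use gn[of x] in simp)
  qed (rule ig)
  finally have I: "integral\<^sup>L lborel g > 0" .
  have "mollifier e (\<lambda>x. inverse (integral\<^sup>L lborel g) * g x)"
    unfolding mollifier_def using sg g0 gn I by (auto intro!: Ck_mult Ck_const)
  then show ?thesis using that by blast
qed

lemma lborel_reflect: "distr lborel borel (\<lambda>y. x - y) = (lborel :: 'a::euclidean_space measure)"
  by (subst (2) lborel_affine[of "-1" x]) (auto simp: density_1)

lemma integral_reflect:
  fixes j :: "'a::euclidean_space \<Rightarrow> real"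
  assumes "j \<in> borel_measurable borel"
  shows "(LINT y|lborel. j (x - y)) = integral\<^sup>L lborel j"
proof -
  have "integral\<^sup>L (distr lborel borel (\<lambda>y. x - y)) j = (LINT y|lborel. j (x - y))"
    using assms by (intro integral_distr) auto
  then show ?thesis by (simp add: lborel_reflect)
qed

lemma mollify_const:
  assumes "mollifier e j" shows "(LINT y|lborel. a * j (x - y)) = a"
proof -
  have "j \<in> borel_measurable borel"
    using assms by (auto simp: mollifier_def intro!: borel_measurable_continuous_onI smooth_continuous)
  from integral_reflect[OF this, of x] assms show ?thesis by (simp add: mollifier_def)
qed

text \<open>The value at \<open>x\<close> is an average of \<open>w\<close> over the ball of radius \<open>e\<close> about \<open>x\<close>.\<close>

lemma mollify_le:
  assumes j: "mollifier e j" and w: "locally_integrable UNIV w"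
    and le: "\<And>y. norm (y - x) \<le> e \<Longrightarrow> w y \<le> a"
  shows "mollify j w x \<le> a"
proof -
  have t: "test_function UNIV (\<lambda>y. j (x - y))"
    using j by (intro test_function_reflect mollifier_test_function)
  have "mollify j w x \<le> (LINT y|lborel. a * j (x - y))"
    unfolding mollify_def
  proof (rule integral_mono)
    show "integrable lborel (\<lambda>y. w y * j (x - y))" by (rule integrable_mult_test_function[OF w t])
    show "integrable lborel (\<lambda>y. a * j (x - y))"
      by (rule integrable_mult_test_function[OF locally_integrable_continuous t]) simp
    fix y
    show "w y * j (x - y) \<le> a * j (x - y)"
      using j le[of y] unfolding mollifier_def
      by (cases "norm (x - y) > e") (auto intro: mult_right_mono simp: norm_minus_commute)
  qed
  also have "\<dots> = a" by (rule mollify_const[OF j])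
  finally show ?thesis .
qed

lemma mollify_ge:
  assumes j: "mollifier e j" and w: "locally_integrable UNIV w"
    and ge: "\<And>y. norm (y - x) \<le> e \<Longrightarrow> a \<le> w y"
  shows "a \<le> mollify j w x"
proof -
  have "locally_integrable UNIV (\<lambda>y. - w y)"
    using w unfolding locally_integrable_def set_integrable_def by simp
  from mollify_le[OF j this, of x "- a"] ge show ?thesis by (simp add: mollify_def)
qed

section \<open>Square integrable functions\<close>

lemma integrable_exp_abs:
  fixes a :: real assumes "a > 0" shows "integrable lborel (\<lambda>s::real. exp (- a * \<bar>s\<bar>))"
proof -
  have "(\<integral>\<^sup>+s. ennreal (exp (- a * s)) * indicator {0..} s \<partial>lborel) = 0 - (- exp (- a * 0) / a)"
  proof (rule nn_integral_FTC_atLeast)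
    show "((\<lambda>s. - exp (- a * s) / a) has_real_derivative exp (- a * s)) (at s)" for s
      using assms by (auto intro!: derivative_eq_intros)
    have "((\<lambda>s. exp (- (a * s))) \<longlongrightarrow> 0) at_top"
      using assms by (intro filterlim_compose[OF exp_at_bot] filterlim_compose[OF filterlim_uminus_at_bot_at_top]
          filterlim_tendsto_pos_mult_at_top[OF tendsto_const]) (auto intro: filterlim_ident)
    from tendsto_divide[OF tendsto_minus[OF this] tendsto_const[of a]] assms
    show "((\<lambda>s. - exp (- a * s) / a) \<longlongrightarrow> 0) at_top" by simp
  qed auto
  then have "(\<integral>\<^sup>+s. ennreal (indicator {0..} s * exp (- a * \<bar>s\<bar>)) \<partial>lborel) = ennreal (1 / a)"
    by (subst (asm) nn_integral_cong[where v = "\<lambda>s. ennreal (indicator {0..} s * exp (- a * \<bar>s\<bar>))"])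
       (auto simp: indicator_def)
  then have "has_bochner_integral lborel (\<lambda>s. indicator {0..} s *\<^sub>R exp (- a * \<bar>s\<bar>)) (1 / a)"
    using assms by (intro has_bochner_integral_nn_integral) auto
  from has_bochner_integral_even_function[OF this] show ?thesis
    by (auto simp: has_bochner_integral_iff)
qed

text \<open>As \<open>\<bar>x\<bar>\<close> is at least the mean of the \<open>\<bar>x \<bullet> b\<bar>\<close>, the integrand is dominated by a product of functions
of one coordinate each.\<close>

lemma integrable_exp_norm:
  fixes c :: real assumes "c > 0"
  shows "integrable lborel (\<lambda>x::'a::euclidean_space. exp (- c * norm x))"
proof (rule integrableI_bounded)
  define a where "a = c / DIM('a)"
  have a: "a > 0" using assms by (simp add: a_def)
  have "(\<integral>\<^sup>+x. ennreal (norm (exp (- c * norm (x::'a)))) \<partial>lborel)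
     \<le> (\<integral>\<^sup>+x. (\<Prod>b\<in>Basis. ennreal (exp (- a * \<bar>(x::'a) \<bullet> b\<bar>))) \<partial>lborel)"
  proof (rule nn_integral_mono)
    fix x :: 'a
    have "(\<Sum>b\<in>Basis. \<bar>x \<bullet> b\<bar>) \<le> (\<Sum>b\<in>(Basis::'a set). norm x)"
      by (intro sum_mono Basis_le_norm)
    then have "a * (\<Sum>b\<in>Basis. \<bar>x \<bullet> b\<bar>) \<le> a * (DIM('a) * norm x)" using a by (intro mult_left_mono) auto
    then have "exp (- c * norm x) \<le> exp (- a * (\<Sum>b\<in>Basis. \<bar>x \<bullet> b\<bar>))" by (simp add: a_def)
    also have "\<dots> = (\<Prod>b\<in>Basis. exp (- a * \<bar>x \<bullet> b\<bar>))" by (simp add: exp_sum sum_distrib_left)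
    finally show "ennreal (norm (exp (- c * norm x))) \<le> (\<Prod>b\<in>Basis. ennreal (exp (- a * \<bar>x \<bullet> b\<bar>)))"
      by (simp add: prod_ennreal ennreal_leI)
  qed
  also have "\<dots> = (\<Prod>b\<in>(Basis::'a set). (\<integral>\<^sup>+s. ennreal (exp (- a * \<bar>s\<bar>)) \<partial>lborel))"
    by (rule nn_integral_lborel_prod) auto
  also have "\<dots> < \<infinity>"
  proof -
    have "(\<integral>\<^sup>+s. ennreal (exp (- a * \<bar>s\<bar>)) \<partial>lborel) = ennreal (LINT s|lborel. exp (- a * \<bar>s\<bar>))"
      by (rule nn_integral_eq_integral[OF integrable_exp_abs[OF a]]) auto
    then show ?thesis by (simp add: power_less_top_ennreal)
  qed
  finally show "(\<integral>\<^sup>+x. ennreal (norm (exp (- c * norm (x::'a)))) \<partial>lborel) < \<infinity>" .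
qed auto

lemma Lp_norm_2:
  assumes [measurable]: "f \<in> borel_measurable lborel"
  shows "Lp_norm 2 f = (if integrable lborel (\<lambda>x. (f x)\<^sup>2) then ennreal (sqrt (LINT x|lborel. (f x)\<^sup>2)) else \<infinity>)"
proof -
  define I where "I = (\<integral>\<^sup>+x. ennreal ((f x)\<^sup>2) \<partial>lborel)"
  have e2: "enn2real 2 = 2" by (metis enn2real_ennreal ennreal_numeral zero_le_numeral)
  have "(\<integral>\<^sup>+x. ennreal (\<bar>f x\<bar> powr enn2real 2) \<partial>lborel) = I"
    unfolding I_def by (intro nn_integral_cong) (simp add: e2)
  then have L: "Lp_norm 2 f = (if I = \<infinity> then \<infinity> else ennreal (enn2real I powr (1 / 2)))"
    by (simp add: Lp_norm_def Let_def e2)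
  show ?thesis
  proof (cases "integrable lborel (\<lambda>x. (f x)\<^sup>2)")
    case True
    have "0 \<le> (LINT x|lborel. (f x)\<^sup>2)" by (intro integral_nonneg_AE) auto
    moreover have "I = ennreal (LINT x|lborel. (f x)\<^sup>2)"
      unfolding I_def using True by (intro nn_integral_eq_integral) auto
    ultimately show ?thesis using True by (simp add: L powr_half_sqrt)
  next
    case False
    have "I = \<infinity>"
    proof (rule ccontr)
      assume "I \<noteq> \<infinity>"
      then have "(\<integral>\<^sup>+x. ennreal (norm ((f x)\<^sup>2)) \<partial>lborel) < \<infinity>" by (simp add: I_def less_top)
      then have "integrable lborel (\<lambda>x. (f x)\<^sup>2)" by (intro integrableI_bounded) auto
      with False show False by simp
    qed
    with False show ?thesis by (simp add: L)
  qed
qed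

lemma in_L2_iff: "in_L2 f \<longleftrightarrow> f \<in> borel_measurable lborel \<and> integrable lborel (\<lambda>x. (f x)\<^sup>2)"
  by (auto simp: in_L2_def Lp_norm_2 split: if_splits)

lemma L2_norm_eq: "in_L2 f \<Longrightarrow> L2_norm f = sqrt (LINT x|lborel. (f x)\<^sup>2)"
  by (simp add: in_L2_iff L2_norm_def Lp_norm_2)

lemma L2_norm_nonneg: "0 \<le> L2_norm f"
  by (simp add: L2_norm_def)

lemma in_L2_mono:
  assumes "in_L2 G" "g \<in> borel_measurable lborel" "\<And>x. \<bar>g x\<bar> \<le> G x"
  shows "in_L2 g" and "L2_norm g \<le> L2_norm G"
proof -
  have le: "(g x)\<^sup>2 \<le> (G x)\<^sup>2" for x
    using power_mono[OF assms(3)[of x], of 2] by simp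
  have "integrable lborel (\<lambda>x. (g x)\<^sup>2)"
    by (rule Bochner_Integration.integrable_bound[of _ "\<lambda>x. (G x)\<^sup>2"]) (use assms le in \<open>auto simp: in_L2_iff\<close>)
  then show g: "in_L2 g" using assms by (simp add: in_L2_iff)
  show "L2_norm g \<le> L2_norm G"
    unfolding L2_norm_eq[OF g] L2_norm_eq[OF assms(1)]
    by (intro real_sqrt_le_mono integral_mono) (use assms g le in \<open>auto simp: in_L2_iff\<close>)
qed

lemma in_L2_cmult: assumes "in_L2 f" shows "in_L2 (\<lambda>x. a * f x)" and "L2_norm (\<lambda>x. a * f x) = \<bar>a\<bar> * L2_norm f"
proof -
  show 1: "in_L2 (\<lambda>x. a * f x)" using assms by (auto simp: in_L2_iff power_mult_distrib)
  show "L2_norm (\<lambda>x. a * f x) = \<bar>a\<bar> * L2_norm f"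
    unfolding L2_norm_eq[OF 1] L2_norm_eq[OF assms] by (simp add: power_mult_distrib real_sqrt_mult)
qed

lemma in_L2_diff:
  assumes "in_L2 f" "in_L2 g" shows "in_L2 (\<lambda>x. f x - g x)"
proof -
  have "(f x - g x)\<^sup>2 \<le> 2 * (f x)\<^sup>2 + 2 * (g x)\<^sup>2" for x
    using zero_le_power2[of "f x + g x"] by (simp add: power2_eq_square algebra_simps)
  then have "integrable lborel (\<lambda>x. (f x - g x)\<^sup>2)"
    by (intro Bochner_Integration.integrable_bound[of _ "\<lambda>x. 2 * (f x)\<^sup>2 + 2 * (g x)\<^sup>2" "\<lambda>x. (f x - g x)\<^sup>2"])
       (use assms in \<open>auto simp: in_L2_iff\<close>)
  then show ?thesis using assms by (auto simp: in_L2_iff)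
qed

lemma L2_Cauchy_Schwarz:
  assumes f: "in_L2 f" and g: "in_L2 g"
  shows "integrable lborel (\<lambda>x. f x * g x)"
    and "\<bar>LINT x|lborel. f x * g x\<bar> \<le> L2_norm f * L2_norm g"
proof -
  have [measurable]: "f \<in> borel_measurable lborel" "g \<in> borel_measurable lborel"
    and i: "integrable lborel (\<lambda>x. (f x)\<^sup>2)" "integrable lborel (\<lambda>x. (g x)\<^sup>2)"
    using f g by (auto simp: in_L2_iff)
  have "\<bar>f x * g x\<bar> \<le> (f x)\<^sup>2 + (g x)\<^sup>2" for x
  proof -
    have "0 \<le> (\<bar>f x\<bar> - \<bar>g x\<bar>)\<^sup>2" by simp
    then have "2 * (\<bar>f x\<bar> * \<bar>g x\<bar>) \<le> (f x)\<^sup>2 + (g x)\<^sup>2" by (simp add: power2_diff mult.assoc)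
    moreover have "0 \<le> \<bar>f x\<bar> * \<bar>g x\<bar>" by simp
    ultimately show ?thesis unfolding abs_mult by linarith
  qed
  then show ifg: "integrable lborel (\<lambda>x. f x * g x)"
    using i by (intro Bochner_Integration.integrable_bound[of _ "\<lambda>x. (f x)\<^sup>2 + (g x)\<^sup>2" "\<lambda>x. f x * g x"]) auto
  have "(\<integral>\<^sup>+x. ennreal \<bar>f x\<bar> * ennreal \<bar>g x\<bar> \<partial>lborel)\<^sup>2
      \<le> (\<integral>\<^sup>+x. (ennreal \<bar>f x\<bar>)\<^sup>2 \<partial>lborel) * (\<integral>\<^sup>+x. (ennreal \<bar>g x\<bar>)\<^sup>2 \<partial>lborel)"
    by (rule Cauchy_Schwarz_nn_integral) auto
  also have "(\<integral>\<^sup>+x. (ennreal \<bar>f x\<bar>)\<^sup>2 \<partial>lborel) = ennreal (LINT x|lborel. (f x)\<^sup>2)"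
    using i by (subst nn_integral_eq_integral[symmetric]) (auto simp: ennreal_power intro!: nn_integral_cong)
  also have "(\<integral>\<^sup>+x. (ennreal \<bar>g x\<bar>)\<^sup>2 \<partial>lborel) = ennreal (LINT x|lborel. (g x)\<^sup>2)"
    using i by (subst nn_integral_eq_integral[symmetric]) (auto simp: ennreal_power intro!: nn_integral_cong)
  also have "(\<integral>\<^sup>+x. ennreal \<bar>f x\<bar> * ennreal \<bar>g x\<bar> \<partial>lborel) = ennreal (LINT x|lborel. \<bar>f x * g x\<bar>)"
    using nn_integral_eq_integral[OF integrable_abs[OF ifg]] by (simp add: ennreal_mult abs_mult)
  finally have "(LINT x|lborel. \<bar>f x * g x\<bar>)\<^sup>2 \<le> (LINT x|lborel. (f x)\<^sup>2) * (LINT x|lborel. (g x)\<^sup>2)"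
    by (simp add: ennreal_power ennreal_mult[symmetric])
  then have "LINT x|lborel. \<bar>f x * g x\<bar> \<le> sqrt ((LINT x|lborel. (f x)\<^sup>2) * (LINT x|lborel. (g x)\<^sup>2))"
    by (rule real_le_rsqrt)
  then show "\<bar>LINT x|lborel. f x * g x\<bar> \<le> L2_norm f * L2_norm g"
    unfolding L2_norm_eq[OF f] L2_norm_eq[OF g] real_sqrt_mult[symmetric]
    by (rule order_trans[OF integral_abs_bound])
qed

text \<open>The form of the Cauchy-Schwarz inequality in which the second factor is only known through
a majorant.\<close>

lemma L2_bound:
  assumes "in_L2 f" "in_L2 G" "g \<in> borel_measurable lborel" "\<And>x. \<bar>g x\<bar> \<le> G x"
  shows "integrable lborel (\<lambda>x. f x * g x)"
    and "\<bar>LINT x|lborel. f x * g x\<bar> \<le> L2_norm f * L2_norm G"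
proof -
  note g = in_L2_mono[OF assms(2-4)]
  show "integrable lborel (\<lambda>x. f x * g x)" by (rule L2_Cauchy_Schwarz[OF assms(1) g(1)])
  show "\<bar>LINT x|lborel. f x * g x\<bar> \<le> L2_norm f * L2_norm G"
    using L2_Cauchy_Schwarz(2)[OF assms(1) g(1)] mult_left_mono[OF g(2) L2_norm_nonneg[of f]] by linarith
qed

lemma in_L2_indicator:
  assumes "compact K" shows "in_L2 (indicator K)" and "L2_norm (indicator K) = sqrt (measure lborel K)"
proof -
  have K: "K \<in> sets borel" "emeasure lborel K < \<infinity>"
    using assms emeasure_lborel_cbox_finite emeasure_compact_finite[of K] by (auto intro: borel_compact)
  have e: "(\<lambda>x. (indicator K x)\<^sup>2) = (indicator K :: 'a \<Rightarrow> real)" by (auto simp: indicator_def)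
  have "integrable lborel (indicator K :: 'a \<Rightarrow> real)" using K by (intro integrable_real_indicator) auto
  then show 1: "in_L2 (indicator K)" using K by (simp add: in_L2_iff e)
  show "L2_norm (indicator K) = sqrt (measure lborel K)"
    using L2_norm_eq[OF 1] by (simp add: e)
qed

lemma in_L2_locally_integrable:
  assumes "in_L2 f" shows "locally_integrable \<Omega> f"
  unfolding locally_integrable_def set_integrable_def
proof (intro allI impI)
  fix K :: "'a set" assume "compact K \<and> K \<subseteq> \<Omega>"
  then have "integrable lborel (\<lambda>x. f x * indicator K x)"
    using L2_Cauchy_Schwarz(1)[OF assms in_L2_indicator(1)] by blast
  then show "integrable lborel (\<lambda>x. indicator K x *\<^sub>R f x)" by (simp add: mult.commute)
qed

lemma in_L2_exp_norm:
  assumes "c > 0" shows "in_L2 (\<lambda>x::'a::euclidean_space. a * exp (- c * norm x))"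
proof -
  have "(exp (- c * norm x))\<^sup>2 = exp (- (2 * c) * norm x)" for x :: 'a
    by (simp add: exp_double[symmetric])
  with integrable_exp_norm[of "2 * c"] assms have "in_L2 (\<lambda>x::'a. exp (- c * norm x))"
    by (simp add: in_L2_iff)
  then show ?thesis by (rule in_L2_cmult)
qed

section \<open>Sobolev functions\<close>

lemma weak_partial:
  assumes "in_H1 f" "b \<in> Basis"
  shows "in_L2 (weak_partial b f)" "weak_deriv UNIV b f (weak_partial b f)"
  using someI_ex[of "\<lambda>g. in_L2 g \<and> weak_deriv UNIV b f g"] assms
  by (auto simp: in_H1_def weak_partial_def)

lemma H1_norm_ge:
  shows "L2_norm f \<le> H1_norm f" and "b \<in> Basis \<Longrightarrow> L2_norm (weak_partial b f) \<le> H1_norm f"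
proof -
  have s: "0 \<le> (\<Sum>b\<in>Basis. (L2_norm (weak_partial b f))\<^sup>2)" by (intro sum_nonneg) auto
  then show "L2_norm f \<le> H1_norm f" unfolding H1_norm_def by (intro real_le_rsqrt) simp
  show "L2_norm (weak_partial b f) \<le> H1_norm f" if "b \<in> Basis"
    unfolding H1_norm_def
    using member_le_sum[OF that, of "\<lambda>b. (L2_norm (weak_partial b f))\<^sup>2"]
    by (intro real_le_rsqrt) (simp add: add_increasing)
qed

lemma H1_norm_nonneg: "0 \<le> H1_norm f"
  using H1_norm_ge(1)[of f] L2_norm_nonneg[of f] by linarith

lemma weak_deriv_diff:
  assumes "weak_deriv \<Omega> b f f'" "weak_deriv \<Omega> b g g'" "b \<in> Basis"
  shows "weak_deriv \<Omega> b (\<lambda>x. f x - g x) (\<lambda>x. f' x - g' x)"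
  unfolding weak_deriv_def
proof (intro conjI allI impI)
  have li: "locally_integrable \<Omega> f" "locally_integrable \<Omega> g" "locally_integrable \<Omega> f'" "locally_integrable \<Omega> g'"
    using assms by (auto simp: weak_deriv_def)
  then show "locally_integrable \<Omega> (\<lambda>x. f x - g x)" "locally_integrable \<Omega> (\<lambda>x. f' x - g' x)"
    unfolding locally_integrable_def by auto
  fix \<eta> assume \<eta>: "test_function \<Omega> \<eta>"
  note i = integrable_mult_test_function[OF _ \<eta>] integrable_mult_test_function[OF _ test_function_dir_deriv[OF \<eta> assms(3)]]
  show "(LINT x|lborel. (f x - g x) * dir_deriv b \<eta> x) = - (LINT x|lborel. (f' x - g' x) * \<eta> x)"
  proof -
    have "(LINT x|lborel. f x * dir_deriv b \<eta> x) = - (LINT x|lborel. f' x * \<eta> x)"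
      "(LINT x|lborel. g x * dir_deriv b \<eta> x) = - (LINT x|lborel. g' x * \<eta> x)"
      using assms \<eta> by (auto simp: weak_deriv_def)
    then show ?thesis using i li by (simp add: left_diff_distrib)
  qed
qed

lemma in_H1_diff:
  assumes "in_H1 f" "in_H1 g" shows "in_H1 (\<lambda>x. f x - g x)"
  unfolding in_H1_def
proof (intro conjI ballI)
  show "in_L2 (\<lambda>x. f x - g x)" using assms by (intro in_L2_diff) (auto simp: in_H1_def)
  fix b :: 'a assume b: "b \<in> Basis"
  show "\<exists>h. in_L2 h \<and> weak_deriv UNIV b (\<lambda>x. f x - g x) h"
    using in_L2_diff[OF weak_partial(1)[OF assms(1) b] weak_partial(1)[OF assms(2) b]]
      weak_deriv_diff[OF weak_partial(2)[OF assms(1) b] weak_partial(2)[OF assms(2) b] b]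
    by (intro exI conjI)
qed

section \<open>Approximation of the bound state by test functions\<close>

text \<open>A single bump is dilated by \<open>R\<close>, so that each derivative gains a factor \<open>1/R\<close>. The bump has the value
\<open>1\<close> at the origin, hence it exceeds \<open>1/2\<close> on some ball, and its dilation on a ball whose radius grows
with \<open>R\<close>.\<close>

lemma cutoff_exists:
  obtains M d :: real and \<zeta> :: "real \<Rightarrow> 'a::euclidean_space \<Rightarrow> real"
  where "M > 0" "d > 0"
    and "\<And>R. R \<ge> 1 \<Longrightarrow> test_function UNIV (\<zeta> R)"
    and "\<And>R x. 0 \<le> \<zeta> R x" and "\<And>R x. \<zeta> R x \<le> M"
    and "\<And>R x. R \<ge> 1 \<Longrightarrow> norm x > R \<Longrightarrow> \<zeta> R x = 0"
    and "\<And>R x b. R \<ge> 1 \<Longrightarrow> b \<in> Basis \<Longrightarrow> \<bar>dir_deriv b (\<zeta> R) x\<bar> \<le> M / R"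
    and "\<And>R x b. R \<ge> 1 \<Longrightarrow> b \<in> Basis \<Longrightarrow> \<bar>dir_deriv b (dir_deriv b (\<zeta> R)) x\<bar> \<le> M / R"
    and "\<And>R x. R \<ge> 1 \<Longrightarrow> norm x \<le> d * R \<Longrightarrow> 1 / 2 \<le> \<zeta> R x"
proof -
  obtain \<beta> :: "'a \<Rightarrow> real" where b: "smooth \<beta>" "\<And>x. \<beta> x \<ge> 0" "\<beta> 0 > 0" "\<And>x. norm x > 1 \<Longrightarrow> \<beta> x = 0"
    using smooth_bump_exists by metis
  define g where "g = (\<lambda>x. inverse (\<beta> 0) * \<beta> x)"
  have sg: "smooth g" unfolding g_def using b by (intro allI Ck_mult Ck_const) auto
  have g: "g x \<ge> 0" "g 0 = 1" "norm x > 1 \<Longrightarrow> g x = 0" for x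
    using b by (auto simp: g_def)
  have tg: "test_function UNIV g"
    by (rule test_functionI[of _ "cball 0 1"]) (use sg g in \<open>auto simp: not_less[symmetric]\<close>)
  have bd: "\<exists>C. \<forall>x. \<bar>f x\<bar> \<le> C" if t: "test_function UNIV f" for f :: "'a \<Rightarrow> real"
  proof -
    obtain K where "compact K" "\<And>x. x \<notin> K \<Longrightarrow> f x = 0"
      using test_function_support[OF t] by metis
    with smooth_continuous[OF test_function_smooth[OF t]] show ?thesis
      using continuous_support_bounded[of f K] by metis
  qed
  obtain M0 where M0: "\<And>x. \<bar>g x\<bar> \<le> M0" using bd[OF tg] by metis
  have "\<forall>b\<in>Basis. \<exists>C. \<forall>x. \<bar>dir_deriv b g x\<bar> \<le> C"
    using bd test_function_dir_deriv[OF tg] by blast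
  then obtain M1 where M1: "\<And>b x. b \<in> Basis \<Longrightarrow> \<bar>dir_deriv b g x\<bar> \<le> M1 b" by metis
  have "\<forall>b\<in>Basis. \<exists>C. \<forall>x. \<bar>dir_deriv b (dir_deriv b g) x\<bar> \<le> C"
    using bd test_function_dir_deriv[OF test_function_dir_deriv[OF tg]] by blast
  then obtain M2 where M2: "\<And>b x. b \<in> Basis \<Longrightarrow> \<bar>dir_deriv b (dir_deriv b g) x\<bar> \<le> M2 b" by metis
  define M where "M = 1 + \<bar>M0\<bar> + (\<Sum>b\<in>Basis. \<bar>M1 b\<bar>) + (\<Sum>b\<in>Basis. \<bar>M2 b\<bar>)"
  have S: "0 \<le> (\<Sum>b\<in>Basis. \<bar>M1 b\<bar>)" "0 \<le> (\<Sum>b\<in>Basis. \<bar>M2 b\<bar>)" by (auto intro: sum_nonneg)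
  have M: "M > 0" "M0 \<le> M" using S unfolding M_def by linarith+
  have Mb: "M1 b \<le> M" "M2 b \<le> M" if "b \<in> Basis" for b
  proof -
    have "\<bar>M1 b\<bar> \<le> (\<Sum>b\<in>Basis. \<bar>M1 b\<bar>)" "\<bar>M2 b\<bar> \<le> (\<Sum>b\<in>Basis. \<bar>M2 b\<bar>)"
      using that by (auto intro!: member_le_sum)
    with S show "M1 b \<le> M" "M2 b \<le> M" unfolding M_def by linarith+
  qed
  define \<zeta> where "\<zeta> R x = g ((1 / R) *\<^sub>R x)" for R x
  have sz: "smooth (\<zeta> R)" for R
    using smooth_affine[OF sg linear_scaleR, of "1 / R" 0] by (simp add: \<zeta>_def[abs_def])
  have z0: "\<zeta> R x = 0" if "R \<ge> 1" "norm x > R" for R x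
    unfolding \<zeta>_def by (rule g(3)) (use that in \<open>simp add: field_simps\<close>)
  have "test_function UNIV (\<zeta> R)" if "R \<ge> 1" for R
    by (rule test_functionI[of _ "cball 0 R"]) (use sz z0[OF that] in \<open>auto simp: not_less[symmetric]\<close>)
  moreover have "0 \<le> \<zeta> R x" "\<zeta> R x \<le> M" for R x
    using g(1) M0[of "(1 / R) *\<^sub>R x"] M by (auto simp: \<zeta>_def)
  moreover have d1: "dir_deriv b (\<zeta> R) = (\<lambda>x. (1 / R) * dir_deriv b g ((1 / R) *\<^sub>R x))" for b R
    using dir_deriv_scale[OF smooth_differentiable[OF sg]] by (simp add: \<zeta>_def[abs_def])
  moreover have "\<bar>dir_deriv b (\<zeta> R) x\<bar> \<le> M / R" if "R \<ge> 1" "b \<in> Basis" for R x b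
  proof -
    have "\<bar>dir_deriv b g ((1 / R) *\<^sub>R x)\<bar> \<le> M"
      using M1[OF that(2)] Mb(1)[OF that(2)] order_trans by blast
    then show ?thesis using that by (simp add: d1 abs_mult divide_right_mono)
  qed
  moreover have "\<bar>dir_deriv b (dir_deriv b (\<zeta> R)) x\<bar> \<le> M / R" if R: "R \<ge> 1" "b \<in> Basis" for R x b
  proof -
    have sgb: "smooth (dir_deriv b g)" using sg R(2) by (rule smooth_dir_deriv)
    then have "smooth (\<lambda>x. dir_deriv b g ((1 / R) *\<^sub>R x))"
      using smooth_affine[OF _ linear_scaleR, of "dir_deriv b g" "1 / R" 0] by simp
    then have "dir_deriv b (dir_deriv b (\<zeta> R)) x = (1 / R) * ((1 / R) * dir_deriv b (dir_deriv b g) ((1 / R) *\<^sub>R x))"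
      unfolding d1 by (subst dir_deriv_cmult)
        (auto intro: smooth_differentiable simp: dir_deriv_scale[OF smooth_differentiable[OF sgb]])
    moreover have "\<bar>dir_deriv b (dir_deriv b g) ((1 / R) *\<^sub>R x)\<bar> \<le> M"
      using M2[OF R(2)] Mb(2)[OF R(2)] order_trans by blast
    moreover have "(1 / R) * ((1 / R) * M) \<le> (1 / R) * (1 * M)"
      using R M by (intro mult_left_mono mult_right_mono) auto
    ultimately show ?thesis
      using R mult_left_mono[of "\<bar>dir_deriv b (dir_deriv b g) ((1 / R) *\<^sub>R x)\<bar>" M "(1 / R) * (1 / R)"]
      by (simp add: abs_mult mult.assoc)
  qed
  moreover obtain d where d: "d > 0" "\<And>x. dist x 0 < d \<Longrightarrow> dist (g x) (g 0) < 1 / 2"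
  proof -
    have "isCont g 0" using smooth_continuous[OF sg] by (simp add: continuous_on_eq_continuous_at)
    then show ?thesis using that unfolding continuous_at_eps_delta by (metis half_gt_zero zero_less_one)
  qed
  moreover have "1 / 2 \<le> \<zeta> R x" if "R \<ge> 1" "norm x \<le> d / 2 * R" for R x
  proof -
    have "norm x / R < d" using that d(1) by (simp add: field_simps) (smt (verit) mult_pos_pos)
    then have "dist (g ((1 / R) *\<^sub>R x)) (g 0) < 1 / 2"
      using that by (intro d(2)) simp
    then show ?thesis using g(2) by (simp add: dist_real_def \<zeta>_def abs_if split: if_splits)
  qed
  ultimately show ?thesis using that[of M "d / 2" \<zeta>] M(1) z0 by (simp add: zero_less_divide_iff)
qed

text \<open>The left-hand side is the average of \<open>(V x - V y) * w y\<close> over \<open>y\<close> near \<open>x\<close>: were \<open>V\<close> constant, the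
mollification of \<open>w\<close> would be an exact eigenfunction.\<close>

lemma schroedinger_mollify_bound:
  fixes V w :: "'a::euclidean_space \<Rightarrow> real"
  assumes V: "continuous_on UNIV V" and eig: "schroedinger_eigen_eq V (- lam) w"
    and j: "mollifier e j" and w: "\<And>y. \<bar>w y\<bar> \<le> C0"
    and close: "\<And>y. norm (y - x) \<le> e \<Longrightarrow> \<bar>V y - V x\<bar> \<le> h"
  shows "\<bar>- laplacian (mollify j w) x + (V x + lam) * mollify j w x\<bar> \<le> h * C0"
proof -
  define \<eta> where "\<eta> = (\<lambda>y. j (x - y))"
  have li: "locally_integrable UNIV w" using eig by (simp add: schroedinger_eigen_eq_def)
  have tj: "test_function UNIV j" using j by (rule mollifier_test_function)
  have t: "test_function UNIV \<eta>" unfolding \<eta>_def using tj by (rule test_function_reflect)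
  have m: "mollify j w x = (LINT y|lborel. w y * \<eta> y)" by (simp add: mollify_def \<eta>_def)
  have L: "laplacian (mollify j w) x = (LINT y|lborel. w y * laplacian \<eta> y)"
    unfolding \<eta>_def by (rule laplacian_mollify[OF li tj])
  note i = integrable_mult_laplacian[OF li t] integrable_mult_potential[OF li t V]
    integrable_mult_test_function[OF li t]
  have "(LINT y|lborel. w y * (- laplacian \<eta> y + V y * \<eta> y)) = - lam * (LINT y|lborel. w y * \<eta> y)"
    using eig t by (simp add: schroedinger_eigen_eq_def)
  moreover have "(LINT y|lborel. w y * (- laplacian \<eta> y + V y * \<eta> y))
     = - (LINT y|lborel. w y * laplacian \<eta> y) + (LINT y|lborel. w y * (V y * \<eta> y))"
    using i by (simp add: right_diff_distrib)
  ultimately have "- laplacian (mollify j w) x + (V x + lam) * mollify j w x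
      = V x * (LINT y|lborel. w y * \<eta> y) - (LINT y|lborel. w y * (V y * \<eta> y))"
    unfolding L m by (simp add: algebra_simps)
  also have "\<dots> = (LINT y|lborel. V x * (w y * \<eta> y) - w y * (V y * \<eta> y))" using i by simp
  also have "\<bar>\<dots>\<bar> \<le> (LINT y|lborel. h * C0 * j (x - y))"
  proof (rule integral_abs_bound_integral)
    show "integrable lborel (\<lambda>y. V x * (w y * \<eta> y) - w y * (V y * \<eta> y))" using i by simp
    show "integrable lborel (\<lambda>y. h * C0 * j (x - y))"
      by (rule integrable_mult_test_function[OF locally_integrable_continuous t[unfolded \<eta>_def]]) simp
    fix y
    show "\<bar>V x * (w y * \<eta> y) - w y * (V y * \<eta> y)\<bar> \<le> h * C0 * j (x - y)"
    proof (cases "norm (x - y) > e")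
      case True
      then show ?thesis using j by (simp add: mollifier_def \<eta>_def)
    next
      case False
      then have "\<bar>V x - V y\<bar> \<le> h" using close[of y] by (simp add: norm_minus_commute abs_minus_commute)
      then have "\<bar>V x - V y\<bar> * \<bar>w y\<bar> \<le> h * C0" using w[of y] by (intro mult_mono) auto
      moreover have "0 \<le> j (x - y)" using j by (simp add: mollifier_def)
      ultimately have "\<bar>V x - V y\<bar> * \<bar>w y\<bar> * j (x - y) \<le> h * C0 * j (x - y)" by (rule mult_right_mono)
      moreover have "V x * (w y * \<eta> y) - w y * (V y * \<eta> y) = (V x - V y) * w y * j (x - y)"
        by (simp add: \<eta>_def algebra_simps)
      ultimately show ?thesis using \<open>0 \<le> j (x - y)\<close> by (simp add: abs_mult)
    qed
  qed
  also have "\<dots> = h * C0" by (rule mollify_const[OF j])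
  finally show ?thesis .
qed

lemma nn_integral_mollifier:
  fixes j :: "'a::euclidean_space \<Rightarrow> real"
  assumes "mollifier e j" shows "(\<integral>\<^sup>+x. ennreal (j (x - y)) \<partial>lborel) = 1"
proof -
  have jm: "j \<in> borel_measurable borel" "\<And>x. 0 \<le> j x" "integral\<^sup>L lborel j = 1"
    using assms by (auto simp: mollifier_def intro!: borel_measurable_continuous_onI smooth_continuous)
  have ij: "integrable lborel j" using jm(3) not_integrable_integral_eq by fastforce
  have "(\<integral>\<^sup>+x. ennreal (j x) \<partial>distr lborel borel ((+) (- y))) = (\<integral>\<^sup>+x. ennreal (j (- y + x)) \<partial>lborel)"
    using jm by (intro nn_integral_distr) auto
  then have "(\<integral>\<^sup>+x. ennreal (j (x - y)) \<partial>lborel) = (\<integral>\<^sup>+x. ennreal (j x) \<partial>lborel)"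
    by (simp add: lborel_distr_plus)
  also have "\<dots> = ennreal 1" using nn_integral_eq_integral[OF ij] jm by simp
  finally show ?thesis by simp
qed

text \<open>For \<open>y\<close> in the smaller ball the kernel \<open>j (x - y)\<close>, as a function of \<open>x\<close>, lives in the larger
ball and has mass one there; Tonelli's theorem does the rest. The bound is uniform in the
mollifier, which a pointwise lower bound for \<open>mollify j w\<close> could not be, since \<open>w\<close> need not be continuous.\<close>

lemma mollify_mass:
  fixes w :: "'a::euclidean_space \<Rightarrow> real"
  assumes w: "locally_integrable UNIV w" "\<And>x. 0 \<le> w x" and j: "mollifier e j" and e: "e \<le> r"
  shows "(LINT x|lborel. indicator (cball x0 r) x * w x)
     \<le> (LINT x|lborel. indicator (cball x0 (2 * r)) x * mollify j w x)"
proof -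
  have tj: "test_function UNIV j" using j by (rule mollifier_test_function)
  have [measurable]: "w \<in> borel_measurable borel" using w(1) by (rule locally_integrable_measurable)
  have [measurable]: "j \<in> borel_measurable borel"
    using j by (auto simp: mollifier_def intro!: borel_measurable_continuous_onI smooth_continuous)
  have jn: "0 \<le> j x" for x using j by (simp add: mollifier_def)
  have mn: "0 \<le> mollify j w x" for x
    unfolding mollify_def using w(2) jn by (intro integral_nonneg_AE) auto
  have cm: "continuous_on UNIV (mollify j w)" by (rule smooth_continuous[OF smooth_mollify[OF w(1) tj]])
  have i1: "integrable lborel (\<lambda>x. indicator (cball x0 r) x * w x)"
    using w(1) unfolding locally_integrable_def set_integrable_def by simp
  have i2: "integrable lborel (\<lambda>x. indicator (cball x0 (2 * r)) x * mollify j w x)"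
    using locally_integrable_continuous[OF cm, of UNIV] unfolding locally_integrable_def set_integrable_def by simp
  have "ennreal (LINT x|lborel. indicator (cball x0 r) x * w x)
      = (\<integral>\<^sup>+y. ennreal (indicator (cball x0 r) y * w y) \<partial>lborel)"
    using w by (intro nn_integral_eq_integral[OF i1, symmetric]) auto
  also have "\<dots> \<le> (\<integral>\<^sup>+y. \<integral>\<^sup>+x. indicator (cball x0 (2 * r)) x * (ennreal (w y) * ennreal (j (x - y))) \<partial>lborel \<partial>lborel)"
  proof (rule nn_integral_mono)
    fix y
    show "ennreal (indicator (cball x0 r) y * w y)
      \<le> (\<integral>\<^sup>+x. indicator (cball x0 (2 * r)) x * (ennreal (w y) * ennreal (j (x - y))) \<partial>lborel)"
    proof (cases "y \<in> cball x0 r")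
      case True
      have "ennreal (w y) = (\<integral>\<^sup>+x. ennreal (w y) * ennreal (j (x - y)) \<partial>lborel)"
        using nn_integral_mollifier[OF j, of y] by (simp add: nn_integral_cmult)
      also have "\<dots> \<le> (\<integral>\<^sup>+x. indicator (cball x0 (2 * r)) x * (ennreal (w y) * ennreal (j (x - y))) \<partial>lborel)"
      proof (rule nn_integral_mono)
        fix x
        show "ennreal (w y) * ennreal (j (x - y)) \<le> indicator (cball x0 (2 * r)) x * (ennreal (w y) * ennreal (j (x - y)))"
        proof (cases "norm (x - y) > e")
          case True
          then show ?thesis using j by (simp add: mollifier_def)
        next
          case False
          have "dist x0 x \<le> dist x0 y + dist y x" by (rule dist_triangle)
          then have "x \<in> cball x0 (2 * r)" using False True e by (simp add: dist_norm norm_minus_commute)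
          then show ?thesis by simp
        qed
      qed
      finally show ?thesis using True by simp
    qed simp
  qed
  also have "\<dots> = (\<integral>\<^sup>+x. \<integral>\<^sup>+y. indicator (cball x0 (2 * r)) x * (ennreal (w y) * ennreal (j (x - y))) \<partial>lborel \<partial>lborel)"
  proof (rule lborel_pair.Fubini')
    have [measurable]: "(fst :: 'a \<times> 'a \<Rightarrow> 'a) \<in> borel_measurable (lborel \<Otimes>\<^sub>M lborel)"
      "(snd :: 'a \<times> 'a \<Rightarrow> 'a) \<in> borel_measurable (lborel \<Otimes>\<^sub>M lborel)"
      using measurable_fst[of lborel lborel] measurable_snd[of lborel lborel] by simp_all
    have "(indicator (cball x0 (2 * r)) :: 'a \<Rightarrow> ennreal) \<in> borel_measurable borel"
      by (intro borel_measurable_indicator borel_closed closed_cball)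
    then have [measurable]: "(\<lambda>z::'a \<times> 'a. indicator (cball x0 (2 * r)) (fst z) :: ennreal)
        \<in> borel_measurable (lborel \<Otimes>\<^sub>M lborel)"
      by (rule measurable_compose[rotated]) measurable
    show "(\<lambda>(x, y). indicator (cball x0 (2 * r)) x * (ennreal (w y) * ennreal (j (x - y))))
        \<in> borel_measurable (lborel \<Otimes>\<^sub>M lborel)"
      unfolding split_beta by measurable
  qed
  also have "\<dots> = (\<integral>\<^sup>+x. ennreal (indicator (cball x0 (2 * r)) x * mollify j w x) \<partial>lborel)"
  proof (rule nn_integral_cong)
    fix x
    have "(\<integral>\<^sup>+y. ennreal (w y) * ennreal (j (x - y)) \<partial>lborel) = (\<integral>\<^sup>+y. ennreal (w y * j (x - y)) \<partial>lborel)"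
      using w jn by (simp add: ennreal_mult)
    also have "\<dots> = ennreal (mollify j w x)"
      unfolding mollify_def using w jn
      by (intro nn_integral_eq_integral integrable_mult_test_function[OF w(1) test_function_reflect[OF tj]]) auto
    finally show "(\<integral>\<^sup>+y. indicator (cball x0 (2 * r)) x * (ennreal (w y) * ennreal (j (x - y))) \<partial>lborel)
      = ennreal (indicator (cball x0 (2 * r)) x * mollify j w x)"
      by (simp add: nn_integral_cmult indicator_def)
  qed
  also have "\<dots> = ennreal (LINT x|lborel. indicator (cball x0 (2 * r)) x * mollify j w x)"
    using mn by (intro nn_integral_eq_integral[OF i2]) auto
  finally show ?thesis using mn by (subst (asm) ennreal_le_iff) (auto intro!: integral_nonneg_AE)
qed

text \<open>The mixed term \<open>2 \<nabla>W \<bullet> \<nabla>\<zeta>\<close> of the product rule contains the gradient of \<open>W\<close>, which is not under control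
when \<open>W\<close> is a mollified bound state. It is removed by testing the weak gradient of \<open>f\<close> with \<open>W \<nabla>\<zeta>\<close>;
only derivatives of the cutoff and of \<open>f\<close> remain.\<close>

lemma laplacian_by_parts:
  fixes W \<zeta> f :: "'a::euclidean_space \<Rightarrow> real"
  assumes f: "in_H1 f" and W: "smooth W" and z: "test_function UNIV \<zeta>"
  shows "(LINT x|lborel. f x * laplacian (\<lambda>x. W x * \<zeta> x) x) =
     (LINT x|lborel. f x * (laplacian W x * \<zeta> x))
     - (\<Sum>b\<in>Basis. 2 * (LINT x|lborel. weak_partial b f x * (W x * dir_deriv b \<zeta> x))
         + (LINT x|lborel. f x * (W x * dir_deriv b (dir_deriv b \<zeta>) x)))"
proof -
  have li: "locally_integrable UNIV f" using f by (auto simp: in_H1_def intro: in_L2_locally_integrable)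
  have sz: "smooth \<zeta>" using z by (rule test_function_smooth)
  note t = test_function_mult[OF W z]
  have sb: "smooth (dir_deriv b W)" "test_function UNIV (dir_deriv b \<zeta>)"
      "test_function UNIV (dir_deriv b (dir_deriv b \<zeta>))" if "b \<in> Basis" for b
    by (rule smooth_dir_deriv[OF W that], intro test_function_dir_deriv z that)
       (intro test_function_dir_deriv z that)
  have i1: "integrable lborel (\<lambda>x. f x * (dir_deriv b W x * dir_deriv b \<zeta> x))"
    and i2: "integrable lborel (\<lambda>x. f x * (W x * dir_deriv b (dir_deriv b \<zeta>) x))" if "b \<in> Basis" for b
    using sb[OF that] W by (auto intro!: integrable_mult_test_function[OF li] test_function_mult)
  have i3: "integrable lborel (\<lambda>x. f x * (laplacian W x * \<zeta> x))"
  proof -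
    have "integrable lborel (\<lambda>x. \<Sum>b\<in>Basis. f x * (dir_deriv b (dir_deriv b W) x * \<zeta> x))"
      by (intro Bochner_Integration.integrable_sum integrable_mult_test_function[OF li] test_function_mult
          smooth_dir_deriv W z)
    then show ?thesis by (simp add: laplacian_def sum_distrib_left sum_distrib_right)
  qed
  have parts: "(LINT x|lborel. f x * (dir_deriv b W x * dir_deriv b \<zeta> x)) =
     - (LINT x|lborel. weak_partial b f x * (W x * dir_deriv b \<zeta> x))
     - (LINT x|lborel. f x * (W x * dir_deriv b (dir_deriv b \<zeta>) x))" if b: "b \<in> Basis" for b
  proof -
    have "(LINT x|lborel. f x * dir_deriv b (\<lambda>x. W x * dir_deriv b \<zeta> x) x) =
       - (LINT x|lborel. weak_partial b f x * (W x * dir_deriv b \<zeta> x))"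
      using weak_partial(2)[OF f b] test_function_mult[OF W sb(2)[OF b]] by (simp add: weak_deriv_def)
    moreover have "dir_deriv b (\<lambda>x. W x * dir_deriv b \<zeta> x) =
      (\<lambda>x. W x * dir_deriv b (dir_deriv b \<zeta>) x + dir_deriv b W x * dir_deriv b \<zeta> x)"
      using W smooth_dir_deriv[OF sz b] by (intro dir_deriv_mult smooth_differentiable)
    ultimately show ?thesis using i1[OF b] i2[OF b] by (simp add: distrib_left)
  qed
  have "(LINT x|lborel. f x * laplacian (\<lambda>x. W x * \<zeta> x) x) =
     (LINT x|lborel. f x * (laplacian W x * \<zeta> x) +
       (\<Sum>b\<in>Basis. 2 * (f x * (dir_deriv b W x * dir_deriv b \<zeta> x)) + f x * (W x * dir_deriv b (dir_deriv b \<zeta>) x)))"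
    by (intro Bochner_Integration.integral_cong refl, simp add: laplacian_mult[OF W sz])
       (simp add: laplacian_def[of \<zeta>] sum_distrib_left sum.distrib algebra_simps)
  also have "\<dots> = (LINT x|lborel. f x * (laplacian W x * \<zeta> x)) +
       (\<Sum>b\<in>Basis. 2 * (LINT x|lborel. f x * (dir_deriv b W x * dir_deriv b \<zeta> x))
         + (LINT x|lborel. f x * (W x * dir_deriv b (dir_deriv b \<zeta>) x)))"
    using i1 i2 i3 by (simp add: Bochner_Integration.integral_sum)
  also have "\<dots> = (LINT x|lborel. f x * (laplacian W x * \<zeta> x)) -
       (\<Sum>b\<in>Basis. 2 * (LINT x|lborel. weak_partial b f x * (W x * dir_deriv b \<zeta> x))
         + (LINT x|lborel. f x * (W x * dir_deriv b (dir_deriv b \<zeta>) x)))"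
    unfolding diff_conv_add_uminus sum_negf[symmetric]
    by (intro arg_cong2[where f = "(+)"] sum.cong refl) (simp add: parts)
  finally show ?thesis .
qed

text \<open>Moving by at most one unit changes the exponential at most by the factor \<open>exp c\<close>.\<close>

lemma mollify_exp_bound:
  fixes w :: "'a::euclidean_space \<Rightarrow> real"
  assumes j: "mollifier e j" "e \<le> 1" and w: "locally_integrable UNIV w"
    and le: "\<And>y. w y \<le> C0 * exp (- c * norm y)" and C: "C0 \<ge> 0" "c \<ge> 0"
  shows "mollify j w x \<le> (C0 * exp c) * exp (- c * norm x)"
proof (rule mollify_le[OF j(1) w])
  fix y assume "norm (y - x) \<le> e"
  then have "norm x \<le> norm y + 1" using j(2) norm_triangle_ineq2[of x y] by (simp add: norm_minus_commute)
  then have "c * norm x \<le> c * (norm y + 1)" using C by (intro mult_left_mono) auto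
  then have "exp (- c * norm y) \<le> exp (c + - c * norm x)" by (simp add: algebra_simps)
  then have "C0 * exp (- c * norm y) \<le> C0 * exp (c + - c * norm x)" using C by (intro mult_left_mono) auto
  with le[of y] have "w y \<le> C0 * exp (c + - c * norm x)" by linarith
  then show "w y \<le> (C0 * exp c) * exp (- c * norm x)" unfolding exp_add by (simp only: mult.assoc)
qed

text \<open>The three kinds of terms left by \<open>laplacian_by_parts\<close> are estimated by the Cauchy-Schwarz inequality:
the defect \<open>h\<close> of \<open>W\<close> as an eigenfunction matters on the ball of radius \<open>R\<close> only, and
each coordinate direction contributes three terms with a derivative of the cutoff, which is at most \<open>m\<close>.\<close>

lemma bound_state_cutoff_error:
  fixes V w :: "'a::euclidean_space \<Rightarrow> real"
  assumes f: "in_H1 f" and V: "continuous_on UNIV V"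
    and W: "smooth W" "in_L2 G" "\<And>x. \<bar>W x\<bar> \<le> G x"
    and z: "test_function UNIV \<zeta>" "\<And>x. norm x > R \<Longrightarrow> \<zeta> x = 0" "\<And>x. \<bar>\<zeta> x\<bar> \<le> M"
    and dz: "\<And>b x. b \<in> Basis \<Longrightarrow> \<bar>dir_deriv b \<zeta> x\<bar> \<le> m"
      "\<And>b x. b \<in> Basis \<Longrightarrow> \<bar>dir_deriv b (dir_deriv b \<zeta>) x\<bar> \<le> m"
    and comm: "\<And>x. norm x \<le> R \<Longrightarrow> \<bar>- laplacian W x + (V x + lam) * W x\<bar> \<le> h"
    and nn: "m \<ge> 0"
  shows "\<bar>LINT x|lborel. f x * (- laplacian (\<lambda>x. W x * \<zeta> x) x + V x * (W x * \<zeta> x) + lam * (W x * \<zeta> x))\<bar>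
     \<le> (h * M * sqrt (measure lborel (cball (0::'a) R)) + 3 * real DIM('a) * m * L2_norm G) * H1_norm f"
proof -
  define N where "N = H1_norm f"
  have f2: "in_L2 f" using f by (simp add: in_H1_def)
  have li: "locally_integrable UNIV f" using f2 by (rule in_L2_locally_integrable)
  have M: "M \<ge> 0" using z(3)[of 0] by linarith
  have t: "test_function UNIV (\<lambda>x. W x * \<zeta> x)" by (rule test_function_mult[OF W(1) z(1)])
  have Wm: "W \<in> borel_measurable lborel"
    using smooth_continuous[OF W(1)] by (simp add: borel_measurable_continuous_onI)
  have tm: "g \<in> borel_measurable lborel" if "test_function UNIV g" for g :: "'a \<Rightarrow> real"
    using smooth_continuous[OF test_function_smooth[OF that]] by (simp add: borel_measurable_continuous_onI)
  have iL: "integrable lborel (\<lambda>x. f x * laplacian (\<lambda>x. W x * \<zeta> x) x)"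
    by (rule integrable_mult_laplacian[OF li t])
  have iV: "integrable lborel (\<lambda>x. f x * (V x * (W x * \<zeta> x)))"
    by (rule integrable_mult_potential[OF li t V])
  have i1: "integrable lborel (\<lambda>x. f x * (W x * \<zeta> x))"
    by (rule integrable_mult_test_function[OF li t])
  have Lc: "continuous_on UNIV (laplacian W)"
    unfolding laplacian_def[abs_def]
    by (intro continuous_on_sum smooth_continuous smooth_dir_deriv W(1))
  have iL0: "integrable lborel (\<lambda>x. f x * (laplacian W x * \<zeta> x))"
    using smooth_continuous[OF test_function_smooth[OF z(1)]] Lc z(2)
    by (intro integrable_mult_continuous[OF li, of "cball 0 R"])
       (auto intro!: continuous_intros simp: not_le)
  have split: "(LINT x|lborel. f x * (- laplacian (\<lambda>x. W x * \<zeta> x) x + V x * (W x * \<zeta> x) + lam * (W x * \<zeta> x)))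
     = (LINT x|lborel. f x * ((- laplacian W x + (V x + lam) * W x) * \<zeta> x))
     + (\<Sum>b\<in>Basis. 2 * (LINT x|lborel. weak_partial b f x * (W x * dir_deriv b \<zeta> x))
         + (LINT x|lborel. f x * (W x * dir_deriv b (dir_deriv b \<zeta>) x)))"
  proof -
    have "(LINT x|lborel. f x * (- laplacian (\<lambda>x. W x * \<zeta> x) x + V x * (W x * \<zeta> x) + lam * (W x * \<zeta> x)))
       = (LINT x|lborel. f x * (V x * (W x * \<zeta> x)) + lam * (f x * (W x * \<zeta> x)) - f x * laplacian (\<lambda>x. W x * \<zeta> x) x)"
      by (intro Bochner_Integration.integral_cong refl) (simp add: algebra_simps)
    also have "\<dots> = (LINT x|lborel. f x * (V x * (W x * \<zeta> x))) + lam * (LINT x|lborel. f x * (W x * \<zeta> x))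
        - (LINT x|lborel. f x * laplacian (\<lambda>x. W x * \<zeta> x) x)"
      using iL iV i1 by simp
    finally have 1: "(LINT x|lborel. f x * (- laplacian (\<lambda>x. W x * \<zeta> x) x + V x * (W x * \<zeta> x) + lam * (W x * \<zeta> x))) = \<dots>" .
    have "(LINT x|lborel. f x * ((- laplacian W x + (V x + lam) * W x) * \<zeta> x))
       = (LINT x|lborel. f x * (V x * (W x * \<zeta> x)) + lam * (f x * (W x * \<zeta> x)) - f x * (laplacian W x * \<zeta> x))"
      by (intro Bochner_Integration.integral_cong refl) (simp add: algebra_simps)
    also have "\<dots> = (LINT x|lborel. f x * (V x * (W x * \<zeta> x))) + lam * (LINT x|lborel. f x * (W x * \<zeta> x))
        - (LINT x|lborel. f x * (laplacian W x * \<zeta> x))"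
      using iL0 iV i1 by simp
    finally show ?thesis unfolding 1 laplacian_by_parts[OF f W(1) z(1)] by simp
  qed
  have e1: "\<bar>LINT x|lborel. f x * ((- laplacian W x + (V x + lam) * W x) * \<zeta> x)\<bar>
      \<le> N * (h * M * sqrt (measure lborel (cball (0::'a) R)))"
  proof -
    define G1 where "G1 = (\<lambda>x::'a. (h * M) * indicator (cball 0 R) x)"
    have G1: "in_L2 G1" unfolding G1_def by (intro in_L2_cmult in_L2_indicator compact_cball)
    have b: "\<bar>(- laplacian W x + (V x + lam) * W x) * \<zeta> x\<bar> \<le> G1 x" for x
    proof (cases "norm x \<le> R")
      case True
      have "\<bar>- laplacian W x + (V x + lam) * W x\<bar> * \<bar>\<zeta> x\<bar> \<le> h * M"
        using comm[OF True] z(3)[of x] by (intro mult_mono) auto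
      then show ?thesis using True by (simp add: G1_def abs_mult)
    qed (use z(2) in \<open>simp add: G1_def\<close>)
    have m: "(\<lambda>x. (- laplacian W x + (V x + lam) * W x) * \<zeta> x) \<in> borel_measurable lborel"
      using smooth_continuous[OF test_function_smooth[OF z(1)]] Lc V smooth_continuous[OF W(1)]
      by (auto intro!: borel_measurable_continuous_onI continuous_intros)
    have "\<bar>LINT x|lborel. f x * ((- laplacian W x + (V x + lam) * W x) * \<zeta> x)\<bar> \<le> L2_norm f * L2_norm G1"
      by (rule L2_bound(2)[OF f2 G1 m b])
    also have "\<dots> \<le> N * L2_norm G1"
      unfolding N_def by (intro mult_right_mono H1_norm_ge L2_norm_nonneg)
    also have "L2_norm G1 = \<bar>h * M\<bar> * L2_norm (indicator (cball (0::'a) R))"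
      unfolding G1_def by (rule in_L2_cmult(2)[OF in_L2_indicator(1)[OF compact_cball]])
    also have "\<dots> = \<bar>h * M\<bar> * sqrt (measure lborel (cball (0::'a) R))"
      by (simp add: in_L2_indicator(2)[OF compact_cball])
    finally have "\<bar>LINT x|lborel. f x * ((- laplacian W x + (V x + lam) * W x) * \<zeta> x)\<bar>
        \<le> N * (\<bar>h * M\<bar> * sqrt (measure lborel (cball (0::'a) R)))" .
    moreover have "\<bar>h * M\<bar> * sqrt (measure lborel (cball (0::'a) R)) = h * M * sqrt (measure lborel (cball (0::'a) R))"
    proof (cases "R < 0")
      case False
      then have "h \<ge> 0" using comm[of 0] by auto
      then show ?thesis using M by simp
    qed simp
    ultimately show ?thesis by simp
  qed
  have e2: "\<bar>2 * (LINT x|lborel. weak_partial b f x * (W x * dir_deriv b \<zeta> x))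
         + (LINT x|lborel. f x * (W x * dir_deriv b (dir_deriv b \<zeta>) x))\<bar> \<le> 3 * (N * (m * L2_norm G))"
    if b: "b \<in> Basis" for b
  proof -
    have mG: "in_L2 (\<lambda>x. m * G x)" "L2_norm (\<lambda>x. m * G x) = m * L2_norm G"
      using in_L2_cmult[OF W(2), of m] nn by auto
    have bd: "\<bar>LINT x|lborel. g x * (W x * k x)\<bar> \<le> N * (m * L2_norm G)"
      if g: "in_L2 g" "L2_norm g \<le> N" and k: "test_function UNIV k" "\<And>x. \<bar>k x\<bar> \<le> m" for g k :: "'a \<Rightarrow> real"
    proof -
      have "\<bar>W x * k x\<bar> \<le> m * G x" for x
        using mult_mono[OF W(3)[of x] k(2)[of x]] W(3)[of x] by (simp add: abs_mult mult.commute)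
      from L2_bound(2)[OF g(1) mG(1) _ this] Wm tm[OF k(1)]
      have "\<bar>LINT x|lborel. g x * (W x * k x)\<bar> \<le> L2_norm g * (m * L2_norm G)"
        by (simp add: mG(2))
      also have "\<dots> \<le> N * (m * L2_norm G)"
        using g(2) nn L2_norm_nonneg[of G] by (intro mult_right_mono) auto
      finally show ?thesis .
    qed
    have "\<bar>LINT x|lborel. weak_partial b f x * (W x * dir_deriv b \<zeta> x)\<bar> \<le> N * (m * L2_norm G)"
      unfolding N_def
      by (intro bd[unfolded N_def] weak_partial(1)[OF f b] H1_norm_ge(2)[OF b] test_function_dir_deriv z(1) b dz(1))
    moreover have "\<bar>LINT x|lborel. f x * (W x * dir_deriv b (dir_deriv b \<zeta>) x)\<bar> \<le> N * (m * L2_norm G)"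
      unfolding N_def
      by (intro bd[unfolded N_def] f2 H1_norm_ge(1) test_function_dir_deriv z(1) b dz(2))
    ultimately show ?thesis by linarith
  qed
  have "\<bar>\<Sum>b\<in>Basis. 2 * (LINT x|lborel. weak_partial b f x * (W x * dir_deriv b \<zeta> x))
         + (LINT x|lborel. f x * (W x * dir_deriv b (dir_deriv b \<zeta>) x))\<bar> \<le> (\<Sum>b\<in>(Basis::'a set). 3 * (N * (m * L2_norm G)))"
    by (rule order_trans[OF sum_abs], rule sum_mono) (rule e2)
  then have "\<bar>\<Sum>b\<in>Basis. 2 * (LINT x|lborel. weak_partial b f x * (W x * dir_deriv b \<zeta> x))
         + (LINT x|lborel. f x * (W x * dir_deriv b (dir_deriv b \<zeta>) x))\<bar> \<le> DIM('a) * (3 * (N * (m * L2_norm G)))"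
    by simp
  with e1 have "\<bar>LINT x|lborel. f x * (- laplacian (\<lambda>x. W x * \<zeta> x) x + V x * (W x * \<zeta> x) + lam * (W x * \<zeta> x))\<bar>
      \<le> N * (h * M * sqrt (measure lborel (cball (0::'a) R))) + DIM('a) * (3 * (N * (m * L2_norm G)))"
    unfolding split by linarith
  then show ?thesis by (simp add: N_def algebra_simps)
qed

lemma positive_local_mass:
  fixes w :: "'a::euclidean_space \<Rightarrow> real"
  assumes w: "locally_integrable UNIV w" "\<And>x. 0 < w x" and r: "r > 0"
  shows "(LINT x|lborel. indicator (cball x0 r) x * w x) > 0"
proof -
  have i: "integrable lborel (\<lambda>x. indicator (cball x0 r) x * w x)"
    using w(1) unfolding locally_integrable_def set_integrable_def by simp
  have n: "AE x in lborel. 0 \<le> indicator (cball x0 r) x * w x" using w(2) by (simp add: less_imp_le)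
  have "(LINT x|lborel. indicator (cball x0 r) x * w x) \<noteq> 0"
  proof
    assume "(LINT x|lborel. indicator (cball x0 r) x * w x) = 0"
    then have "AE x in lborel. indicator (cball x0 r) x * w x = 0"
      using integral_nonneg_eq_0_iff_AE[OF i n] by simp
    then have "AE x in lborel. x \<notin> cball x0 r"
    proof (rule AE_mp, intro AE_I2 impI)
      fix x assume "indicator (cball x0 r) x * w x = 0"
      then show "x \<notin> cball x0 r" using w(2)[of x] by (auto simp: indicator_def)
    qed
    then have "emeasure lborel (cball x0 r) = 0"
      by (subst (asm) AE_iff_measurable[of "cball x0 r"]) auto
    then show False using content_cball_pos[of r x0] r by (simp add: measure_def)
  qed
  moreover have "0 \<le> (LINT x|lborel. indicator (cball x0 r) x * w x)" using n by (rule integral_nonneg_AE)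
  ultimately show ?thesis by linarith
qed

text \<open>The bound state is mollified and cut off. The order of choices matters: the constants \<open>b\<close> and \<open>C1\<close>
come first, then the radius \<open>R\<close> of the cutoff makes its derivatives small, and finally the scale \<open>e\<close> of the
mollifier is adapted to the modulus of continuity of \<open>V\<close> on the ball of radius \<open>R + 1\<close>.\<close>

lemma bound_state_approximation:
  fixes V \<psi> w :: "'a::euclidean_space \<Rightarrow> real"
  assumes V: "continuous_on UNIV V" and eig: "schroedinger_eigen_eq V (- lam) w"
    and w: "\<And>x. 0 < w x" "\<And>x. w x \<le> C0 * exp (- c * norm x)" and c: "c > 0"
    and psi: "continuous_on UNIV \<psi>" "\<And>x. 0 \<le> \<psi> x" "\<psi> x0 \<noteq> 0"
  obtains b C1 where "b > 0" "C1 > 0"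
    "\<And>\<delta>. \<delta> > 0 \<Longrightarrow> \<exists>\<theta>. test_function UNIV \<theta> \<and> (\<forall>x. 0 \<le> \<theta> x \<and> \<theta> x \<le> C1 * exp (- c * norm x))
       \<and> b \<le> (LINT x|lborel. \<psi> x * \<theta> x)
       \<and> (\<forall>f. in_H1 f \<longrightarrow> \<bar>LINT x|lborel. f x * (- laplacian \<theta> x + V x * \<theta> x + lam * \<theta> x)\<bar> \<le> \<delta> * H1_norm f)"
proof -
  have li: "locally_integrable UNIV w" using eig by (simp add: schroedinger_eigen_eq_def)
  have C0: "C0 > 0" using order_less_le_trans[OF w(1) w(2), of 0] by simp
  have wC: "\<bar>w x\<bar> \<le> C0" for x
  proof -
    have "C0 * exp (- c * norm x) \<le> C0 * 1" using C0 c by (intro mult_left_mono) auto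
    then show ?thesis using w(1)[of x] w(2)[of x] by simp
  qed
  obtain M d :: real and \<zeta> :: "real \<Rightarrow> 'a \<Rightarrow> real" where M: "M > 0" "d > 0"
    and z: "\<And>R. R \<ge> 1 \<Longrightarrow> test_function UNIV (\<zeta> R)"
      "\<And>R x. 0 \<le> \<zeta> R x" "\<And>R x. \<zeta> R x \<le> M" "\<And>R x. R \<ge> 1 \<Longrightarrow> norm x > R \<Longrightarrow> \<zeta> R x = 0"
      "\<And>R x b. R \<ge> 1 \<Longrightarrow> b \<in> Basis \<Longrightarrow> \<bar>dir_deriv b (\<zeta> R) x\<bar> \<le> M / R"
      "\<And>R x b. R \<ge> 1 \<Longrightarrow> b \<in> Basis \<Longrightarrow> \<bar>dir_deriv b (dir_deriv b (\<zeta> R)) x\<bar> \<le> M / R"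
      "\<And>R x. R \<ge> 1 \<Longrightarrow> norm x \<le> d * R \<Longrightarrow> 1 / 2 \<le> \<zeta> R x"
    by (rule cutoff_exists[where 'a='a]) (rule that, assumption+)
  define C1 where "C1 = C0 * exp c * M"
  have C1: "C1 > 0" using C0 M by (simp add: C1_def)
  define G where "G = (\<lambda>x::'a. (C0 * exp c) * exp (- c * norm x))"
  have G: "in_L2 G" unfolding G_def using c by (rule in_L2_exp_norm)
  have "\<psi> x0 > 0" using psi(2)[of x0] psi(3) by linarith
  then have p2: "\<psi> x0 / 2 > 0" by simp
  have "isCont \<psi> x0" using psi(1) by (simp add: continuous_on_eq_continuous_at)
  with p2 obtain s where s: "s > 0" "\<And>x. dist x x0 < s \<Longrightarrow> dist (\<psi> x) (\<psi> x0) < \<psi> x0 / 2"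
    unfolding continuous_at_eps_delta by metis
  define r where "r = s / 4"
  have r: "r > 0" using s(1) by (simp add: r_def)
  have psi_low: "\<psi> x0 / 2 \<le> \<psi> x" if "x \<in> cball x0 (2 * r)" for x
  proof -
    have "dist (\<psi> x) (\<psi> x0) < \<psi> x0 / 2" using that s(1) by (intro s(2)) (auto simp: r_def dist_commute)
    then have "\<bar>\<psi> x - \<psi> x0\<bar> < \<psi> x0 / 2" by (simp add: dist_real_def)
    then show ?thesis by linarith
  qed
  define I where "I = (LINT x|lborel. indicator (cball x0 r) x * w x)"
  have I: "I > 0" unfolding I_def by (rule positive_local_mass[OF li w(1) r])
  define b where "b = \<psi> x0 / 4 * I"
  have b: "b > 0" using I p2 by (simp add: b_def)
  have "\<exists>\<theta>. test_function UNIV \<theta> \<and> (\<forall>x. 0 \<le> \<theta> x \<and> \<theta> x \<le> C1 * exp (- c * norm x))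
       \<and> b \<le> (LINT x|lborel. \<psi> x * \<theta> x)
       \<and> (\<forall>f. in_H1 f \<longrightarrow> \<bar>LINT x|lborel. f x * (- laplacian \<theta> x + V x * \<theta> x + lam * \<theta> x)\<bar> \<le> \<delta> * H1_norm f)"
    if \<delta>: "\<delta> > 0" for \<delta>
  proof -
    define D where "D = 3 * real DIM('a) * M * L2_norm G"
    have D: "D \<ge> 0" unfolding D_def using M L2_norm_nonneg[of G] by simp
    \<comment> \<open>The second term makes the cutoff error \<open>D / R\<close> small, the third makes the cutoff at least \<open>1/2\<close> on the ball where \<open>\<psi>\<close> is bounded below.\<close>
    define R where "R = 1 + 2 * D / \<delta> + (norm x0 + 2 * r) / d"
    have R: "R \<ge> 1" "D / R \<le> \<delta> / 2" "norm x0 + 2 * r \<le> d * R"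
    proof -
      have nn: "0 \<le> 2 * D / \<delta>" "0 \<le> (norm x0 + 2 * r) / d" using D \<delta> r M by auto
      then show "R \<ge> 1" by (simp add: R_def)
      have "2 * D / \<delta> \<le> R" using nn by (simp add: R_def)
      then show "D / R \<le> \<delta> / 2" using \<delta> \<open>R \<ge> 1\<close> by (simp add: field_simps)
      have "(norm x0 + 2 * r) / d \<le> R" using nn by (simp add: R_def)
      then show "norm x0 + 2 * r \<le> d * R" using M by (simp add: field_simps)
    qed
    define S where "S = sqrt (measure lborel (cball (0::'a) R))"
    \<comment> \<open>With this tolerance for \<open>V\<close> the mollification error \<open>h * C0 * M * S\<close> is at most \<open>\<delta> / 2\<close>.\<close>
    define h where "h = \<delta> / 2 / (C0 * M * (S + 1))"
    have S: "S \<ge> 0" by (simp add: S_def)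
    have h: "h > 0" using \<delta> C0 M S by (simp add: h_def)
    have "continuous_on (cball 0 (R + 1)) V" using V by (rule continuous_on_subset) simp
    from uniformly_continuous_on_neighborhood[OF this h]
    obtain e0 where e0: "0 < e0" "e0 \<le> 1" "\<And>x y. norm x \<le> R \<Longrightarrow> norm (y - x) < e0 \<Longrightarrow> \<bar>V y - V x\<bar> < h"
      by metis
    \<comment> \<open>The bound by \<open>r\<close> is for the lower estimate of the mass near \<open>x0\<close>.\<close>
    define e where "e = min (e0 / 2) r"
    have e: "e > 0" "e < e0" "e \<le> 1" "e \<le> r" using e0 r by (auto simp: e_def)
    obtain j :: "'a \<Rightarrow> real" where j: "mollifier e j" using mollifier_exists[OF e(1)] by metis
    have tj: "test_function UNIV j" using j by (rule mollifier_test_function)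
    define W where "W = mollify j w"
    have sW: "smooth W" unfolding W_def by (rule smooth_mollify[OF li tj])
    have W0: "0 \<le> W x" for x
      unfolding W_def by (rule mollify_ge[OF j li]) (use w(1) in \<open>auto intro: less_imp_le\<close>)
    have WG: "W x \<le> G x" for x
      unfolding W_def G_def by (rule mollify_exp_bound[OF j e(3) li w(2)]) (use C0 c in auto)
    have comm: "\<bar>- laplacian W x + (V x + lam) * W x\<bar> \<le> h * C0" if "norm x \<le> R" for x
      unfolding W_def
      by (rule schroedinger_mollify_bound[OF V eig j wC]) (use e0(3)[OF that] e in \<open>force intro: less_imp_le\<close>)
    define \<theta> where "\<theta> = (\<lambda>x. W x * \<zeta> R x)"
    have t: "test_function UNIV \<theta>" unfolding \<theta>_def by (rule test_function_mult[OF sW z(1)[OF R(1)]])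
    have t0: "0 \<le> \<theta> x" for x using W0 z(2) by (simp add: \<theta>_def)
    have t1: "\<theta> x \<le> C1 * exp (- c * norm x)" for x
    proof -
      have "W x * \<zeta> R x \<le> G x * M" using W0[of x] WG[of x] z(2,3) by (intro mult_mono) auto
      then show ?thesis by (simp add: \<theta>_def G_def C1_def mult_ac)
    qed
    have mass: "b \<le> (LINT x|lborel. \<psi> x * \<theta> x)"
    proof -
      have cW: "continuous_on UNIV W" by (rule smooth_continuous[OF sW])
      have i2: "integrable lborel (\<lambda>x. indicator (cball x0 (2 * r)) x * W x)"
        using locally_integrable_continuous[OF cW, of UNIV] unfolding locally_integrable_def set_integrable_def by simp
      have "b \<le> \<psi> x0 / 4 * (LINT x|lborel. indicator (cball x0 (2 * r)) x * W x)"
        unfolding b_def I_def W_def using p2 w(1)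
        by (intro mult_left_mono mollify_mass[OF li _ j e(4)]) (auto intro: less_imp_le)
      also have "\<dots> = (LINT x|lborel. \<psi> x0 / 4 * (indicator (cball x0 (2 * r)) x * W x))" by simp
      also have "\<dots> \<le> (LINT x|lborel. \<psi> x * \<theta> x)"
      proof (rule integral_mono)
        show "integrable lborel (\<lambda>x. \<psi> x0 / 4 * (indicator (cball x0 (2 * r)) x * W x))" using i2 by simp
        show "integrable lborel (\<lambda>x. \<psi> x * \<theta> x)"
          by (rule integrable_mult_test_function[OF locally_integrable_continuous[OF psi(1)] t])
        fix x
        show "\<psi> x0 / 4 * (indicator (cball x0 (2 * r)) x * W x) \<le> \<psi> x * \<theta> x"
        proof (cases "x \<in> cball x0 (2 * r)")
          case True
          have "norm x \<le> norm x0 + dist x0 x" using norm_triangle_ineq2[of x x0] by (simp add: dist_norm norm_minus_commute)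
          then have "norm x \<le> d * R" using True R(3) by simp
          then have "1 / 2 \<le> \<zeta> R x" by (rule z(7)[OF R(1)])
          with psi_low[OF True] p2 have "\<psi> x0 / 2 * (1 / 2) \<le> \<psi> x * \<zeta> R x" by (intro mult_mono) auto
          from mult_right_mono[OF this W0[of x]] True show ?thesis by (simp add: \<theta>_def mult_ac)
        qed (use psi(2) t0 in simp)
      qed
      finally show ?thesis .
    qed
    have est: "\<bar>LINT x|lborel. f x * (- laplacian \<theta> x + V x * \<theta> x + lam * \<theta> x)\<bar> \<le> \<delta> * H1_norm f"
      if f: "in_H1 f" for f
    proof -
      have "\<bar>LINT x|lborel. f x * (- laplacian \<theta> x + V x * \<theta> x + lam * \<theta> x)\<bar>
         \<le> (h * C0 * M * S + 3 * real DIM('a) * (M / R) * L2_norm G) * H1_norm f"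
        unfolding \<theta>_def S_def
      proof (rule bound_state_cutoff_error[OF f V sW G])
        show "\<bar>W x\<bar> \<le> G x" for x using W0[of x] WG[of x] by simp
        show "test_function UNIV (\<zeta> R)" by (rule z(1)[OF R(1)])
        show "\<zeta> R x = 0" if "R < norm x" for x using z(4)[OF R(1) that] .
        show "\<bar>\<zeta> R x\<bar> \<le> M" for x using z(2,3)[of R x] by simp
        show "\<bar>dir_deriv b (\<zeta> R) x\<bar> \<le> M / R" if "b \<in> Basis" for b x by (rule z(5)[OF R(1) that])
        show "\<bar>dir_deriv b (dir_deriv b (\<zeta> R)) x\<bar> \<le> M / R" if "b \<in> Basis" for b x by (rule z(6)[OF R(1) that])
        show "0 \<le> M / R" using M R(1) by simp
      qed (rule comm)
      also have "\<dots> \<le> \<delta> * H1_norm f"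
      proof (rule mult_right_mono)
        have "h * C0 * M * S = \<delta> / 2 * (S / (S + 1))" using C0 M S by (simp add: h_def)
        also have "\<dots> \<le> \<delta> / 2 * 1" using \<delta> S by (intro mult_left_mono) auto
        finally have "h * C0 * M * S \<le> \<delta> / 2" by simp
        moreover have "3 * real DIM('a) * (M / R) * L2_norm G = D / R" by (simp add: D_def)
        ultimately show "h * C0 * M * S + 3 * real DIM('a) * (M / R) * L2_norm G \<le> \<delta>" using R(2) by linarith
        show "0 \<le> H1_norm f" using H1_norm_ge(1)[of f] L2_norm_nonneg[of f] by linarith
      qed
      finally show ?thesis .
    qed
    show ?thesis by (intro exI[of _ \<theta>] conjI allI impI t t0 t1 mass est)
  qed
  then show ?thesis by (rule that[OF b C1])
qed

section \<open>From weak to integrated inequalities\<close>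

text \<open>Testing with \<open>y \<mapsto> j (x - y)\<close> shows that the derivative of the mollified \<open>f\<close> at \<open>x\<close> is at least the mollified \<open>g\<close>.
Integrating over \<open>{s..t}\<close> gives the claim; the terms with \<open>h\<close> account for the mollification of \<open>g\<close>
and of the two values of \<open>f\<close>.\<close>

lemma weak_increment_interior:
  fixes f g :: "real \<Rightarrow> real"
  assumes f: "continuous_on {0..T} f" and g: "continuous_on {0..T} g"
    and weak: "\<And>\<rho>. test_function {0<..<T} \<rho> \<Longrightarrow> (\<And>t. 0 \<le> \<rho> t) \<Longrightarrow>
       (LINT t|lborel. g t * \<rho> t) \<le> - (LINT t|lborel. f t * dir_deriv 1 \<rho> t)"
    and st: "0 < s" "s < t" "t < T" and h: "h > 0"
  shows "integral {s..t} g - h * (t - s) \<le> f t - f s + 2 * h"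
proof -
  define f0 where "f0 = (\<lambda>x. indicator {0..T} x * f x)"
  define g0 where "g0 = (\<lambda>x. indicator {0..T} x * g x)"
  have li: "locally_integrable UNIV (\<lambda>x. indicator {0..T} x * k x)" if "continuous_on {0..T} k" for k :: "real \<Rightarrow> real"
  proof -
    have i: "integrable lborel (\<lambda>x. indicator {0..T} x *\<^sub>R k x)"
      by (rule borel_integrable_compact[OF compact_Icc that])
    then show ?thesis
      unfolding locally_integrable_def set_integrable_def
      using integrable_mult_indicator[OF _ i] by (simp add: borel_compact)
  qed
  have lf: "locally_integrable UNIV f0" and lg: "locally_integrable UNIV g0"
    unfolding f0_def g0_def using f g by (auto intro: li)
  have "uniformly_continuous_on {0..T} f" "uniformly_continuous_on {0..T} g"
    using f g by (auto intro: compact_uniformly_continuous)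
  then obtain d1 d2 where d: "d1 > 0" "d2 > 0"
    "\<And>x y. x \<in> {0..T} \<Longrightarrow> y \<in> {0..T} \<Longrightarrow> dist y x < d1 \<Longrightarrow> dist (f y) (f x) < h"
    "\<And>x y. x \<in> {0..T} \<Longrightarrow> y \<in> {0..T} \<Longrightarrow> dist y x < d2 \<Longrightarrow> dist (g y) (g x) < h"
    using h unfolding uniformly_continuous_on_def by metis
  define m where "m = min (min d1 d2) (min s (T - t))"
  have m: "m > 0" "m \<le> d1" "m \<le> d2" "m \<le> s" "m \<le> T - t" using d(1,2) st by (simp_all add: m_def)
  define e where "e = m / 2"
  have em: "e > 0" "e < m" using m(1) by (simp_all add: e_def)
  have e: "e > 0" "e < d1" "e < d2" "e < s" "e < T - t"
    using em m(2-5) by (blast intro: less_le_trans)+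
  obtain j :: "real \<Rightarrow> real" where j: "mollifier e j" using mollifier_exists[OF e(1)] by metis
  have tj: "test_function UNIV j" using j by (rule mollifier_test_function)
  have sj: "smooth j" using tj by (rule test_function_smooth)
  have inT: "y \<in> {0..T}" "y \<in> {0<..<T}" if "x \<in> {s..t}" "\<bar>y - x\<bar> \<le> e" for x y
    using that e st by (auto simp: abs_le_iff)
  have near: "\<bar>f0 y - f x\<bar> \<le> h" "\<bar>g0 y - g x\<bar> \<le> h" if "x \<in> {s..t}" "norm (y - x) \<le> e" for x y
  proof -
    have "y \<in> {0..T}" "x \<in> {0..T}" using inT[of x y] that st by auto
    then show "\<bar>f0 y - f x\<bar> \<le> h" "\<bar>g0 y - g x\<bar> \<le> h"
      using d(3)[of x y] d(4)[of x y] that e by (auto simp: f0_def g0_def dist_real_def)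
  qed
  have d0: "mollify (dir_deriv 1 j) f0 x \<ge> g x - h" if x: "x \<in> {s..t}" for x
  proof -
    define \<rho> where "\<rho> = (\<lambda>y. j (x - y))"
    have cb: "y \<in> {0..T}" if "y \<in> cball x e" for y
      using that by (intro inT(1)[OF x]) (simp add: dist_real_def abs_minus_commute)
    have \<rho>0: "\<rho> y = 0" if "y \<notin> cball x e" for y
      using j that by (auto simp: \<rho>_def mollifier_def dist_real_def)
    have t\<rho>: "test_function {0<..<T} \<rho>"
    proof (rule test_functionI)
      show "smooth \<rho>" unfolding \<rho>_def by (rule smooth_reflect[OF sj])
      show "compact (cball x e)" "cball x e \<subseteq> {0<..<T}"
        using inT(2)[OF x] by (auto simp: dist_real_def abs_minus_commute)
      show "y \<in> cball x e" if "\<rho> y \<noteq> 0" for y using that \<rho>0 by blast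
    qed
    have d\<rho>0: "dir_deriv 1 \<rho> y = 0" if "y \<notin> cball x e" for y
      by (rule dir_deriv_zero_outside[of "cball x e"]) (use \<rho>0 that in auto)
    have "g x - h \<le> mollify j g0 x"
      by (rule mollify_ge[OF j lg]) (use near(2)[OF x] in \<open>force simp: abs_le_iff\<close>)
    also have "\<dots> = (LINT y|lborel. g y * \<rho> y)"
      unfolding mollify_def \<rho>_def[symmetric]
    proof (intro Bochner_Integration.integral_cong refl)
      fix y show "g0 y * j (x - y) = g y * \<rho> y"
      proof (cases "y \<in> cball x e")
        case True
        from cb[OF True] show ?thesis by (simp add: g0_def \<rho>_def)
      next
        case False
        from \<rho>0[OF False] show ?thesis by (simp add: \<rho>_def)
      qed
    qed
    also have "\<dots> \<le> - (LINT y|lborel. f y * dir_deriv 1 \<rho> y)"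
      by (rule weak[OF t\<rho>]) (use j in \<open>simp add: \<rho>_def mollifier_def\<close>)
    also have "(LINT y|lborel. f y * dir_deriv 1 \<rho> y) = (LINT y|lborel. f0 y * dir_deriv 1 \<rho> y)"
    proof (intro Bochner_Integration.integral_cong refl)
      fix y show "f y * dir_deriv 1 \<rho> y = f0 y * dir_deriv 1 \<rho> y"
      proof (cases "y \<in> cball x e")
        case True
        from cb[OF True] show ?thesis by (simp add: f0_def)
      next
        case False
        from d\<rho>0[OF False] show ?thesis by simp
      qed
    qed
    also have "\<dots> = - mollify (dir_deriv 1 j) f0 x"
      by (simp add: \<rho>_def dir_deriv_reflect[OF sj] mollify_def)
    finally show ?thesis by simp
  qed
  have "(mollify j f0 has_vector_derivative mollify (dir_deriv 1 j) f0 x) (at x within {s..t})" for x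
    by (rule has_vector_derivative_at_within)
       (use mollify_has_derivative[OF lf tj, of x] in \<open>simp add: has_vector_derivative_def\<close>)
  then have "(mollify (dir_deriv 1 j) f0 has_integral mollify j f0 t - mollify j f0 s) {s..t}"
    using st by (intro fundamental_theorem_of_calculus) auto
  moreover have "((\<lambda>x. g x - h) has_integral integral {s..t} g - h * (t - s)) {s..t}"
  proof (intro has_integral_diff)
    have "g integrable_on {s..t}"
      using st by (intro integrable_continuous_interval continuous_on_subset[OF g]) auto
    then show "(g has_integral integral {s..t} g) {s..t}" by (rule integrable_integral)
    show "((\<lambda>x. h) has_integral h * (t - s)) {s..t}"
      using has_integral_const_real[of h s t] st by (simp add: mult.commute)
  qed
  ultimately have "integral {s..t} g - h * (t - s) \<le> mollify j f0 t - mollify j f0 s"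
    using d0 by (auto intro: has_integral_le)
  moreover have "mollify j f0 t \<le> f t + h"
    by (rule mollify_le[OF j lf]) (use near(1)[of t] st in \<open>force simp: abs_le_iff\<close>)
  moreover have "f s - h \<le> mollify j f0 s"
    by (rule mollify_ge[OF j lf]) (use near(1)[of s] st in \<open>force simp: abs_le_iff\<close>)
  ultimately show ?thesis by linarith
qed

text \<open>By the interior estimate, \<open>f\<close> minus a primitive of \<open>g\<close> is nondecreasing on the open interval,
and therefore on the closed one by continuity.\<close>

lemma weak_increment:
  fixes f g :: "real \<Rightarrow> real"
  assumes f: "continuous_on {0..T} f" and g: "continuous_on {0..T} g"
    and weak: "\<And>\<rho>. test_function {0<..<T} \<rho> \<Longrightarrow> (\<And>t. 0 \<le> \<rho> t) \<Longrightarrow>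
       (LINT t|lborel. g t * \<rho> t) \<le> - (LINT t|lborel. f t * dir_deriv 1 \<rho> t)"
    and st: "0 \<le> s" "s \<le> t" "t \<le> T"
  shows "integral {s..t} g \<le> f t - f s"
proof (cases "s = t")
  case False
  then have slt: "s < t" using st by simp
  define \<Phi> where "\<Phi> = (\<lambda>x. f x - integral {0..x} g)"
  have gi: "g integrable_on {a..b}" if "0 \<le> a" "b \<le> T" for a b
    using that by (intro integrable_continuous_interval continuous_on_subset[OF g]) auto
  have split: "integral {0..b} g = integral {0..a} g + integral {a..b} g" if "0 \<le> a" "a \<le> b" "b \<le> T" for a b
    using that gi[of 0 b] by (intro Henstock_Kurzweil_Integration.integral_combine[symmetric]) auto
  have c: "continuous_on {0..T} \<Phi>"
    unfolding \<Phi>_def by (intro continuous_intros f indefinite_integral_continuous_1 gi) auto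
  have mono: "\<Phi> a \<le> \<Phi> b" if ab: "0 < a" "a < b" "b < T" for a b
  proof -
    have "integral {a..b} g \<le> f b - f a"
    proof (rule field_le_epsilon)
      fix h :: real assume "h > 0"
      then have h: "h / (b - a + 2) > 0" using ab by simp
      have "h / (b - a + 2) * (b - a) + 2 * (h / (b - a + 2)) = h / (b - a + 2) * (b - a + 2)"
        by (simp only: distrib_right mult.commute)
      also have "\<dots> = h" using ab by simp
      finally have "h / (b - a + 2) * (b - a) + 2 * (h / (b - a + 2)) = h" .
      moreover have "integral {a..b} g - h / (b - a + 2) * (b - a) \<le> f b - f a + 2 * (h / (b - a + 2))"
        by (rule weak_increment_interior[OF f g _ ab h]) (rule weak)
      ultimately show "integral {a..b} g \<le> f b - f a + h" by linarith
    qed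
    then show ?thesis using split[of a b] ab by (simp add: \<Phi>_def)
  qed
  define a where "a n = s + (t - s) / (real n + 3)" for n
  define b where "b n = t - (t - s) / (real n + 3)" for n
  have lim0: "(\<lambda>n. (t - s) / (real n + 3)) \<longlonglongrightarrow> 0" by real_asymp
  have la: "a \<longlonglongrightarrow> s" unfolding a_def using tendsto_add[OF tendsto_const lim0, of s] by simp
  have lb: "b \<longlonglongrightarrow> t" unfolding b_def using tendsto_diff[OF tendsto_const lim0, of t] by simp
  have ab: "s < a n" "a n < b n" "b n < t" for n
  proof -
    define q where "q = (t - s) / (real n + 3)"
    have q: "0 < q" using slt by (simp add: q_def)
    have "t - s = q * (real n + 3)" by (simp add: q_def)
    moreover have "q * (real n + 3) \<ge> q * 3" using q by (intro mult_left_mono) auto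
    ultimately have "3 * q \<le> t - s" by simp
    with q show "s < a n" "a n < b n" "b n < t" unfolding a_def b_def q_def[symmetric] by auto
  qed
  have "a n \<in> {0..T}" "b n \<in> {0..T}" for n using ab[of n] st by auto
  then have "(\<lambda>n. \<Phi> (a n)) \<longlonglongrightarrow> \<Phi> s" "(\<lambda>n. \<Phi> (b n)) \<longlonglongrightarrow> \<Phi> t"
    using st by (auto intro!: continuous_on_tendsto_compose[OF c la] continuous_on_tendsto_compose[OF c lb])
  moreover have "\<Phi> (a n) \<le> \<Phi> (b n)" for n
    using ab[of n] st by (intro mono) auto
  ultimately have "\<Phi> s \<le> \<Phi> t" by (intro LIMSEQ_le) auto
  then show ?thesis using split[of s t] st by (simp add: \<Phi>_def)
qed simp

section \<open>Blow-up for differential inequalities\<close>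

text \<open>Multiplying \<open>H'' \<ge> B H\<^sup>p\<close> by \<open>H'\<close> and integrating gives \<open>H' \<ge> const * H powr (q + 1)\<close> with \<open>q = (p - 1) / 2\<close>.
Hence \<open>H powr (- q)\<close>, which is positive, decreases at least linearly, and the interval ends
before this function reaches zero. The first unit of time serves to have \<open>H \<ge> b\<close> at the start.\<close>

lemma convex_blowup:
  fixes H G k :: "real \<Rightarrow> real"
  assumes p: "p > 1" and B: "B > 0" and b: "b > 0" and T: "T \<ge> 1"
    and c: "continuous_on {0..T} H" "continuous_on {0..T} G" and H0: "H 0 = 0" and G: "\<And>t. t \<in> {0..T} \<Longrightarrow> b \<le> G t"
    and dH: "\<And>t. t \<in> {0<..<T} \<Longrightarrow> (H has_real_derivative G t) (at t)"
    and dG: "\<And>t. t \<in> {0<..<T} \<Longrightarrow> (G has_real_derivative k t) (at t)"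
    and k: "\<And>t. t \<in> {0<..<T} \<Longrightarrow> B * H t powr p \<le> k t"
  shows "T \<le> 1 + b powr (- ((p - 1) / 2)) / ((p - 1) / 2 * sqrt (2 * B / (p + 1)))"
proof -
  define q where "q = (p - 1) / 2"
  define c2 where "c2 = 2 * B / (p + 1)"
  have q: "q > 0" and c2: "c2 > 0" using p B by (auto simp: q_def c2_def)
  have Hlow: "b * t \<le> H t" if t: "t \<in> {0..T}" for t
  proof -
    define D where "D = (\<lambda>t. H t - b * t)"
    have "D 0 \<le> D t"
    proof (rule DERIV_nonneg_imp_increasing_open[of 0 t D])
      show "\<exists>y. (D has_real_derivative y) (at x) \<and> 0 \<le> y" if "0 < x" "x < t" for x
        unfolding D_def using that t G[of x]
        by (intro exI[of _ "G x - b"] conjI) (auto intro!: derivative_eq_intros dH)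
      show "continuous_on {0..t} D"
        unfolding D_def using t by (intro continuous_intros continuous_on_subset[OF c(1)]) auto
    qed (use t in auto)
    then show ?thesis using H0 by (simp add: D_def)
  qed
  have Hpos: "H t > 0" if "t \<in> {0<..T}" for t
  proof -
    have "0 < b * t" using b that by simp
    with Hlow[of t] that show ?thesis by auto
  qed
  have Hnn: "H t \<ge> 0" if "t \<in> {0..T}" for t
  proof -
    have "0 \<le> b * t" using b that by simp
    with Hlow[OF that] show ?thesis by linarith
  qed
  have energy: "c2 * H t powr (p + 1) \<le> (G t)\<^sup>2" if t: "t \<in> {0..T}" for t
  proof -
    \<comment> \<open>Twice the energy of the conservative equation \<open>H'' = B H\<^sup>p\<close>; it is nondecreasing.\<close>
    define E where "E = (\<lambda>t. (G t)\<^sup>2 - c2 * H t powr (p + 1))"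
    have "E 0 \<le> E t"
    proof (rule DERIV_nonneg_imp_increasing_open[of 0 t E])
      show "continuous_on {0..t} E"
        unfolding E_def using t p Hnn
        by (intro continuous_intros continuous_on_powr' continuous_on_subset[OF c(1)] continuous_on_subset[OF c(2)]) auto
      fix x assume x: "0 < x" "x < t"
      then have xT: "x \<in> {0<..<T}" using t by auto
      have Hx: "H x > 0" using x t by (intro Hpos) auto
      have "((\<lambda>t. H t powr (p + 1)) has_real_derivative (p + 1) * H x powr p * G x) (at x)"
        using DERIV_chain2[OF has_real_derivative_powr[OF Hx, of "p + 1"] dH[OF xT]] by simp
      from DERIV_diff[OF DERIV_power[OF dG[OF xT], of 2] DERIV_cmult[OF this, of c2]]
      have "(E has_real_derivative 2 * (k x * G x) - c2 * ((p + 1) * H x powr p * G x)) (at x)"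
        unfolding E_def by simp
      moreover have "2 * (k x * G x) - c2 * ((p + 1) * H x powr p * G x) = 2 * (G x * (k x - B * H x powr p))"
        using p by (simp add: c2_def field_simps)
      moreover have "0 \<le> 2 * (G x * (k x - B * H x powr p))"
        using k[OF xT] G[of x] xT b by (intro mult_nonneg_nonneg) auto
      ultimately show "\<exists>y. (E has_real_derivative y) (at x) \<and> 0 \<le> y" by auto
    qed (use t in auto)
    moreover have "0 \<le> E 0" using H0 by (simp add: E_def)
    ultimately show ?thesis by (simp add: E_def)
  qed
  have Glow: "sqrt c2 * H t powr (q + 1) \<le> G t" if t: "t \<in> {0<..T}" for t
  proof (rule power2_le_imp_le)
    have "(H t powr (q + 1))\<^sup>2 = H t powr (p + 1)"
    proof -
      have "2 * q + 2 = p + 1" by (simp add: q_def field_simps)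
      moreover have "(H t powr (q + 1))\<^sup>2 = H t powr (2 * q + 2)" using Hpos[OF t] by (simp add: powr_power)
      ultimately show ?thesis by (simp only:)
    qed
    then show "(sqrt c2 * H t powr (q + 1))\<^sup>2 \<le> (G t)\<^sup>2"
      using energy[of t] t c2 by (simp add: power_mult_distrib)
    show "0 \<le> G t" using G[of t] b t by auto
  qed
  define K where "K = (\<lambda>t. H t powr (- q) + q * sqrt c2 * t)"
  have "K T \<le> K 1"
  proof (rule DERIV_nonpos_imp_decreasing_open[of 1 T K])
    have sub: "{1..T} \<subseteq> {0..T}" by auto
    show "continuous_on {1..T} K"
      unfolding K_def
    proof (intro continuous_on_add continuous_on_mult continuous_on_const continuous_on_id)
      have "\<forall>x\<in>{1..T}. 0 < H x" using Hpos by auto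
      then show "continuous_on {1..T} (\<lambda>t. H t powr - q)"
        by (intro continuous_on_powr continuous_on_const continuous_on_subset[OF c(1) sub]) force
    qed
    fix x assume x: "1 < x" "x < T"
    then have xT: "x \<in> {0<..<T}" by auto
    have Hx: "H x > 0" using x by (intro Hpos) auto
    have "((\<lambda>t. H t powr (- q)) has_real_derivative - q * H x powr (- q - 1) * G x) (at x)"
      using DERIV_chain2[OF has_real_derivative_powr[OF Hx, of "- q"] dH[OF xT]] by simp
    from DERIV_add[OF this DERIV_cmult_Id[of "q * sqrt c2"]]
    have "(K has_real_derivative - q * H x powr (- q - 1) * G x + q * sqrt c2) (at x)"
      unfolding K_def .
    moreover have "sqrt c2 \<le> H x powr (- q - 1) * G x"
    proof -
      have "H x powr (- q - 1) * (sqrt c2 * H x powr (q + 1)) = sqrt c2 * (H x powr (- q - 1) * H x powr (q + 1))"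
        by simp
      also have "\<dots> = sqrt c2" using Hx by (simp add: powr_add[symmetric])
      finally have eq: "H x powr (- q - 1) * (sqrt c2 * H x powr (q + 1)) = sqrt c2" .
      have "H x powr (- q - 1) * (sqrt c2 * H x powr (q + 1)) \<le> H x powr (- q - 1) * G x"
        using x by (intro mult_left_mono Glow) auto
      then show ?thesis unfolding eq .
    qed
    from mult_left_mono[OF this, of q] have "- q * H x powr (- q - 1) * G x + q * sqrt c2 \<le> 0"
      using q by (simp add: mult.assoc)
    ultimately show "\<exists>y. (K has_real_derivative y) (at x) \<and> y \<le> 0" by blast
  qed (rule T)
  then have "H T powr (- q) + q * sqrt c2 * T \<le> H 1 powr (- q) + q * sqrt c2" by (simp add: K_def)
  moreover have "0 \<le> H T powr (- q)" by simp
  ultimately have "q * sqrt c2 * T - q * sqrt c2 \<le> H 1 powr (- q)" by linarith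
  then have "q * sqrt c2 * (T - 1) \<le> H 1 powr (- q)" by (simp add: right_diff_distrib)
  also have "\<dots> \<le> b powr (- q)"
    using Hlow[of 1] T b q by (intro powr_mono2') auto
  finally have "T - 1 \<le> b powr (- q) / (q * sqrt c2)"
    using q c2 by (simp add: field_simps)
  then show ?thesis by (simp add: q_def c2_def)
qed

text \<open>At the first time at which \<open>F1\<close> falls to \<open>b / 4\<close>, the function \<open>F\<close> has been nonnegative so far,
and \<open>F1\<close> can have lost at most \<open>\<kappa> T \<le> b / 2\<close>; so there is no such time. Once the signs are known,
\<open>F\<close> dominates the solution \<open>H\<close> of \<open>H'' = B max(0,F)\<^sup>p\<close>, \<open>H(0) = 0\<close>, \<open>H'(0) = b / 2\<close>, to which the
differential inequality without perturbation applies.\<close>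

lemma perturbed_blowup:
  fixes F F1 :: "real \<Rightarrow> real"
  assumes p: "p > 1" and B: "B > 0" and b: "b > 0" and T: "T \<ge> 1" and lam: "lam \<ge> 0"
    and kap: "\<kappa> \<ge> 0" "\<kappa> * T \<le> b / 2"
    and cF: "continuous_on {0..T} F" and cF1: "continuous_on {0..T} F1"
    and init: "0 \<le> F 0" "b \<le> F1 0"
    and incF: "\<And>s t. 0 \<le> s \<Longrightarrow> s \<le> t \<Longrightarrow> t \<le> T \<Longrightarrow> integral {s..t} F1 \<le> F t - F s"
    and incF1: "\<And>s t. 0 \<le> s \<Longrightarrow> s \<le> t \<Longrightarrow> t \<le> T \<Longrightarrow>
       integral {s..t} (\<lambda>x. lam * F x + B * (max 0 (F x)) powr p - \<kappa>) \<le> F1 t - F1 s"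
  shows "T \<le> 1 + (b / 2) powr (- ((p - 1) / 2)) / ((p - 1) / 2 * sqrt (2 * B / (p + 1)))"
proof -
  define P where "P = (\<lambda>x. max 0 (F x) powr p)"
  have cP: "continuous_on {0..T} P"
    unfolding P_def using p by (intro continuous_on_powr' continuous_intros cF) auto
  have intg: "k integrable_on {0..t}" if "continuous_on {0..T} k" "t \<le> T" for k :: "real \<Rightarrow> real" and t
    using that by (intro integrable_continuous_interval continuous_on_subset[OF that(1)]) auto
  have up: "b - \<kappa> * t + B * integral {0..t} P \<le> F1 t"
    if t: "0 \<le> t" "t \<le> T" and pos: "\<And>x. x \<in> {0..t} \<Longrightarrow> 0 \<le> F x" for t
  proof -
    have "(\<lambda>x. B * P x) integrable_on {0..t}" "(\<lambda>x. \<kappa>) integrable_on {0..t}"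
      by (intro intg[OF _ t(2)] continuous_intros cP)+
    then have "B * integral {0..t} P - \<kappa> * t = integral {0..t} (\<lambda>x. B * P x - \<kappa>)"
      using t by (subst Henstock_Kurzweil_Integration.integral_diff) (auto simp: mult.commute)
    also have "\<dots> \<le> integral {0..t} (\<lambda>x. lam * F x + B * (max 0 (F x)) powr p - \<kappa>)"
    proof (rule integral_le)
      show "(\<lambda>x. B * P x - \<kappa>) integrable_on {0..t}"
        by (rule intg[OF _ t(2)]) (intro continuous_intros cP)
      have "continuous_on {0..T} (\<lambda>x. lam * F x + B * P x - \<kappa>)" by (intro continuous_intros cP cF)
      from intg[OF this t(2)] show "(\<lambda>x. lam * F x + B * (max 0 (F x)) powr p - \<kappa>) integrable_on {0..t}"
        by (simp add: P_def)
      show "B * P x - \<kappa> \<le> lam * F x + B * (max 0 (F x)) powr p - \<kappa>" if "x \<in> {0..t}" for x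
        using lam pos[OF that] by (simp add: P_def)
    qed
    also have "\<dots> \<le> F1 t - F1 0" using t by (intro incF1) auto
    finally show ?thesis using init by linarith
  qed
  have Pnn: "0 \<le> integral {0..t} P" if "t \<le> T" for t
    using intg[OF cP that] by (intro Henstock_Kurzweil_Integration.integral_nonneg) (auto simp: P_def)
  have kt: "\<kappa> * t \<le> b / 2" if "t \<le> T" for t
    using mult_left_mono[OF that kap(1)] kap(2) by linarith
  have Fpos: "0 \<le> F t" if t: "0 \<le> t" "t \<le> T" and F1: "\<And>x. x \<in> {0..t} \<Longrightarrow> 0 \<le> F1 x" for t
  proof -
    have "0 \<le> integral {0..t} F1"
      using F1 intg[OF cF1 t(2)] by (intro Henstock_Kurzweil_Integration.integral_nonneg) auto
    also have "\<dots> \<le> F t - F 0" using t by (intro incF) auto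
    finally show ?thesis using init by linarith
  qed
  have F1pos: "0 \<le> F1 t" if t: "t \<in> {0..T}" for t
  proof (rule ccontr)
    assume "\<not> 0 \<le> F1 t"
    define Z where "Z = {x \<in> {0..T}. F1 x \<le> b / 4}"
    have "compact Z"
      unfolding Z_def
      using continuous_closed_preimage[OF cF1 closed_atLeastAtMost closed_atMost, of "b / 4"]
      by (auto simp: compact_eq_bounded_closed vimage_def Int_def intro: bounded_subset[of "{0..T}"])
    moreover have "t \<in> Z" using t b \<open>\<not> 0 \<le> F1 t\<close> by (simp add: Z_def)
    ultimately obtain \<tau> where tau: "\<tau> \<in> Z" "\<And>x. x \<in> Z \<Longrightarrow> \<tau> \<le> x"
      using compact_attains_inf[of Z] by blast
    have tT: "0 \<le> \<tau>" "\<tau> \<le> T" "F1 \<tau> \<le> b / 4" using tau(1) by (auto simp: Z_def)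
    \<comment> \<open>The first time \<open>\<tau>\<close> with \<open>F1 \<tau> \<le> b / 4\<close> has equality, so that \<open>F1\<close> is nonnegative on the closed interval \<open>{0..\<tau>}\<close>.\<close>
    have "\<exists>x. 0 \<le> x \<and> x \<le> \<tau> \<and> F1 x = b / 4"
      using init b tT by (intro IVT2' continuous_on_subset[OF cF1]) auto
    then obtain x where "0 \<le> x" "x \<le> \<tau>" "F1 x = b / 4" by blast
    moreover from this have "\<tau> \<le> x" using tT by (intro tau(2)) (auto simp: Z_def)
    ultimately have eq: "F1 \<tau> = b / 4" by simp
    have low: "b / 4 \<le> F1 x" if "x \<in> {0..\<tau>}" for x
    proof (rule ccontr)
      assume "\<not> b / 4 \<le> F1 x"
      then have "\<tau> \<le> x" using that tT by (intro tau(2)) (auto simp: Z_def)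
      then have "x = \<tau>" using that by auto
      then show False using eq \<open>\<not> b / 4 \<le> F1 x\<close> by simp
    qed
    have "b - \<kappa> * \<tau> + B * integral {0..\<tau>} P \<le> F1 \<tau>"
    proof (rule up[OF tT(1,2)])
      show "0 \<le> F x" if "x \<in> {0..\<tau>}" for x
        using that tT b by (intro Fpos order_trans[OF _ low]) auto
    qed
    moreover have "0 \<le> B * integral {0..\<tau>} P" using B Pnn[OF tT(2)] by simp
    ultimately show False using kt[OF tT(2)] eq b by linarith
  qed
  have Fnn: "0 \<le> F t" if "t \<in> {0..T}" for t using that F1pos by (intro Fpos) auto
  define G where "G = (\<lambda>t. b / 2 + B * integral {0..t} P)"
  define H where "H = (\<lambda>t. integral {0..t} G)"
  have cG: "continuous_on {0..T} G"
    unfolding G_def by (intro continuous_intros indefinite_integral_continuous_1 intg cP) auto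
  have cH: "continuous_on {0..T} H"
    unfolding H_def by (intro indefinite_integral_continuous_1 intg cG) auto
  have GF: "G t \<le> F1 t" if t: "t \<in> {0..T}" for t
    using up[of t] Fnn t kt[of t] unfolding G_def by auto
  have HF: "H t \<le> F t" if t: "t \<in> {0..T}" for t
  proof -
    have "H t \<le> integral {0..t} F1"
      unfolding H_def using t GF by (intro integral_le intg cG cF1) auto
    also have "\<dots> \<le> F t - F 0" using t by (intro incF) auto
    finally show ?thesis using init by linarith
  qed
  have Gb: "b / 2 \<le> G t" if "t \<in> {0..T}" for t
    using B Pnn[of t] that by (simp add: G_def)
  have Hnn: "0 \<le> H t" if "t \<in> {0..T}" for t
    unfolding H_def
  proof (intro Henstock_Kurzweil_Integration.integral_nonneg intg cG)
    show "0 \<le> G x" if "x \<in> {0..t}" for x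
      using Gb[of x] b that \<open>t \<in> {0..T}\<close> by auto
  qed (use that in auto)
  have dI: "((\<lambda>t. integral {0..t} k) has_real_derivative k t) (at t)"
    if "continuous_on {0..T} k" "t \<in> {0<..<T}" for k t
    using integral_has_real_derivative[OF that(1), of t] that(2) at_within_Icc_at[of 0 t T] by auto
  show ?thesis
  proof (rule convex_blowup[OF p B _ T cH cG])
    show "b / 2 > 0" using b by simp
    show "H 0 = 0" by (simp add: H_def)
    show "b / 2 \<le> G t" if "t \<in> {0..T}" for t using Gb that .
    show "(H has_real_derivative G t) (at t)" if "t \<in> {0<..<T}" for t
      unfolding H_def by (rule dI[OF cG that])
    show "(G has_real_derivative B * P t) (at t)" if "t \<in> {0<..<T}" for t
      unfolding G_def by (auto intro!: derivative_eq_intros dI[OF cP that])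
    show "B * H t powr p \<le> B * P t" if "t \<in> {0<..<T}" for t
      unfolding P_def using that B p Hnn[of t] HF[of t] by (intro mult_left_mono powr_mono2) auto
  qed
qed

section \<open>Moments of a solution\<close>

text \<open>The graph of the convex function \<open>\<bar>x\<bar> powr p\<close> lies above its tangent at \<open>m\<close>.\<close>

lemma power_tangent_le:
  fixes m p x :: real
  assumes p: "p > 1" and m: "m \<ge> 0"
  shows "p * (m powr (p - 1) * x) - (p - 1) * m powr p \<le> \<bar>x\<bar> powr p"
proof -
  have q: "p / (p - 1) > 1" "1 / p + 1 / (p / (p - 1)) = 1" using p by (auto simp: field_simps)
  have "\<bar>x\<bar> * m powr (p - 1) \<le> \<bar>x\<bar> powr p / p + (m powr (p - 1)) powr (p / (p - 1)) / (p / (p - 1))"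
    by (rule Youngs_inequality[OF p q]) auto
  also have "(m powr (p - 1)) powr (p / (p - 1)) = m powr p" using p by (simp add: powr_powr)
  finally have "p * (\<bar>x\<bar> * m powr (p - 1)) \<le> p * (\<bar>x\<bar> powr p / p + m powr p / (p / (p - 1)))"
    using p by (intro mult_left_mono) auto
  also have "\<dots> = \<bar>x\<bar> powr p + (p - 1) * m powr p" using p by (simp add: field_simps)
  finally have "p * (\<bar>x\<bar> * m powr (p - 1)) \<le> \<bar>x\<bar> powr p + (p - 1) * m powr p" .
  moreover have "m powr (p - 1) * x \<le> \<bar>x\<bar> * m powr (p - 1)"
    using mult_right_mono[OF abs_ge_self[of x], of "m powr (p - 1)"] by (simp add: mult.commute)
  then have "p * (m powr (p - 1) * x) \<le> p * (\<bar>x\<bar> * m powr (p - 1))" using p by (intro mult_left_mono) auto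
  ultimately show ?thesis by linarith
qed

lemma continuous_curve_functional:
  assumes u: "continuous_curve inX normX T u"
    and L2: "\<And>f. inX f \<Longrightarrow> in_L2 f" and le: "\<And>f. inX f \<Longrightarrow> L2_norm f \<le> normX f"
    and diff: "\<And>f g. inX f \<Longrightarrow> inX g \<Longrightarrow> inX (\<lambda>x. f x - g x)"
    and th: "in_L2 \<theta>"
  shows "continuous_on {0..<T} (\<lambda>t. LINT x|lborel. u t x * \<theta> x)"
  unfolding continuous_on_def
proof
  fix s assume s: "s \<in> {0..<T}"
  have X: "inX (u t)" if "t \<in> {0..<T}" for t using u that by (auto simp: continuous_curve_def)
  have "((\<lambda>t. (LINT x|lborel. u t x * \<theta> x) - (LINT x|lborel. u s x * \<theta> x)) \<longlongrightarrow> 0) (at s within {0..<T})"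
  proof (rule Lim_null_comparison)
    have "((\<lambda>t. normX (\<lambda>x. u t x - u s x)) \<longlongrightarrow> 0) (at s within {0..<T})"
      using u s by (auto simp: continuous_curve_def)
    from tendsto_mult_left[OF this, of "L2_norm \<theta>"]
    show "((\<lambda>t. L2_norm \<theta> * normX (\<lambda>x. u t x - u s x)) \<longlongrightarrow> 0) (at s within {0..<T})" by simp
    show "\<forall>\<^sub>F t in at s within {0..<T}. norm ((LINT x|lborel. u t x * \<theta> x) - (LINT x|lborel. u s x * \<theta> x))
        \<le> L2_norm \<theta> * normX (\<lambda>x. u t x - u s x)"
      unfolding eventually_at_filter
    proof (intro always_eventually allI impI)
      fix t assume t: "t \<in> {0..<T}"
      have d: "inX (\<lambda>x. u t x - u s x)" by (rule diff[OF X[OF t] X[OF s]])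
      have "(LINT x|lborel. u t x * \<theta> x) - (LINT x|lborel. u s x * \<theta> x) = (LINT x|lborel. (u t x - u s x) * \<theta> x)"
        using L2_Cauchy_Schwarz(1)[OF L2[OF X[OF t]] th] L2_Cauchy_Schwarz(1)[OF L2[OF X[OF s]] th]
        by (simp add: left_diff_distrib)
      moreover have "\<bar>LINT x|lborel. (u t x - u s x) * \<theta> x\<bar> \<le> L2_norm (\<lambda>x. u t x - u s x) * L2_norm \<theta>"
        by (rule L2_Cauchy_Schwarz(2)[OF L2[OF d] th])
      moreover have "L2_norm (\<lambda>x. u t x - u s x) * L2_norm \<theta> \<le> normX (\<lambda>x. u t x - u s x) * L2_norm \<theta>"
        by (intro mult_right_mono le d L2_norm_nonneg)
      ultimately show "norm ((LINT x|lborel. u t x * \<theta> x) - (LINT x|lborel. u s x * \<theta> x))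
        \<le> L2_norm \<theta> * normX (\<lambda>x. u t x - u s x)"
        by (simp add: mult.commute)
    qed
  qed
  then show "((\<lambda>t. LINT x|lborel. u t x * \<theta> x) \<longlongrightarrow> (LINT x|lborel. u s x * \<theta> x)) (at s within {0..<T})"
    by (simp add: LIM_zero_iff)
qed

text \<open>Along a compact piece of the curve a functional is bounded by its norm times a constant which
depends on the curve alone. The constant comes from a finite cover of the time interval. Only values of
\<open>H1_norm\<close> at points \<open>u s\<close> and at differences \<open>u t - u s\<close> occur: the triangle inequality for \<open>H1_norm\<close>, which
would require the uniqueness of weak derivatives, is replaced by the linearity of the functional.\<close>

lemma continuous_curve_bounded_functional:
  fixes u :: "real \<Rightarrow> 'a::euclidean_space \<Rightarrow> real"
  assumes u: "continuous_curve in_H1 H1_norm T u" and T1: "T1 < T"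
  shows "\<exists>M\<ge>0. \<forall>\<delta> L t. 0 \<le> \<delta> \<longrightarrow> (\<forall>f. in_H1 f \<longrightarrow> \<bar>L f\<bar> \<le> \<delta> * H1_norm f) \<longrightarrow>
      (\<forall>f g. in_H1 f \<longrightarrow> in_H1 g \<longrightarrow> L (\<lambda>x. f x - g x) = L f - L g) \<longrightarrow>
      t \<in> {0..T1} \<longrightarrow> \<bar>L (u t)\<bar> \<le> \<delta> * M"
proof -
  have sub: "{0..T1} \<subseteq> {0..<T}" using T1 by auto
  have X: "in_H1 (u t)" if "t \<in> {0..T1}" for t using u that sub by (auto simp: continuous_curve_def)
  have "\<exists>d>0. \<forall>t\<in>{0..T1}. t \<noteq> s \<and> dist t s < d \<longrightarrow> H1_norm (\<lambda>x. u t x - u s x) < 1"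
    if s: "s \<in> {0..T1}" for s
  proof -
    have "((\<lambda>t. H1_norm (\<lambda>x. u t x - u s x)) \<longlongrightarrow> 0) (at s within {0..<T})"
      using u s sub by (auto simp: continuous_curve_def)
    then have "\<forall>\<^sub>F t in at s within {0..<T}. H1_norm (\<lambda>x. u t x - u s x) < 1"
      by (rule order_tendstoD) simp
    then show ?thesis using sub unfolding eventually_at by blast
  qed
  then obtain d where d: "\<And>s. s \<in> {0..T1} \<Longrightarrow> 0 < d s"
    "\<And>s t. s \<in> {0..T1} \<Longrightarrow> t \<in> {0..T1} \<Longrightarrow> t \<noteq> s \<Longrightarrow> dist t s < d s \<Longrightarrow> H1_norm (\<lambda>x. u t x - u s x) < 1"
    by metis
  have "{0..T1} \<subseteq> (\<Union>s\<in>{0..T1}. ball s (d s))" using d(1) by force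
  then obtain S where S: "S \<subseteq> {0..T1}" "finite S" "{0..T1} \<subseteq> (\<Union>s\<in>S. ball s (d s))"
    by (rule compactE_image[OF compact_Icc, rotated]) auto
  define M where "M = 1 + (\<Sum>s\<in>S. H1_norm (u s))"
  have M: "M \<ge> 0" unfolding M_def by (intro add_nonneg_nonneg sum_nonneg H1_norm_nonneg) auto
  show ?thesis
  proof (intro exI[of _ M] conjI M allI impI)
    fix \<delta> :: real and L :: "('a \<Rightarrow> real) \<Rightarrow> real" and t
    assume \<delta>: "\<delta> \<ge> 0" and L': "\<forall>f. in_H1 f \<longrightarrow> \<bar>L f\<bar> \<le> \<delta> * H1_norm f"
      and lin': "\<forall>f g. in_H1 f \<longrightarrow> in_H1 g \<longrightarrow> L (\<lambda>x. f x - g x) = L f - L g" and t: "t \<in> {0..T1}"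
    note L = L'[rule_format] and lin = lin'[rule_format]
    obtain s where s: "s \<in> S" "dist t s < d s" using S(3) t by (auto simp: dist_commute)
    have s1: "s \<in> {0..T1}" using s S by auto
    have sM: "H1_norm (u s) + 1 \<le> M"
      unfolding M_def using member_le_sum[of s S "\<lambda>s. H1_norm (u s)"] s S H1_norm_nonneg by auto
    have "\<bar>L (u t)\<bar> \<le> \<delta> * (H1_norm (u s) + 1)"
    proof (cases "t = s")
      case True
      have "\<bar>L (u s)\<bar> \<le> \<delta> * H1_norm (u s)" by (rule L[OF X[OF s1]])
      then show ?thesis using True \<delta> by (simp add: distrib_left)
    next
      case False
      have "\<bar>L (\<lambda>x. u t x - u s x)\<bar> \<le> \<delta> * H1_norm (\<lambda>x. u t x - u s x)"
        by (rule L[OF in_H1_diff[OF X[OF t] X[OF s1]]])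
      also have "\<dots> \<le> \<delta> * 1" using d(2)[OF s1 t False s(2)] \<delta> by (intro mult_left_mono) auto
      finally have "\<bar>L (u t) - L (u s)\<bar> \<le> \<delta>" using lin[OF X[OF t] X[OF s1]] by simp
      with L[OF X[OF s1]] show ?thesis by (simp add: distrib_left)
    qed
    also have "\<dots> \<le> \<delta> * M" by (rule mult_left_mono[OF sM \<delta>])
    finally show "\<bar>L (u t)\<bar> \<le> \<delta> * M" .
  qed
qed

text \<open>Fubini's theorem for a function that is locally integrable on the open slab. The support of the
temporal factor \<open>r\<close> keeps away from the times \<open>0\<close> and \<open>T\<close>.\<close>

lemma space_time_moment:
  fixes U :: "real \<Rightarrow> 'a::euclidean_space \<Rightarrow> real"
  assumes U: "locally_integrable (space_time T) (\<lambda>(x, t). U t x)"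
    and a: "continuous_on UNIV a" "compact K" "\<forall>x. x \<notin> K \<longrightarrow> a x = 0"
    and r: "r \<in> borel_measurable borel" "compact J" "J \<subseteq> {0<..<T}" "\<forall>t. t \<notin> J \<longrightarrow> r t = 0" "\<And>t. \<bar>r t\<bar> \<le> C"
  shows "integrable lborel (\<lambda>z. U (snd z) (fst z) * (a (fst z) * r (snd z)))"
    and "integrable lborel (\<lambda>t. (LINT x|lborel. U t x * a x) * r t)"
    and "(LINT z|lborel. U (snd z) (fst z) * (a (fst z) * r (snd z))) = (LINT t|lborel. (LINT x|lborel. U t x * a x) * r t)"
proof -
  obtain D where D: "D > 0" "\<And>x. \<bar>a x\<bar> \<le> D" using continuous_support_bounded[OF a(1,2)] a(3) by metis
  have am: "a \<in> borel_measurable borel" using a(1) by (rule borel_measurable_continuous_onI)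
  have "integrable lborel (\<lambda>z. (case z of (x, t) \<Rightarrow> U t x) * (a (fst z) * r (snd z)))"
  proof (rule locally_integrable_mult[OF U])
    show "compact (K \<times> J)" "K \<times> J \<subseteq> space_time T"
      using a r by (auto simp: space_time_def intro!: compact_Times)
    show "(\<lambda>z. a (fst z) * r (snd z)) \<in> borel_measurable borel"
    proof (intro borel_measurable_times)
      show "(\<lambda>z::'a \<times> real. a (fst z)) \<in> borel_measurable borel"
        by (rule measurable_compose[OF _ am]) (intro borel_measurable_continuous_onI continuous_intros)
      show "(\<lambda>z::'a \<times> real. r (snd z)) \<in> borel_measurable borel"
        by (rule measurable_compose[OF _ r(1)]) (intro borel_measurable_continuous_onI continuous_intros)
    qed
    show "\<bar>a (fst z) * r (snd z)\<bar> \<le> D * C" for z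
      unfolding abs_mult using D r(5) by (intro mult_mono) auto
    show "a (fst z) * r (snd z) = 0" if "z \<notin> K \<times> J" for z
      using that a(3) r(4) by (auto simp: mem_Times_iff)
  qed
  then show i: "integrable lborel (\<lambda>z. U (snd z) (fst z) * (a (fst z) * r (snd z)))"
    by (simp add: case_prod_beta)
  have e: "case_prod (\<lambda>x t. (U t x * a x) * r t) = (\<lambda>z. U (snd z) (fst z) * (a (fst z) * r (snd z)))"
    by (auto simp: fun_eq_iff)
  have i': "integrable (lborel \<Otimes>\<^sub>M lborel) (case_prod (\<lambda>x t. (U t x * a x) * r t))"
    unfolding e lborel_prod by (rule i)
  show "integrable lborel (\<lambda>t. (LINT x|lborel. U t x * a x) * r t)"
    using lborel_pair.integrable_snd[OF i'] by simp
  show "(LINT z|lborel. U (snd z) (fst z) * (a (fst z) * r (snd z))) = (LINT t|lborel. (LINT x|lborel. U t x * a x) * r t)"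
    using lborel_pair.integral_snd[OF i'] unfolding e lborel_prod by simp
qed

lemma moment_weak_velocity:
  fixes u v :: "real \<Rightarrow> 'a::euclidean_space \<Rightarrow> real"
  assumes w: "weak_deriv (space_time T) (0, 1) (\<lambda>(x, t). u t x) (\<lambda>(x, t). v t x)"
    and th: "test_function UNIV \<theta>" and rho: "test_function {0<..<T} \<rho>"
  shows "(LINT t|lborel. (LINT x|lborel. u t x * \<theta> x) * dir_deriv 1 \<rho> t)
    = - (LINT t|lborel. (LINT x|lborel. v t x * \<theta> x) * \<rho> t)"
proof -
  have lu: "locally_integrable (space_time T) (\<lambda>(x, t). u t x)"
    and lv: "locally_integrable (space_time T) (\<lambda>(x, t). v t x)"
    using w by (auto simp: weak_deriv_def)
  obtain K where K: "compact K" "\<And>x. x \<notin> K \<Longrightarrow> \<theta> x = 0"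
    using test_function_support[OF th] by metis
  have ct: "continuous_on UNIV \<theta>" by (rule smooth_continuous[OF test_function_smooth[OF th]])
  have m: "(LINT z|lborel. U (snd z) (fst z) * (\<theta> (fst z) * r (snd z))) = (LINT t|lborel. (LINT x|lborel. U t x * \<theta> x) * r t)"
    if U: "locally_integrable (space_time T) (\<lambda>(x, t). U t x)" and r: "test_function {0<..<T} r" for U r
  proof -
    obtain J where J: "compact J" "J \<subseteq> {0<..<T}" "\<And>t. t \<notin> J \<Longrightarrow> r t = 0"
      using test_function_support[OF r] by metis
    have cr: "continuous_on UNIV r" by (rule smooth_continuous[OF test_function_smooth[OF r]])
    obtain C where "\<And>t. \<bar>r t\<bar> \<le> C" using continuous_support_bounded[OF cr J(1,3)] by metis
    then show ?thesis
      using space_time_moment(3)[OF U ct K(1) _ borel_measurable_continuous_onI[OF cr] J(1,2)] K(2) J(3) by blast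
  qed
  have dr: "test_function {0<..<T} (dir_deriv 1 \<rho>)" using rho by (intro test_function_dir_deriv) auto
  have "(LINT z|lborel. (case z of (x, t) \<Rightarrow> u t x) * dir_deriv (0, 1) (tensor \<theta> \<rho>) z)
    = - (LINT z|lborel. (case z of (x, t) \<Rightarrow> v t x) * tensor \<theta> \<rho> z)"
    using w test_function_tensor[OF th rho] by (simp add: weak_deriv_def)
  then show ?thesis
    using m[OF lu dr] m[OF lv rho]
    by (simp add: dir_deriv_tensor(2)[OF test_function_smooth[OF th] test_function_smooth[OF rho]] case_prod_beta)
qed

text \<open>Jensen's inequality is used in linearised form: \<open>\<bar>u\<bar> powr p\<close> is replaced by its tangent at a number \<open>m t\<close>
that depends on time only. Thus \<open>\<bar>u\<bar> powr p\<close> is integrated over space-time, where it is locally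
integrable, and at a fixed time only \<open>u\<close> itself has to be integrable against \<open>\<theta>\<close>. The function \<open>m\<close>
will be read off from the moment of \<open>u t\<close> itself.\<close>

lemma moment_weak_wave:
  fixes u :: "real \<Rightarrow> 'a::euclidean_space \<Rightarrow> real" and V \<theta> :: "'a \<Rightarrow> real" and \<rho> m :: "real \<Rightarrow> real"
  assumes V: "continuous_on UNIV V" and A: "A > 0" and p: "p > 1" and wave: "wave_eq V A p T u"
    and th: "test_function UNIV \<theta>" "\<And>x. 0 \<le> \<theta> x" and rho: "test_function {0<..<T} \<rho>" "\<And>t. 0 \<le> \<rho> t"
    and m: "m \<in> borel_measurable borel" "\<And>t. 0 \<le> m t" "\<And>t. m t \<le> C"
  shows "integrable lborel (\<lambda>t. (LINT x|lborel. u t x * (- laplacian \<theta> x + V x * \<theta> x)) * \<rho> t)"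
    and "integrable lborel (\<lambda>t. (LINT x|lborel. u t x * \<theta> x) * (m t powr (p - 1) * \<rho> t))"
    and "integrable lborel (\<lambda>t. (LINT x|lborel. \<theta> x) * (m t powr p * \<rho> t))"
    and "A * p * (LINT t|lborel. (LINT x|lborel. u t x * \<theta> x) * (m t powr (p - 1) * \<rho> t))
        - A * (p - 1) * (LINT t|lborel. (LINT x|lborel. \<theta> x) * (m t powr p * \<rho> t))
      \<le> (LINT t|lborel. (LINT x|lborel. u t x * \<theta> x) * dir_deriv 1 (dir_deriv 1 \<rho>) t)
        + (LINT t|lborel. (LINT x|lborel. u t x * (- laplacian \<theta> x + V x * \<theta> x)) * \<rho> t)"
proof -
  have lu: "locally_integrable (space_time T) (\<lambda>(x, t). u t x)"
    and lp: "locally_integrable (space_time T) (\<lambda>(x, t). \<bar>u t x\<bar> powr p)"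
    using wave by (auto simp: wave_eq_def)
  have l1: "locally_integrable (space_time T) (\<lambda>(x::'a, t::real). 1)"
    by (rule locally_integrable_continuous) (simp add: case_prod_beta)
  have st: "smooth \<theta>" and sr: "smooth \<rho>" using th rho by (auto simp: test_function_smooth)
  obtain K where K: "compact K" "\<And>x. x \<notin> K \<Longrightarrow> \<theta> x = 0"
    using test_function_support[OF th(1)] by metis
  obtain J where J: "compact J" "J \<subseteq> {0<..<T}" "\<And>t. t \<notin> J \<Longrightarrow> \<rho> t = 0"
    using test_function_support[OF rho(1)] by metis
  have dd: "test_function {0<..<T} (dir_deriv 1 (dir_deriv 1 \<rho>))"
    using rho(1) by (intro test_function_dir_deriv) auto
  have J2: "dir_deriv 1 (dir_deriv 1 \<rho>) t = 0" if "t \<notin> J" for t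
    using that J dir_deriv_zero_outside[OF compact_imp_closed[OF J(1)], of "dir_deriv 1 \<rho>"]
      dir_deriv_zero_outside[OF compact_imp_closed[OF J(1)], of \<rho>] by blast
  have K2: "- laplacian \<theta> x + V x * \<theta> x = 0" if "x \<notin> K" for x
  proof -
    have "dir_deriv b (dir_deriv b \<theta>) x = 0" for b
      using that K dir_deriv_zero_outside[OF compact_imp_closed[OF K(1)], of "dir_deriv b \<theta>"]
        dir_deriv_zero_outside[OF compact_imp_closed[OF K(1)], of \<theta>] by blast
    then show ?thesis using K that by (simp add: laplacian_def)
  qed
  have ct: "continuous_on UNIV \<theta>" by (rule smooth_continuous[OF st])
  have cr: "continuous_on UNIV \<rho>" by (rule smooth_continuous[OF sr])
  have cdd: "continuous_on UNIV (dir_deriv 1 (dir_deriv 1 \<rho>))"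
    by (rule smooth_continuous[OF test_function_smooth[OF dd]])
  have cL: "continuous_on UNIV (\<lambda>x. - laplacian \<theta> x + V x * \<theta> x)"
    unfolding laplacian_def[abs_def]
    by (intro continuous_intros smooth_continuous smooth_dir_deriv st V)
  obtain C1 where C1: "\<And>t. \<bar>\<rho> t\<bar> \<le> C1" using continuous_support_bounded[OF cr J(1,3)] by metis
  obtain C2 where C2: "\<And>t. \<bar>dir_deriv 1 (dir_deriv 1 \<rho>) t\<bar> \<le> C2"
    using continuous_support_bounded[OF cdd J(1) J2] by metis
  have K': "\<forall>x. x \<notin> K \<longrightarrow> \<theta> x = 0" "\<forall>x. x \<notin> K \<longrightarrow> - laplacian \<theta> x + V x * \<theta> x = 0"
    using K(2) K2 by auto
  have J': "\<forall>t. t \<notin> J \<longrightarrow> \<rho> t = 0" "\<forall>t. t \<notin> J \<longrightarrow> dir_deriv 1 (dir_deriv 1 \<rho>) t = 0"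
    "\<forall>t. t \<notin> J \<longrightarrow> m t powr q * \<rho> t = 0" for q
    using J(3) J2 by auto
  note rm = borel_measurable_continuous_onI[OF cr]
  note M1 = space_time_moment[OF lu ct K(1) K'(1) borel_measurable_continuous_onI[OF cdd] J(1,2) J'(2) C2]
  note M2 = space_time_moment[OF lu cL K(1) K'(2) rm J(1,2) J'(1) C1]
  have mb: "\<bar>m t powr q * \<rho> t\<bar> \<le> C powr q * C1" if "q > 0" for q t
  proof -
    have "m t powr q \<le> C powr q" using m(2,3)[of t] that by (intro powr_mono2) auto
    then show ?thesis using C1[of t] unfolding abs_mult by (intro mult_mono) auto
  qed
  have mm: "(\<lambda>t. m t powr q * \<rho> t) \<in> borel_measurable borel" for q
    using m(1) rm by measurable
  have p1: "p - 1 > 0" "p > 0" using p by auto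
  note M3 = space_time_moment[OF lu ct K(1) K'(1) mm J(1,2) J'(3) mb[OF p1(1)]]
  note M4 = space_time_moment[OF l1 ct K(1) K'(1) mm J(1,2) J'(3) mb[OF p1(2)]]
  note M5 = space_time_moment(1)[OF lp ct K(1) K'(1) rm J(1,2) J'(1) C1]
  show "integrable lborel (\<lambda>t. (LINT x|lborel. u t x * (- laplacian \<theta> x + V x * \<theta> x)) * \<rho> t)" by (rule M2(2))
  show "integrable lborel (\<lambda>t. (LINT x|lborel. u t x * \<theta> x) * (m t powr (p - 1) * \<rho> t))" by (rule M3(2))
  show "integrable lborel (\<lambda>t. (LINT x|lborel. \<theta> x) * (m t powr p * \<rho> t))" using M4(2) by simp
  have "A * p * (LINT z|lborel. u (snd z) (fst z) * (\<theta> (fst z) * (m (snd z) powr (p - 1) * \<rho> (snd z))))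
        - A * (p - 1) * (LINT z|lborel. 1 * (\<theta> (fst z) * (m (snd z) powr p * \<rho> (snd z))))
      = (LINT z|lborel. A * p * (u (snd z) (fst z) * (\<theta> (fst z) * (m (snd z) powr (p - 1) * \<rho> (snd z))))
        - A * (p - 1) * (1 * (\<theta> (fst z) * (m (snd z) powr p * \<rho> (snd z)))))"
    using M3(1) M4(1) by simp
  also have "\<dots> \<le> (LINT z|lborel. A * (\<bar>u (snd z) (fst z)\<bar> powr p * (\<theta> (fst z) * \<rho> (snd z))))"
  proof (rule integral_mono)
    show "integrable lborel (\<lambda>z. A * p * (u (snd z) (fst z) * (\<theta> (fst z) * (m (snd z) powr (p - 1) * \<rho> (snd z))))
        - A * (p - 1) * (1 * (\<theta> (fst z) * (m (snd z) powr p * \<rho> (snd z)))))"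
      using M3(1) M4(1) by simp
    show "integrable lborel (\<lambda>z. A * (\<bar>u (snd z) (fst z)\<bar> powr p * (\<theta> (fst z) * \<rho> (snd z))))"
      using M5 by simp
    fix z :: "'a \<times> real"
    have nn: "0 \<le> A * (\<theta> (fst z) * \<rho> (snd z))" using A th rho by simp
    from mult_left_mono[OF power_tangent_le[OF p m(2), of "snd z" "u (snd z) (fst z)"] nn]
    show "A * p * (u (snd z) (fst z) * (\<theta> (fst z) * (m (snd z) powr (p - 1) * \<rho> (snd z))))
        - A * (p - 1) * (1 * (\<theta> (fst z) * (m (snd z) powr p * \<rho> (snd z))))
      \<le> A * (\<bar>u (snd z) (fst z)\<bar> powr p * (\<theta> (fst z) * \<rho> (snd z)))"
      by (simp add: algebra_simps)
  qed
  also have "\<dots> = (LINT z|lborel. (case z of (x, t) \<Rightarrow> A * \<bar>u t x\<bar> powr p * tensor \<theta> \<rho> (x, t)))"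
    by (intro Bochner_Integration.integral_cong refl) (simp add: case_prod_beta)
  also have "\<dots> = (LINT z|lborel. (case z of (x, t) \<Rightarrow> u t x * wave_op V (tensor \<theta> \<rho>) (x, t)))"
    using wave test_function_tensor[OF th(1) rho(1)] by (simp add: wave_eq_def)
  also have "\<dots> = (LINT z|lborel. u (snd z) (fst z) * (\<theta> (fst z) * dir_deriv 1 (dir_deriv 1 \<rho>) (snd z))
       + u (snd z) (fst z) * ((- laplacian \<theta> (fst z) + V (fst z) * \<theta> (fst z)) * \<rho> (snd z)))"
    by (intro Bochner_Integration.integral_cong refl)
       (simp add: case_prod_beta wave_op_tensor[OF st sr] distrib_left del: minus_add_distrib)
  also have "\<dots> = (LINT z|lborel. u (snd z) (fst z) * (\<theta> (fst z) * dir_deriv 1 (dir_deriv 1 \<rho>) (snd z)))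
       + (LINT z|lborel. u (snd z) (fst z) * ((- laplacian \<theta> (fst z) + V (fst z) * \<theta> (fst z)) * \<rho> (snd z)))"
    by (rule Bochner_Integration.integral_add[OF M1(1) M2(1)])
  finally show "A * p * (LINT t|lborel. (LINT x|lborel. u t x * \<theta> x) * (m t powr (p - 1) * \<rho> t))
        - A * (p - 1) * (LINT t|lborel. (LINT x|lborel. \<theta> x) * (m t powr p * \<rho> t))
      \<le> (LINT t|lborel. (LINT x|lborel. u t x * \<theta> x) * dir_deriv 1 (dir_deriv 1 \<rho>) t)
        + (LINT t|lborel. (LINT x|lborel. u t x * (- laplacian \<theta> x + V x * \<theta> x)) * \<rho> t)"
    unfolding M1(3) M2(3) M3(3) M4(3) by simp
qed

text \<open>At \<open>m = max 0 F / W\<close> the tangent gives the constant of Jensen's inequality for the mass \<open>W\<close>; a smaller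
mass \<open>W'\<close> only helps. For negative \<open>F\<close> both sides vanish.\<close>

lemma moment_nonlinearity:
  fixes A W F :: real
  assumes A: "A > 0" and p: "p > 1" and W: "W > 0" "W' \<le> W"
  defines "m \<equiv> max 0 F / W"
  shows "A * W powr (1 - p) * max 0 F powr p \<le> A * p * (F * m powr (p - 1)) - A * (p - 1) * (W' * m powr p)"
proof -
  have m: "m \<ge> 0" "max 0 F = W * m" using W by (auto simp: m_def)
  have FW: "F * m powr (p - 1) = W * m powr p"
  proof (cases "F \<ge> 0")
    case True
    then have "F = W * m" using m by simp
    moreover have "m * m powr (p - 1) = m powr p"
      using m(1) p by (cases "m = 0") (auto simp: powr_mult_base)
    ultimately show ?thesis by (simp add: mult.assoc)
  qed (use W in \<open>simp add: m_def\<close>)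
  have lhs: "A * W powr (1 - p) * max 0 F powr p = A * (W * m powr p)"
  proof -
    have "W powr (1 - p) * W powr p = W" using W by (simp add: powr_add[symmetric])
    then show ?thesis using m W by (simp add: powr_mult mult.assoc[symmetric])
  qed
  have "A * (p - 1) * (W' * m powr p) \<le> A * (p - 1) * (W * m powr p)"
    using A p W by (intro mult_left_mono mult_right_mono) auto
  moreover have "A * (W * m powr p) = A * p * (W * m powr p) - A * (p - 1) * (W * m powr p)"
    by (simp add: algebra_simps)
  ultimately show ?thesis unfolding FW lhs by linarith
qed

text \<open>The weak form of \<open>F'' \<ge> \<lambda> F + B max(0,F)\<^sup>p - \<kappa>\<close>, in which \<open>F'\<close> is the moment of the velocity \<open>v\<close> and
one derivative is left on \<open>\<rho>\<close>.\<close>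

lemma moment_weak_inequality:
  fixes u v :: "real \<Rightarrow> 'a::euclidean_space \<Rightarrow> real" and V \<theta> :: "'a \<Rightarrow> real"
  assumes V: "continuous_on UNIV V" and A: "A > 0" and p: "p > 1" and wave: "wave_eq V A p T u"
    and vel: "weak_deriv (space_time T) (0, 1) (\<lambda>(x, t). u t x) (\<lambda>(x, t). v t x)"
    and th: "test_function UNIV \<theta>" "\<And>x. 0 \<le> \<theta> x" and W: "W > 0" "(LINT x|lborel. \<theta> x) \<le> W"
    and T1: "0 \<le> T1" "T1 < T" and u: "\<And>t. t \<in> {0..T1} \<Longrightarrow> locally_integrable UNIV (u t)"
    and F: "F = (\<lambda>t. LINT x|lborel. u t x * \<theta> x)" "continuous_on {0..T1} F"
    and err: "\<And>t. t \<in> {0..T1} \<Longrightarrow> \<bar>LINT x|lborel. u t x * (- laplacian \<theta> x + V x * \<theta> x + lam * \<theta> x)\<bar> \<le> \<kappa>"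
    and rho: "test_function {0<..<T1} \<rho>" "\<And>t. 0 \<le> \<rho> t"
  shows "(LINT t|lborel. (lam * F t + A * W powr (1 - p) * max 0 (F t) powr p - \<kappa>) * \<rho> t)
     \<le> - (LINT t|lborel. (LINT x|lborel. v t x * \<theta> x) * dir_deriv 1 \<rho> t)"
proof -
  \<comment> \<open>The indicator makes the slope Borel measurable and bounded on the whole line; \<open>\<rho>\<close> vanishes where the indicator does.\<close>
  define m where "m = (\<lambda>t. indicator {0..T1} t *\<^sub>R (max 0 (F t) / W))"
  define E where "E = (\<lambda>t. LINT x|lborel. u t x * (- laplacian \<theta> x + V x * \<theta> x))"
  define g where "g = (\<lambda>t. lam * F t + A * W powr (1 - p) * max 0 (F t) powr p - \<kappa>)"
  have rT: "test_function {0<..<T} \<rho>" using rho(1) T1 by (auto intro: test_function_mono)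
  have cm: "continuous_on {0..T1} (\<lambda>t. max 0 (F t) / W)" using W by (intro continuous_intros F(2)) auto
  have mm: "m \<in> borel_measurable borel"
    unfolding m_def by (rule borel_measurable_continuous_on_indicator[OF _ cm]) simp
  have m0: "0 \<le> m t" for t using W by (simp add: m_def indicator_def)
  have "bounded ((\<lambda>t. max 0 (F t) / W) ` {0..T1})"
    by (intro compact_imp_bounded compact_continuous_image cm compact_Icc)
  then obtain C where C: "C > 0" "\<And>t. t \<in> {0..T1} \<Longrightarrow> \<bar>max 0 (F t) / W\<bar> \<le> C" by (auto simp: bounded_pos)
  have mC: "m t \<le> C" for t
  proof (cases "t \<in> {0..T1}")
    case True
    have "max 0 (F t) / W \<le> C" by (rule order_trans[OF abs_ge_self C(2)[OF True]])
    then show ?thesis using True by (simp add: m_def)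
  qed (use C(1) in \<open>simp add: m_def\<close>)
  note ww = moment_weak_wave[OF V A p wave th rT rho(2) mm m0 mC]
  have "g t * \<rho> t \<le> A * p * (F t * (m t powr (p - 1) * \<rho> t)) - A * (p - 1) * ((LINT x|lborel. \<theta> x) * (m t powr p * \<rho> t)) - E t * \<rho> t" for t
  proof (cases "t \<in> {0..T1}")
    case True
    have "\<bar>E t + lam * F t\<bar> \<le> \<kappa>"
      using err[OF True] integrable_schroedinger(3)[OF u[OF True] V th(1), of lam] by (simp add: E_def F(1))
    then have "lam * F t - \<kappa> \<le> - E t" "m t = max 0 (F t) / W"
      using True by (auto simp: m_def abs_le_iff)
    with moment_nonlinearity[OF A p W, of "F t"]
    have "g t \<le> A * p * (F t * m t powr (p - 1)) - A * (p - 1) * ((LINT x|lborel. \<theta> x) * m t powr p) - E t"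
      by (simp add: g_def)
    from mult_right_mono[OF this rho(2)[of t]] show ?thesis by (simp add: algebra_simps)
  next
    case False
    obtain J where "J \<subseteq> {0<..<T1}" "\<And>t. t \<notin> J \<Longrightarrow> \<rho> t = 0" using test_function_support[OF rho(1)] by metis
    then have "\<rho> t = 0" using False by force
    then show ?thesis by simp
  qed
  moreover have "integrable lborel (\<lambda>t. g t * \<rho> t)"
  proof -
    have "continuous_on {0..T1} g"
      unfolding g_def using p by (intro continuous_intros continuous_on_powr' F(2)) auto
    then have "continuous_on {0..T1} (\<lambda>t. g t * \<rho> t)"
      by (intro continuous_intros continuous_on_subset[OF smooth_continuous[OF test_function_smooth[OF rho(1)]]]) auto
    from borel_integrable_compact[OF compact_Icc this]
    have "integrable lborel (\<lambda>t. indicator {0..T1} t *\<^sub>R (g t * \<rho> t))" .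
    moreover obtain J where "J \<subseteq> {0<..<T1}" "\<And>t. t \<notin> J \<Longrightarrow> \<rho> t = 0" using test_function_support[OF rho(1)] by metis
    then have "(\<lambda>t. indicator {0..T1} t *\<^sub>R (g t * \<rho> t)) = (\<lambda>t. g t * \<rho> t)"
      by (force simp: indicator_def)
    ultimately show ?thesis by (simp only:)
  qed
  moreover have i: "integrable lborel (\<lambda>t. A * p * (F t * (m t powr (p - 1) * \<rho> t)) - A * (p - 1) * ((LINT x|lborel. \<theta> x) * (m t powr p * \<rho> t)) - E t * \<rho> t)"
    using ww(1-3) unfolding E_def F(1) by simp
  ultimately have "(LINT t|lborel. g t * \<rho> t) \<le>
     (LINT t|lborel. A * p * (F t * (m t powr (p - 1) * \<rho> t)) - A * (p - 1) * ((LINT x|lborel. \<theta> x) * (m t powr p * \<rho> t)) - E t * \<rho> t)"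
    by (intro integral_mono) auto
  also have "\<dots> = A * p * (LINT t|lborel. F t * (m t powr (p - 1) * \<rho> t))
     - A * (p - 1) * (LINT t|lborel. (LINT x|lborel. \<theta> x) * (m t powr p * \<rho> t)) - (LINT t|lborel. E t * \<rho> t)"
    using ww(1-3) unfolding E_def F(1) by simp
  also have "\<dots> \<le> (LINT t|lborel. F t * dir_deriv 1 (dir_deriv 1 \<rho>) t)"
    using ww(4) unfolding E_def F(1) by linarith
  also have "\<dots> = - (LINT t|lborel. (LINT x|lborel. v t x * \<theta> x) * dir_deriv 1 \<rho> t)"
    unfolding F(1) by (rule moment_weak_velocity[OF vel th(1) test_function_dir_deriv[OF rT]]) simp
  finally show ?thesis by (simp add: g_def)
qed

lemma integral_cong_continuous_AE:
  assumes "in_L2 f" "continuous_on UNIV g" "AE x in lborel. f x = g x" "test_function UNIV \<theta>"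
  shows "(LINT x|lborel. f x * \<theta> x) = (LINT x|lborel. g x * \<theta> x)"
proof (rule integral_cong_AE)
  have "\<theta> \<in> borel_measurable borel" "g \<in> borel_measurable borel" "f \<in> borel_measurable borel"
    using assms smooth_continuous[OF test_function_smooth[OF assms(4)]]
    by (auto intro: borel_measurable_continuous_onI simp: in_L2_iff)
  then show "(\<lambda>x. f x * \<theta> x) \<in> borel_measurable lborel" "(\<lambda>x. g x * \<theta> x) \<in> borel_measurable lborel" by auto
qed (use assms(3) in auto)

text \<open>The time \<open>Tstar\<close> exceeds by one the bound of \<open>perturbed_blowup\<close> for the constants \<open>b\<close> and \<open>B\<close>, which only
depend on the data. The test function \<open>\<theta>\<close> is chosen after the solution, so that the perturbation is
small compared with \<open>b\<close> on \<open>{0..Tstar}\<close>.\<close>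

lemma wave_blowup:
  fixes V \<phi> \<psi> :: "'a::euclidean_space \<Rightarrow> real"
  assumes V: "continuous_on UNIV V" and bs: "has_positive_bound_state V"
    and phi: "continuous_on UNIV \<phi>" "\<And>x. 0 \<le> \<phi> x"
    and psi: "continuous_on UNIV \<psi>" "\<And>x. 0 \<le> \<psi> x" "\<psi> x0 \<noteq> 0"
    and A: "A > 0" and p: "p > 1"
  obtains Tstar where "Tstar > 0" "\<And>T u. T > Tstar \<Longrightarrow> \<not> cauchy_solution V A p \<phi> \<psi> T u"
proof -
  obtain lam w C0 c where lam: "lam > 0" and w: "\<And>x. w x > 0" "\<And>x. w x \<le> C0 * exp (- c * norm x)"
    and c: "c > 0" and eig: "schroedinger_eigen_eq V (- lam) w"
    using bs unfolding has_positive_bound_state_def exponentially_decaying_def by blast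
  obtain b C1 where b: "b > 0" and C1: "C1 > 0"
    and approx: "\<And>\<delta>. \<delta> > 0 \<Longrightarrow> \<exists>\<theta>. test_function UNIV \<theta> \<and> (\<forall>x. 0 \<le> \<theta> x \<and> \<theta> x \<le> C1 * exp (- c * norm x))
       \<and> b \<le> (LINT x|lborel. \<psi> x * \<theta> x)
       \<and> (\<forall>f. in_H1 f \<longrightarrow> \<bar>LINT x|lborel. f x * (- laplacian \<theta> x + V x * \<theta> x + lam * \<theta> x)\<bar> \<le> \<delta> * H1_norm f)"
    by (rule bound_state_approximation[OF V eig w c psi]) (rule that, assumption+)
  have ie: "integrable lborel (\<lambda>x::'a. C1 * exp (- c * norm x))"
    using integrable_exp_norm[OF c] by (intro integrable_mult_right) 
  define W where "W = 1 + (LINT x|lborel. C1 * exp (- c * norm (x::'a)))"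
  have "0 \<le> (LINT x|lborel. C1 * exp (- c * norm (x::'a)))" using C1 by (intro integral_nonneg_AE) auto
  then have W: "W > 0" by (simp add: W_def)
  define B where "B = A * W powr (1 - p)"
  have B: "B > 0" using A W by (simp add: B_def)
  define q where "q = (b / 2) powr (- ((p - 1) / 2)) / ((p - 1) / 2 * sqrt (2 * B / (p + 1)))"
  have q: "q \<ge> 0" using p B by (simp add: q_def)
  define Ts where "Ts = 2 + q"
  have Ts: "Ts > 0" "Ts \<ge> 1" using q by (auto simp: Ts_def)
  show ?thesis
  proof (rule that[OF Ts(1)])
    fix T u assume T: "T > Ts"
    show "\<not> cauchy_solution V A p \<phi> \<psi> T u"
    proof
      assume "cauchy_solution V A p \<phi> \<psi> T u"
      then obtain v where cu: "continuous_curve in_H1 H1_norm T u" and cv: "continuous_curve in_L2 L2_norm T v"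
        and vel: "weak_deriv (space_time T) (0, 1) (\<lambda>(x, t). u t x) (\<lambda>(x, t). v t x)"
        and wave: "wave_eq V A p T u"
        and init: "AE x in lborel. u 0 x = \<phi> x" "AE x in lborel. v 0 x = \<psi> x"
        unfolding cauchy_solution_def by blast
      have sub: "{0..Ts} \<subseteq> {0..<T}" using T by auto
      have H: "in_H1 (u t)" if "t \<in> {0..Ts}" for t using cu that sub by (auto simp: continuous_curve_def)
      have L: "in_L2 (v t)" if "t \<in> {0..Ts}" for t using cv that sub by (auto simp: continuous_curve_def)
      have H2: "in_L2 f" if "in_H1 f" for f :: "'a \<Rightarrow> real" using that by (simp add: in_H1_def)
      obtain M where M: "M \<ge> 0" and Mb: "\<forall>\<delta> L t. 0 \<le> \<delta> \<longrightarrow> (\<forall>f. in_H1 f \<longrightarrow> \<bar>L f\<bar> \<le> \<delta> * H1_norm f) \<longrightarrow>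
          (\<forall>f g. in_H1 f \<longrightarrow> in_H1 g \<longrightarrow> L (\<lambda>x. f x - g x) = L f - L g) \<longrightarrow>
          t \<in> {0..Ts} \<longrightarrow> \<bar>L (u t)\<bar> \<le> \<delta> * M"
        using continuous_curve_bounded_functional[OF cu T] by (elim exE conjE)
      \<comment> \<open>The perturbation is \<open>\<kappa> = \<delta> * M\<close>, and \<open>\<kappa> * Ts \<le> b / 2\<close> is required below.\<close>
      define \<delta> where "\<delta> = b / (2 * Ts * (M + 1))"
      have \<delta>: "\<delta> > 0" using b Ts M by (simp add: \<delta>_def)
      have kap: "\<delta> * M \<ge> 0" "\<delta> * M * Ts \<le> b / 2"
      proof -
        show "\<delta> * M \<ge> 0" using \<delta> M by simp
        have "\<delta> * M * Ts = b / 2 * (M / (M + 1))" using Ts M by (simp add: \<delta>_def)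
        also have "\<dots> \<le> b / 2 * 1" using b M by (intro mult_left_mono) auto
        finally show "\<delta> * M * Ts \<le> b / 2" by simp
      qed
      obtain \<theta> where th: "test_function UNIV \<theta>" "\<And>x. 0 \<le> \<theta> x" "\<And>x. \<theta> x \<le> C1 * exp (- c * norm x)"
        and mass: "b \<le> (LINT x|lborel. \<psi> x * \<theta> x)"
        and est: "\<And>f. in_H1 f \<Longrightarrow> \<bar>LINT x|lborel. f x * (- laplacian \<theta> x + V x * \<theta> x + lam * \<theta> x)\<bar> \<le> \<delta> * H1_norm f"
        using approx[OF \<delta>] by blast
      have th2: "in_L2 \<theta>"
      proof (rule in_L2_mono(1)[OF in_L2_exp_norm[OF c, of C1]])
        show "\<theta> \<in> borel_measurable lborel"
          using smooth_continuous[OF test_function_smooth[OF th(1)]] by (simp add: borel_measurable_continuous_onI)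
      qed (use th(2,3) in simp)
      have ith: "integrable lborel \<theta>"
        using integrable_mult_test_function[OF locally_integrable_continuous th(1), of "\<lambda>_. 1"] by simp
      have "(LINT x|lborel. \<theta> x) \<le> (LINT x|lborel. C1 * exp (- c * norm (x::'a)))"
        by (rule integral_mono[OF ith ie th(3)])
      then have Wth: "(LINT x|lborel. \<theta> x) \<le> W" by (simp add: W_def)
      define F where "F = (\<lambda>t. LINT x|lborel. u t x * \<theta> x)"
      define F1 where "F1 = (\<lambda>t. LINT x|lborel. v t x * \<theta> x)"
      have "continuous_on {0..<T} F"
        unfolding F_def by (rule continuous_curve_functional[OF cu H2 H1_norm_ge(1) in_H1_diff th2])
      then have cF: "continuous_on {0..Ts} F" using sub by (rule continuous_on_subset)
      have "continuous_on {0..<T} F1"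
        unfolding F1_def by (rule continuous_curve_functional[OF cv _ order_refl in_L2_diff th2])
      then have cF1: "continuous_on {0..Ts} F1" using sub by (rule continuous_on_subset)
      have F0: "0 \<le> F 0"
      proof -
        have "F 0 = (LINT x|lborel. \<phi> x * \<theta> x)"
          unfolding F_def using Ts by (intro integral_cong_continuous_AE H2 H phi init th) auto
        also have "\<dots> \<ge> 0" using phi(2) th(2) by (intro integral_nonneg_AE) auto
        finally show ?thesis .
      qed
      have F10: "b \<le> F1 0"
      proof -
        have "F1 0 = (LINT x|lborel. \<psi> x * \<theta> x)"
          unfolding F1_def using Ts by (intro integral_cong_continuous_AE L psi init th) auto
        with mass show ?thesis by simp
      qed
      have err: "\<bar>LINT x|lborel. u t x * (- laplacian \<theta> x + V x * \<theta> x + lam * \<theta> x)\<bar> \<le> \<delta> * M" if "t \<in> {0..Ts}" for t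
      proof (rule Mb[rule_format, where L = "\<lambda>f. LINT x|lborel. f x * (- laplacian \<theta> x + V x * \<theta> x + lam * \<theta> x)", OF _ est _ that])
        show "0 \<le> \<delta>" using \<delta> by simp
        fix f g :: "'a \<Rightarrow> real" assume "in_H1 f" "in_H1 g"
        then show "(LINT x|lborel. (f x - g x) * (- laplacian \<theta> x + V x * \<theta> x + lam * \<theta> x)) =
           (LINT x|lborel. f x * (- laplacian \<theta> x + V x * \<theta> x + lam * \<theta> x))
           - (LINT x|lborel. g x * (- laplacian \<theta> x + V x * \<theta> x + lam * \<theta> x))"
          using integrable_schroedinger(2)[OF in_L2_locally_integrable[OF H2] V th(1), of f lam]
            integrable_schroedinger(2)[OF in_L2_locally_integrable[OF H2] V th(1), of g lam]
          unfolding left_diff_distrib by (intro Bochner_Integration.integral_diff)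
      qed
      have "Ts \<le> 1 + q"
        unfolding q_def
      proof (rule perturbed_blowup[OF p B b Ts(2) less_imp_le[OF lam] kap cF cF1 F0 F10])
        show "integral {s..t} F1 \<le> F t - F s" if "0 \<le> s" "s \<le> t" "t \<le> Ts" for s t
        proof (rule weak_increment[OF cF cF1 _ that])
          fix \<rho> assume "test_function {0<..<Ts} \<rho>"
          then have "test_function {0<..<T} \<rho>" using T by (auto intro: test_function_mono)
          from moment_weak_velocity[OF vel th(1) this]
          show "(LINT t|lborel. F1 t * \<rho> t) \<le> - (LINT t|lborel. F t * dir_deriv 1 \<rho> t)"
            by (simp add: F_def F1_def)
        qed
        show "integral {s..t} (\<lambda>x. lam * F x + B * max 0 (F x) powr p - \<delta> * M) \<le> F1 t - F1 s"
          if "0 \<le> s" "s \<le> t" "t \<le> Ts" for s t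
        proof (rule weak_increment[OF cF1 _ _ that])
          show "continuous_on {0..Ts} (\<lambda>x. lam * F x + B * max 0 (F x) powr p - \<delta> * M)"
            using p by (intro continuous_intros continuous_on_powr' cF) auto
          fix \<rho> :: "real \<Rightarrow> real" assume rho: "test_function {0<..<Ts} \<rho>" "\<And>t. 0 \<le> \<rho> t"
          show "(LINT t|lborel. (lam * F t + B * max 0 (F t) powr p - \<delta> * M) * \<rho> t) \<le> - (LINT t|lborel. F1 t * dir_deriv 1 \<rho> t)"
            unfolding B_def F1_def
            by (rule moment_weak_inequality[OF V A p wave vel th(1,2) W Wth less_imp_le[OF Ts(1)] T
                  in_L2_locally_integrable[OF H2[OF H]] F_def cF err rho])
        qed
      qed
      then show False by (simp add: Ts_def)
    qed
  qed
qed

theorem theorem1p4: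
  fixes V \<phi> \<psi> :: "real ^ 'n \<Rightarrow> real" and A p :: real
  assumes "continuous_on UNIV V"
    and "has_positive_bound_state V"
    and "continuous_on UNIV \<phi>" and "compact (closure {x. \<phi> x \<noteq> 0})" and "\<And>x. \<phi> x \<ge> 0"
    and "continuous_on UNIV \<psi>" and "compact (closure {x. \<psi> x \<noteq> 0})" and "\<And>x. \<psi> x \<ge> 0"
    and "\<exists>x. \<psi> x \<noteq> 0"
    and "A > 0" and "p > 1"
  shows "\<exists>Tstar>0. \<forall>T>Tstar. \<forall>q::ennreal. 1 \<le> q \<longrightarrow>
    \<not> (\<exists>u. cauchy_solution V A p \<phi> \<psi> T u \<and>
          (\<forall>t\<in>{0..<T}. compactly_supported (u t)) \<and>
          (\<forall>t\<in>{0..<T}. Lp_norm q (u t) < \<infinity>))"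
proof -
  obtain x0 where "\<psi> x0 \<noteq> 0" using assms(9) by blast
  from wave_blowup[OF assms(1,2,3,5,6,8) this assms(10,11)]
  obtain Tstar where "Tstar > 0" "\<And>T u. T > Tstar \<Longrightarrow> \<not> cauchy_solution V A p \<phi> \<psi> T u"
    by metis
  then show ?thesis by blast
qed

end
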